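(* Fix $T>0$. Assume that the Finite Volume Scheme $\Phi^k$ is consistent of order $q>0$. Let $\{k_m\downarrow0\}$ be a decreasing sequence of time steps (with $N_m=k_m^{-1}T$ an integer). Let $u_0\in\mathfrak{U}$ and let $\{\widetilde{\Upsilon^{k_m}}(x,t)\}_{m=1}^\infty$ be the corresponding functions, where, for $k=k_m$, $N=N_m$ and $t_n=nk$, $$\widetilde{\theta^0}=P^ku_0,\qquad \widetilde{\theta^{n+1}}=\Phi^k(\widetilde{\theta^n})\in V^k,\quad n=0,1,\ldots,N-1,$$ $$\widetilde{\Upsilon^k}(x,t)=\frac1k\big[(t_{n+1}-t)\widetilde{\theta^n}(x)+(t-t_n)\widetilde{\theta^{n+1}}(x)\big],\quad t\in[t_n,t_{n+1}],\ n=0,1,\ldots,N-1.$$ Suppose that (i) the sequence $\{\widetilde{\Upsilon^{k_m}}(x,t)\}_{m=1}^\infty$ is uniformly bounded in $L^\infty([0,T],L^\infty(\mathbb{R}))$; (ii) the sequence $\{\widetilde{\Upsilon^{k_m}}(x,t)\}_{m=1}^\infty$ converges in $C([0,T],L^1_{loc}(\mathbb{R}))$ to a function $v(x,t)$ (in particular it is uniformly bounded in this space). Then $v(x,t)$ is a solution of the balance law in $\mathbb{R}\times[0,T]$.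
   Context: Setting. Fix $D\ge1$ and a (continuous) flux $f:\mathbb{R}^D\to\mathbb{R}^D$. Let $\mathfrak{U}^b,\mathfrak{U}^c$ be Banach spaces of ($\mathbb{R}^D$-valued) functions on $\mathbb{R}$, $\mathfrak{U}=\mathfrak{U}^b\cap\mathfrak{U}^c$ with norm $\|w\|_{\mathfrak{U}}=\|w\|_b+\|w\|_c$; $\mathfrak{U}$ is assumed to be a persistence space, i.e. solutions with initial data in $\mathfrak{U}$ are continuous in time with values in $\mathfrak{U}^c$ and bounded in time with values in $\mathfrak{U}^b$. The balance law (for $u_t+f(u)_x=0$) is $$\int_{x_1}^{x_2}u(x,t_2)dx-\int_{x_1}^{x_2}u(x,t_1)dx=-\Big[\int_{t_1}^{t_2}f(u(x_2,t))dt-\int_{t_1}^{t_2}f(u(x_1,t))dt\Big].$$ A function $u(\cdot,t)$, continuous in $t$ with values in $\mathfrak{U}^c$ and bounded in $t$ with values in $\mathfrak{U}^b$, is a solution of the balance law (in $\mathbb{R}\times[0,T]$, with all times restricted to $[0,T]$) if: for every $x$ and $[t_1,t_2]$, $\int_{t_1}^{t_2}f(u(x,t))dt$ is well defined and continuous in $x$; for every $t$ and $[x_1,x_2]$, $\int_{x_1}^{x_2}u(x,t)dx$ is well defined and continuous in $t$; and the balance law holds on every rectangle $[x_1,x_2]\times[t_1,t_2]$. Convention: flux integrals $x\mapsto\int_{t_1}^{t_2}f(u(x,t))dt$ are understood up to modification on $x$-null sets, i.e. as their continuous representative. $L^1_{loc}(\mathbb{R})$ carries the metric $d(y,z)=\sum_{N\ge1}2^{-N}\frac{\int_{-N}^N|y-z|dx}{1+\int_{-N}^N|y-z|dx}$.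 Grid. $k=\Delta t>0$ is the time step, $h=\Delta x=\lambda^{-1}k$ with $\lambda>0$ fixed, $\lambda<\lambda_0$ ($\lambda_0$ below), $x_j=jh$, $x_{j\pm\frac12}=x_j\pm\frac h2$, $I_j=(x_{j-\frac12},x_{j+\frac12})$. Spaces. $V^k\subseteq\mathfrak{U}$ is a subspace whose restrictions to any grid cell $I_j$ form a finite dimensional space (its dimension is the order of $V^k$; typically piecewise polynomials of fixed degree, possibly discontinuous at cell boundaries), and $P^k:\mathfrak{U}\to V^k$ is a projection with $\int_{I_j}P^kv\,dx=\int_{I_j}v\,dx$ for all $j$ and $v\in\mathfrak{U}$. Short-time solutions. For each $\xi\in V^k$ the balance law is assumed to have a unique solution on $[0,k]$ with initial data $\xi$ (uniqueness possibly being achieved by imposing constraints such as entropy conditions), denoted $u(x,t;\xi)=S(t)\xi\in\mathfrak{U}$. Approximate fluxes. There is $\lambda_0>0$ such that for every fixed $\lambda=k/h<\lambda_0$, $0<k<\frac12T$, and $\xi\in V^k$ there is a sequence of continuous functions $F^\xi_{j+\frac12}(t)$, $0\le t<k$, $j\in\mathbb{Z}$. They are approximate fluxes if $F^\xi_{j+\frac12}(t)$ depends only on the restriction of $\xi$ to $I_j\cup I_{j+1}$, and $F^\xi_{j+\frac12}(t)\equiv f(c)$ whenever $\xi\equiv c$ is constant on $I_j\cup I_{j+1}$. Admissible sets. $H\subseteq\bigcup_{0<k<\frac12T}V^k$ is admissible if for every $\lambda=k/h<\lambda_0$ the set $H\cap V^k$ is bounded in $\mathfrak{U}$ and compact in $L^1_{loc}(\mathbb{R})$.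 Consistency. For $q\ge0$ the fluxes are consistent of order $q$ if for every admissible $H$ there is $C>0$ depending only on $H$ such that for all $\xi\in H\cap V^k$ and all $j$, $$\Big|\int_0^k\big[F^\xi_{j+\frac12}(t)-F^\xi_{j-\frac12}(t)\big]dt-\int_0^k\big[f(u(x_{j+\frac12},t;\xi))-f(u(x_{j-\frac12},t;\xi))\big]dt\Big|\le Ck^{2+q}.$$ Finite Volume Scheme (FVS). An approximate evolution operator associated with the fluxes is a map $\widetilde{S(k)}:V^k\to\mathfrak{U}$ with $$\int_{I_j}\widetilde{S(k)}\xi\,dx-\int_{I_j}\xi\,dx=-\int_0^k\big[F^\xi_{j+\frac12}(t)-F^\xi_{j-\frac12}(t)\big]dt,\qquad \xi\in V^k,\ j\in\mathbb{Z}.$$ A family of maps $\{\Phi^k:V^k\to V^k\}_{k>0}$ is an FVS if $\Phi^k=P^k\widetilde{S(k)}$; it is consistent of order $q$ if its fluxes are.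
   Formalization: Adds: for data in V^k bounded in L^∞ and convergent in L^1_loc as k→0, S(t), 0≤t≤k, stays bounded with the same limit (false otherwise, e.g. f(u1,u2)=(u2,0) with interface spikes). Admissible H lies in the disjoint union of the V^k; persistence covers all bounded C([0,T],L^1_loc) solutions. *)

theory Defs
  imports "HOL-Analysis.Analysis"
begin

(* Functions of x are taken modulo Lebesgue-null sets, represented by Borel functions.
   Functions of (x,t) are curves "u t x", i.e. time comes first. *)

type_synonym 'd fld = "real \<Rightarrow> real ^ 'd"

section \<open>Function spaces\<close>

definition L1loc :: "'d::finite fld set" where
  "L1loc = {w. \<forall>a b. set_integrable lborel {a..b} w}"

definition L1loc_dist :: "'d::finite fld \<Rightarrow> 'd fld \<Rightarrow> real" where
  "L1loc_dist y z =
     (\<Sum>n. let I = (LINT x:{- real (Suc n)..real (Suc n)}|lborel. norm (y x - z x))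
           in (1/2) ^ Suc n * (I / (1 + I)))"

definition C_L1loc :: "real \<Rightarrow> (real \<Rightarrow> 'd::finite fld) \<Rightarrow> bool" where
  "C_L1loc T u \<longleftrightarrow> (\<forall>t\<in>{0..T}. u t \<in> L1loc \<and>
       ((\<lambda>s. L1loc_dist (u s) (u t)) \<longlongrightarrow> 0) (at t within {0..T}))"

definition Linf_bound :: "real \<Rightarrow> (real \<Rightarrow> 'd::finite fld) \<Rightarrow> real \<Rightarrow> bool" where
  "Linf_bound T u M \<longleftrightarrow>
     (AE t in lborel. t \<in> {0..T} \<longrightarrow> (AE x in lborel. norm (u t x) \<le> M))"

definition banach_function_space :: "'d::finite fld set \<Rightarrow> ('d fld \<Rightarrow> real) \<Rightarrow> bool" where
  "banach_function_space W nrm \<longleftrightarrow>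
     W \<subseteq> borel_measurable borel \<and> (\<lambda>x. 0) \<in> W \<and>
     (\<forall>a b. \<forall>v\<in>W. \<forall>w\<in>W. (\<lambda>x. a *\<^sub>R v x + b *\<^sub>R w x) \<in> W) \<and>
     (\<forall>w\<in>W. \<forall>w'\<in>borel_measurable borel. (AE x in lborel. w' x = w x) \<longrightarrow> w' \<in> W) \<and>
     (\<forall>w\<in>W. 0 \<le> nrm w) \<and>
     (\<forall>w\<in>W. nrm w = 0 \<longleftrightarrow> (AE x in lborel. w x = 0)) \<and>
     (\<forall>a. \<forall>w\<in>W. nrm (\<lambda>x. a *\<^sub>R w x) = \<bar>a\<bar> * nrm w) \<and>
     (\<forall>v\<in>W. \<forall>w\<in>W. nrm (\<lambda>x. v x + w x) \<le> nrm v + nrm w) \<and>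
     (\<forall>X. (\<forall>n::nat. X n \<in> W) \<and>
          (\<forall>e>0. \<exists>M. \<forall>m\<ge>M. \<forall>n\<ge>M. nrm (\<lambda>x. X m x - X n x) < e)
          \<longrightarrow> (\<exists>w\<in>W. (\<lambda>n. nrm (\<lambda>x. X n x - w x)) \<longlonglongrightarrow> 0))"

section \<open>The balance law\<close>

(* g is the continuous representative of x |-> int_{t1}^{t2} f(u(x,t)) dt.  The curve u fixes
   u(.,t) only up to x-null sets for each t, so the t-integral at a given x is computed with a
   jointly measurable version w of u; by Fubini, g does not depend on the choice of w. *)
definition is_flux_integral ::
  "(real ^ 'd \<Rightarrow> real ^ 'd) \<Rightarrow> (real \<Rightarrow> 'd::finite fld) \<Rightarrow> real \<Rightarrow> real \<Rightarrow> 'd fld \<Rightarrow> bool" where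
  "is_flux_integral f u t1 t2 g \<longleftrightarrow> continuous_on UNIV g \<and>
     (\<exists>w. (\<lambda>(t, x). w t x) \<in> borel_measurable (borel :: (real \<times> real) measure) \<and>
          (\<forall>t\<in>{t1..t2}. AE x in lborel. w t x = u t x) \<and>
          (AE x in lborel. set_integrable lborel {t1..t2} (\<lambda>t. f (w t x)) \<and>
                           g x = (LINT t:{t1..t2}|lborel. f (w t x))))"

definition flux_integral ::
  "(real ^ 'd \<Rightarrow> real ^ 'd) \<Rightarrow> (real \<Rightarrow> 'd::finite fld) \<Rightarrow> real \<Rightarrow> real \<Rightarrow> 'd fld" where
  "flux_integral f u t1 t2 = (SOME g. is_flux_integral f u t1 t2 g)"

definition balance_law ::
  "(real ^ 'd \<Rightarrow> real ^ 'd) \<Rightarrow> real \<Rightarrow> (real \<Rightarrow> 'd::finite fld) \<Rightarrow> bool" where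
  "balance_law f T u \<longleftrightarrow>
     (\<forall>t1 t2. 0 \<le> t1 \<and> t1 \<le> t2 \<and> t2 \<le> T \<longrightarrow> (\<exists>g. is_flux_integral f u t1 t2 g)) \<and>
     (\<forall>t\<in>{0..T}. u t \<in> L1loc) \<and>
     (\<forall>x1 x2. x1 \<le> x2 \<longrightarrow> continuous_on {0..T} (\<lambda>t. LINT x:{x1..x2}|lborel. u t x)) \<and>
     (\<forall>t1 t2 x1 x2. 0 \<le> t1 \<and> t1 \<le> t2 \<and> t2 \<le> T \<and> x1 \<le> x2 \<longrightarrow>
        (LINT x:{x1..x2}|lborel. u t2 x) - (LINT x:{x1..x2}|lborel. u t1 x)
          = - (flux_integral f u t1 t2 x2 - flux_integral f u t1 t2 x1))"

definition continuous_bounded_curve ::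
  "'d::finite fld set \<Rightarrow> ('d fld \<Rightarrow> real) \<Rightarrow> 'd fld set \<Rightarrow> ('d fld \<Rightarrow> real) \<Rightarrow>
   real \<Rightarrow> (real \<Rightarrow> 'd fld) \<Rightarrow> bool" where
  "continuous_bounded_curve Ub nb Uc nc T u \<longleftrightarrow>
     (\<forall>t\<in>{0..T}. u t \<in> Uc \<and>
        ((\<lambda>s. nc (\<lambda>x. u s x - u t x)) \<longlongrightarrow> 0) (at t within {0..T})) \<and>
     (\<exists>M. \<forall>t\<in>{0..T}. u t \<in> Ub \<and> nb (u t) \<le> M)"

definition solution ::
  "(real ^ 'd \<Rightarrow> real ^ 'd) \<Rightarrow> 'd::finite fld set \<Rightarrow> ('d fld \<Rightarrow> real) \<Rightarrow>
   'd fld set \<Rightarrow> ('d fld \<Rightarrow> real) \<Rightarrow> real \<Rightarrow> (real \<Rightarrow> 'd fld) \<Rightarrow> bool" where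
  "solution f Ub nb Uc nc T u \<longleftrightarrow>
     continuous_bounded_curve Ub nb Uc nc T u \<and> balance_law f T u"

(* Persistence is only required of bounded functions u in C([0,T], L1loc) satisfying the
   balance law, not of unbounded ones. *)
definition persistence_space ::
  "(real ^ 'd \<Rightarrow> real ^ 'd) \<Rightarrow> 'd::finite fld set \<Rightarrow> ('d fld \<Rightarrow> real) \<Rightarrow>
   'd fld set \<Rightarrow> ('d fld \<Rightarrow> real) \<Rightarrow> real \<Rightarrow> bool" where
  "persistence_space f Ub nb Uc nc T \<longleftrightarrow>
     (\<forall>u. C_L1loc T u \<and> (\<exists>M. Linf_bound T u M) \<and> balance_law f T u \<and> u 0 \<in> Ub \<inter> Uc
        \<longrightarrow> continuous_bounded_curve Ub nb Uc nc T u)"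

(* E is the additional constraint (e.g. an entropy condition; E = (%_ _. True) for none)
   that singles out the solution S(t) xi among all solutions with initial data xi. *)
definition short_time_solutions ::
  "(real ^ 'd \<Rightarrow> real ^ 'd) \<Rightarrow> 'd::finite fld set \<Rightarrow> ('d fld \<Rightarrow> real) \<Rightarrow>
   'd fld set \<Rightarrow> ('d fld \<Rightarrow> real) \<Rightarrow> (real \<Rightarrow> (real \<Rightarrow> 'd fld) \<Rightarrow> bool) \<Rightarrow>
   real \<Rightarrow> 'd fld set \<Rightarrow> (real \<Rightarrow> 'd fld \<Rightarrow> 'd fld) \<Rightarrow> bool" where
  "short_time_solutions f Ub nb Uc nc E k V S \<longleftrightarrow>
     (\<forall>\<xi>\<in>V. solution f Ub nb Uc nc k (\<lambda>t. S t \<xi>) \<and> E k (\<lambda>t. S t \<xi>) \<and>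
        (AE x in lborel. S 0 \<xi> x = \<xi> x) \<and>
        (\<forall>u. solution f Ub nb Uc nc k u \<and> E k u \<and> (AE x in lborel. u 0 x = \<xi> x)
             \<longrightarrow> (\<forall>t\<in>{0..k}. AE x in lborel. u t x = S t \<xi> x)))"

(* Persistence of the exact evolution, locally uniformly in the data: if data xi_m in V^{kappa_m}
   are bounded in Linf and converge in L1loc, and 0 <= tau_m <= kappa_m -> 0, then
   S(tau_m) xi_m stays bounded in Linf and has the same limit in L1loc.  This is an additional
   assumption: persistence for each single datum does not control S(t) on data varying with
   the grid, e.g. for u1_t + u2_x = 0, u2_t = 0 and data with narrow spikes of u2 at the cell
   boundaries, where the interface fluxes need not approximate f(v). *)
definition uniform_short_time_persistence ::
  "real \<Rightarrow> (real \<Rightarrow> 'd::finite fld set) \<Rightarrow> (real \<Rightarrow> 'd fld \<Rightarrow> 'd fld) \<Rightarrow> bool" where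
  "uniform_short_time_persistence T V S \<longleftrightarrow>
     (\<forall>(\<kappa> :: nat \<Rightarrow> real) \<tau> \<xi>. \<forall>w\<in>L1loc. \<forall>M.
        \<kappa> \<longlonglongrightarrow> 0 \<and>
        (\<forall>m. 0 < \<kappa> m \<and> \<kappa> m < T / 2 \<and> 0 \<le> \<tau> m \<and> \<tau> m \<le> \<kappa> m \<and> \<xi> m \<in> V (\<kappa> m) \<and>
             (AE x in lborel. norm (\<xi> m x) \<le> M)) \<and>
        (\<lambda>m. L1loc_dist (\<xi> m) w) \<longlonglongrightarrow> 0
        \<longrightarrow> (\<exists>M'. \<forall>m. AE x in lborel. norm (S (\<tau> m) (\<xi> m) x) \<le> M') \<and>
            (\<lambda>m. L1loc_dist (S (\<tau> m) (\<xi> m)) w) \<longlonglongrightarrow> 0)"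

section \<open>Finite volume schemes\<close>

(* half_pt lam k j is x_{j+1/2} for the mesh size h = k / lam *)
definition half_pt :: "real \<Rightarrow> real \<Rightarrow> int \<Rightarrow> real" where
  "half_pt lam k j = (real_of_int j + 1/2) * (k / lam)"

definition cell :: "real \<Rightarrow> real \<Rightarrow> int \<Rightarrow> real set" where
  "cell lam k j = {half_pt lam k (j - 1) <..< half_pt lam k j}"

definition fv_space :: "'d::finite fld set \<Rightarrow> real \<Rightarrow> real \<Rightarrow> 'd fld set \<Rightarrow> bool" where
  "fv_space U lam k V \<longleftrightarrow>
     V \<subseteq> U \<and> (\<lambda>x. 0) \<in> V \<and>
     (\<forall>a b. \<forall>v\<in>V. \<forall>w\<in>V. (\<lambda>x. a *\<^sub>R v x + b *\<^sub>R w x) \<in> V) \<and>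
     (\<forall>j. \<exists>B :: 'd fld set. finite B \<and>
        (\<forall>\<xi>\<in>V. \<exists>c. AE x in lborel. x \<in> cell lam k j \<longrightarrow> \<xi> x = (\<Sum>b\<in>B. c b *\<^sub>R b x)))"

(* Linearity of P is not required. *)
definition fv_projection ::
  "'d::finite fld set \<Rightarrow> real \<Rightarrow> real \<Rightarrow> 'd fld set \<Rightarrow> ('d fld \<Rightarrow> 'd fld) \<Rightarrow> bool" where
  "fv_projection U lam k V P \<longleftrightarrow>
     (\<forall>v\<in>U. P v \<in> V) \<and>
     (\<forall>\<xi>\<in>V. AE x in lborel. P \<xi> x = \<xi> x) \<and>
     (\<forall>v\<in>U. \<forall>j. (LINT x:cell lam k j|lborel. P v x) = (LINT x:cell lam k j|lborel. v x))"

(* F xi j t is F^xi_{j+1/2}(t) *)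
definition approximate_fluxes ::
  "(real ^ 'd \<Rightarrow> real ^ 'd) \<Rightarrow> real \<Rightarrow> real \<Rightarrow> 'd::finite fld set \<Rightarrow>
   ('d fld \<Rightarrow> int \<Rightarrow> real \<Rightarrow> real ^ 'd) \<Rightarrow> bool" where
  "approximate_fluxes f lam k V F \<longleftrightarrow>
     (\<forall>\<xi>\<in>V. \<forall>j. continuous_on {0..<k} (F \<xi> j) \<and> set_integrable lborel {0..<k} (F \<xi> j)) \<and>
     (\<forall>\<xi>\<in>V. \<forall>\<eta>\<in>V. \<forall>j.
        (AE x in lborel. x \<in> cell lam k j \<union> cell lam k (j + 1) \<longrightarrow> \<xi> x = \<eta> x)
        \<longrightarrow> (\<forall>t\<in>{0..<k}. F \<xi> j t = F \<eta> j t)) \<and>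
     (\<forall>\<xi>\<in>V. \<forall>j c.
        (AE x in lborel. x \<in> cell lam k j \<union> cell lam k (j + 1) \<longrightarrow> \<xi> x = c)
        \<longrightarrow> (\<forall>t\<in>{0..<k}. F \<xi> j t = f c))"

(* The slice of H at step k is H k, so that H is a subset of the disjoint union of the V^k:
   an element of V^k is a function together with its grid, on which its fluxes depend.
   Compactness in the metrizable space L1loc is stated sequentially. *)
definition admissible ::
  "('d::finite fld \<Rightarrow> real) \<Rightarrow> ('d fld \<Rightarrow> real) \<Rightarrow> real \<Rightarrow> (real \<Rightarrow> 'd fld set) \<Rightarrow>
   (real \<Rightarrow> 'd fld set) \<Rightarrow> bool" where
  "admissible nb nc T V H \<longleftrightarrow>
     (\<forall>k. 0 < k \<and> k < T / 2 \<longrightarrow>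
        H k \<subseteq> V k \<and>
        (\<exists>B. \<forall>\<xi>\<in>H k. nb \<xi> + nc \<xi> \<le> B) \<and>
        (\<forall>X. (\<forall>n::nat. X n \<in> H k) \<longrightarrow>
             (\<exists>\<xi>\<in>H k. \<exists>r. strict_mono r \<and> (\<lambda>n. L1loc_dist (X (r n)) \<xi>) \<longlonglongrightarrow> 0)))"

definition consistent_of_order ::
  "real \<Rightarrow> (real ^ 'd \<Rightarrow> real ^ 'd) \<Rightarrow> ('d::finite fld \<Rightarrow> real) \<Rightarrow> ('d fld \<Rightarrow> real) \<Rightarrow>
   real \<Rightarrow> real \<Rightarrow> (real \<Rightarrow> 'd fld set) \<Rightarrow> (real \<Rightarrow> 'd fld \<Rightarrow> 'd fld) \<Rightarrow>
   (real \<Rightarrow> 'd fld \<Rightarrow> int \<Rightarrow> real \<Rightarrow> real ^ 'd) \<Rightarrow> bool" where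
  "consistent_of_order q f nb nc T lam V S F \<longleftrightarrow>
     (\<forall>H. admissible nb nc T V H \<longrightarrow>
        (\<exists>C>0. \<forall>k. 0 < k \<and> k < T / 2 \<longrightarrow> (\<forall>\<xi>\<in>H k. \<forall>j.
           norm ((LINT t:{0..<k}|lborel. F k \<xi> j t - F k \<xi> (j - 1) t)
                 - (flux_integral f (\<lambda>t. S t \<xi>) 0 k (half_pt lam k j)
                    - flux_integral f (\<lambda>t. S t \<xi>) 0 k (half_pt lam k (j - 1))))
           \<le> C * k powr (2 + q))))"

definition approximate_evolution ::
  "'d::finite fld set \<Rightarrow> real \<Rightarrow> real \<Rightarrow> 'd fld set \<Rightarrow>
   ('d fld \<Rightarrow> int \<Rightarrow> real \<Rightarrow> real ^ 'd) \<Rightarrow> ('d fld \<Rightarrow> 'd fld) \<Rightarrow> bool" where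
  "approximate_evolution U lam k V F St \<longleftrightarrow>
     (\<forall>\<xi>\<in>V. St \<xi> \<in> U \<and>
        (\<forall>j. (LINT x:cell lam k j|lborel. St \<xi> x) - (LINT x:cell lam k j|lborel. \<xi> x)
             = - (LINT t:{0..<k}|lborel. F \<xi> j t - F \<xi> (j - 1) t)))"

definition finite_volume_scheme ::
  "'d::finite fld set \<Rightarrow> real \<Rightarrow> real \<Rightarrow> 'd fld set \<Rightarrow> ('d fld \<Rightarrow> 'd fld) \<Rightarrow>
   ('d fld \<Rightarrow> int \<Rightarrow> real \<Rightarrow> real ^ 'd) \<Rightarrow> ('d fld \<Rightarrow> 'd fld) \<Rightarrow> bool" where
  "finite_volume_scheme U lam k V P F \<Phi> \<longleftrightarrow>
     (\<exists>St. approximate_evolution U lam k V F St \<and> (\<forall>\<xi>\<in>V. \<Phi> \<xi> = P (St \<xi>)))"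

fun fvs_iterate :: "('d::finite fld \<Rightarrow> 'd fld) \<Rightarrow> ('d fld \<Rightarrow> 'd fld) \<Rightarrow> 'd fld \<Rightarrow> nat \<Rightarrow> 'd fld" where
  "fvs_iterate P \<Phi> u0 0 = P u0"
| "fvs_iterate P \<Phi> u0 (Suc n) = \<Phi> (fvs_iterate P \<Phi> u0 n)"

(* Piecewise linear in time with value th n at t = n k; at t = n k the term th (Suc n) has
   coefficient 0, so on [0, N k] only th 0, ..., th N enter. *)
definition time_interpolant :: "real \<Rightarrow> (nat \<Rightarrow> 'd::finite fld) \<Rightarrow> real \<Rightarrow> 'd fld" where
  "time_interpolant k th t x =
     (let n = nat \<lfloor>t / k\<rfloor> in
      (1 / k) *\<^sub>R ((real (Suc n) * k - t) *\<^sub>R th n x + (t - real n * k) *\<^sub>R th (Suc n) x))"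

end

theory Submission
  imports Defs
begin

text \<open>Summing the scheme over time steps and telescoping over cells turns the cell balances into the
  balance law for the exact short-time flows, at the cost of \<open>O(k\<^sup>q)\<close> by consistency. Two passages to
  the limit remain. Uniform persistence and compactness of \<open>[0, T]\<close> make the short-time flows converge
  to the limit uniformly in the time step, so their flux integrals converge in \<open>L\<^sup>1\<close> in space. The
  flux at the cell boundary next to \<open>x\<close> may replace the flux at \<open>x\<close>, because the exact balance law
  bounds the error by the \<open>L\<^sup>1\<close> increment of one short-time step over an interval of length \<open>h\<close>;
  averaging over \<open>x\<close> gains the factor \<open>h\<close> that compensates the number of steps. Hence for every \<open>t\<close>
  the function \<open>x \<mapsto> \<integral>\<^sub>0\<^sup>t f(v(x,s)) ds + \<integral>\<^sub>0\<^sup>x (v(y,t) - v(y,0)) dy\<close> is almost everywhere constant,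
  which is the balance law. Finally \<open>v(\<sqdot>,0) = u\<^sub>0\<close> since the projection keeps cell averages, so the
  persistence property applies.\<close>

section \<open>Convergence in L1loc\<close>

text \<open>Consistency compares differences of numerical and exact fluxes across one cell, never a
  single flux, so telescoping reaches a half point only relative to another one and leaves a
  function of time undetermined. This is why the target is a constant in x for each t. The exponent
  2 + q pays for the accumulation: about R lam / k cells and T / k steps, each with an error C
  k^(2+q), leave a multiple of k^q, which vanishes since q > 0. The second obstacle is null sets.
  Each \<open>v t\<close> is a class modulo null sets in x, and grid points form a null set, so
  convergence in L1loc says nothing about fluxes at half points; every comparison has to be averaged
  over x first. A time integral at fixed x moreover needs a version of v that is measurable in (t,
  x) jointly; it is built from the interpolants. The continuous representative of the flux integral
  is not guessed: constancy of the residual almost everywhere exhibits it as a constant minus an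
  increment of primitives, which is continuous by itself.\<close>

definition L1_seminorm :: "real \<Rightarrow> 'd::finite fld \<Rightarrow> real" where
  "L1_seminorm R y = (LINT x:{-R..R}|lborel. norm (y x))"

lemma L1_seminorm_nonneg: "0 \<le> L1_seminorm R y"
  unfolding L1_seminorm_def set_lebesgue_integral_def
  by (intro integral_nonneg_AE) auto

lemma L1loc_integrable: "w \<in> L1loc \<Longrightarrow> set_integrable lborel {a..b} w"
  by (simp add: L1loc_def)

text \<open>\<open>L1loc\<close> only speaks of the truncations of \<open>w\<close> to compact
  intervals; at each point these are eventually equal to \<open>w\<close>, so measurability passes
  to the limit.\<close>

lemma L1loc_borel_measurable:
  assumes "w \<in> L1loc"
  shows "w \<in> borel_measurable borel"
proof (rule borel_measurable_LIMSEQ_metric)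
  fix n :: nat
  show "(\<lambda>x. indicator {- real n..real n} x *\<^sub>R w x) \<in> borel_measurable borel"
    using L1loc_integrable[OF assms, of "- real n" "real n"]
    unfolding set_integrable_def by (auto dest: borel_measurable_integrable)
next
  fix x :: real
  have "\<forall>\<^sub>F n in sequentially. indicator {- real n..real n} x *\<^sub>R w x = w x"
    using eventually_ge_at_top[of "nat \<lceil>\<bar>x\<bar>\<rceil>"]
  proof eventually_elim
    case (elim n)
    then have "\<bar>x\<bar> \<le> real n" by linarith
    then show ?case by (auto simp: indicator_def)
  qed
  then show "(\<lambda>n. indicator {- real n..real n} x *\<^sub>R w x) \<longlonglongrightarrow> w x"
    by (rule tendsto_eventually)
qed

lemma L1loc_diff: "y \<in> L1loc \<Longrightarrow> z \<in> L1loc \<Longrightarrow> (\<lambda>x. y x - z x) \<in> L1loc"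
  by (simp add: L1loc_def set_integral_diff)

lemma L1loc_bounded:
  assumes "y \<in> borel_measurable borel" and "AE x in lborel. norm (y x) \<le> B"
  shows "y \<in> L1loc"
  unfolding L1loc_def mem_Collect_eq set_integrable_def
proof (intro allI)
  fix a b :: real
  show "integrable lborel (\<lambda>x. indicator {a..b} x *\<^sub>R y x)"
  proof (rule integrableI_bounded_set[where A="{a..b}" and B=B])
    show "AE x\<in>{a..b} in lborel. norm (indicator {a..b} x *\<^sub>R y x) \<le> B"
      using assms(2) by eventually_elim auto
  qed (use assms(1) in \<open>auto simp: emeasure_lborel_Icc_eq\<close>)
qed

lemma L1loc_add: "y \<in> L1loc \<Longrightarrow> z \<in> L1loc \<Longrightarrow> (\<lambda>x. y x + z x) \<in> L1loc"
  by (simp add: L1loc_def set_integral_add)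

lemma L1loc_continuous: "continuous_on UNIV y \<Longrightarrow> y \<in> L1loc"
  unfolding L1loc_def by (auto intro: borel_integrable_atLeastAtMost' continuous_on_subset)

lemma L1_seminorm_mono:
  assumes "y \<in> L1loc" and "R \<le> R'"
  shows "L1_seminorm R y \<le> L1_seminorm R' y"
proof -
  have i: "set_integrable lborel {-r..r} (\<lambda>s. norm (y s))" for r
    by (intro set_integrable_norm L1loc_integrable assms)
  show ?thesis
    unfolding L1_seminorm_def set_lebesgue_integral_def
    by (intro integral_mono i[unfolded set_integrable_def]) (use assms(2) in \<open>auto simp: indicator_def\<close>)
qed

lemma L1_seminorm_triangle:
  assumes "x \<in> L1loc" "y \<in> L1loc" "z \<in> L1loc"
  shows "L1_seminorm R (\<lambda>s. x s - z s) \<le> L1_seminorm R (\<lambda>s. x s - y s) + L1_seminorm R (\<lambda>s. y s - z s)"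
proof -
  have i: "set_integrable lborel {-R..R} (\<lambda>s. norm (x s - y s))"
    "set_integrable lborel {-R..R} (\<lambda>s. norm (y s - z s))"
    "set_integrable lborel {-R..R} (\<lambda>s. norm (x s - z s))"
    by (auto intro!: set_integrable_norm L1loc_integrable L1loc_diff assms)
  show ?thesis
    unfolding L1_seminorm_def set_integral_add(2)[OF i(1,2), symmetric]
    by (intro set_integral_mono set_integral_add i) (rule norm_diff_triangle_le[OF order_refl order_refl])
qed

lemma L1loc_dist_eq:
  "L1loc_dist y z = (\<Sum>n. (1/2) ^ Suc n *
     (L1_seminorm (real (Suc n)) (\<lambda>x. y x - z x) / (1 + L1_seminorm (real (Suc n)) (\<lambda>x. y x - z x))))"
  unfolding L1loc_dist_def L1_seminorm_def Let_def ..

lemma summable_L1loc_dist: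
  "summable (\<lambda>n. (1/2) ^ Suc n *
     (L1_seminorm (real (Suc n)) y / (1 + L1_seminorm (real (Suc n)) y)))"
proof (rule summable_comparison_test)
  show "summable (\<lambda>n. (1/2::real) ^ Suc n)"
    by (subst summable_Suc_iff) simp
  have le1: "a / (1 + a) \<le> 1" if "0 \<le> a" for a :: real
    using that by (simp add: field_simps)
  show "\<exists>N. \<forall>n\<ge>N. norm ((1/2) ^ Suc n *
     (L1_seminorm (real (Suc n)) y / (1 + L1_seminorm (real (Suc n)) y))) \<le> (1/2) ^ Suc n"
    by (intro exI[of _ 0] allI impI)
      (simp add: abs_mult L1_seminorm_nonneg mult_left_le le1 del: power_Suc of_nat_Suc times_divide_eq_right)
qed

lemma L1loc_dist_nonneg: "0 \<le> L1loc_dist y z"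
  unfolding L1loc_dist_eq
  by (intro suminf_nonneg summable_L1loc_dist) (simp add: L1_seminorm_nonneg)

text \<open>A single term of the series bounds the metric d from below, so s / (1 + s) <= 2^(n+1) d
  for the seminorm s. As s / (1 + s) is bounded, a linear bound on s is possible only for small d:
  once the right side is at most 1/2, s <= 1 and then s <= 2 s / (1 + s).\<close>

lemma L1_seminorm_le_dist:
  assumes "2 ^ Suc n * L1loc_dist y z \<le> 1/2"
  shows "L1_seminorm (real (Suc n)) (\<lambda>x. y x - z x) \<le> 2 ^ Suc (Suc n) * L1loc_dist y z"
proof -
  define a where "a = L1_seminorm (real (Suc n)) (\<lambda>x. y x - z x)"
  have a0: "0 \<le> a" by (simp add: a_def L1_seminorm_nonneg)
  have "(1/2) ^ Suc n * (a / (1 + a)) \<le> L1loc_dist y z"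
    unfolding L1loc_dist_eq a_def
    using sum_le_suminf[OF summable_L1loc_dist, of "{n}" "\<lambda>x. y x - z x"]
    by (simp add: L1_seminorm_nonneg)
  then have le: "a / (1 + a) \<le> 2 ^ Suc n * L1loc_dist y z"
    by (simp only: power_divide power_one times_divide_eq_left mult_1_left pos_divide_le_eq
        zero_less_power zero_less_numeral) (simp only: mult.commute)
  with assms have "a / (1 + a) \<le> 1/2" by linarith
  with a0 have "a \<le> 1" by (simp add: field_simps)
  with a0 have "a \<le> 2 * (a / (1 + a))"
    using mult_left_mono[of "1 + a" 2 a] by (simp add: pos_le_divide_eq mult.commute)
  with le show ?thesis by (simp add: a_def)
qed

text \<open>The map s / (1 + s) is increasing and subadditive for s >= 0, so the triangle inequality
  of each seminorm survives it term by term.\<close>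

lemma L1loc_dist_triangle:
  assumes "x \<in> L1loc" "y \<in> L1loc" "z \<in> L1loc"
  shows "L1loc_dist x z \<le> L1loc_dist x y + L1loc_dist y z"
proof -
  have frac: "c / (1 + c) \<le> a / (1 + a) + b / (1 + b)"
    if "0 \<le> a" "0 \<le> b" "0 \<le> c" "c \<le> a + b" for a b c :: real
  proof -
    have eq: "s / (1 + s) = 1 - 1 / (1 + s)" if "0 \<le> s" for s :: real
      using that by (simp add: field_simps)
    have "1 / (1 + (a + b)) \<le> 1 / (1 + c)"
      using that by (intro frac_le) auto
    then have "c / (1 + c) \<le> (a + b) / (1 + (a + b))"
      using that eq[of c] eq[of "a + b"] by linarith
    also have "\<dots> = a / (1 + (a + b)) + b / (1 + (a + b))"
      by (simp add: add_divide_distrib)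
    also have "\<dots> \<le> a / (1 + a) + b / (1 + b)"
      using that by (intro add_mono divide_left_mono) (auto intro!: mult_pos_pos)
    finally show ?thesis .
  qed
  show ?thesis
    unfolding L1loc_dist_eq suminf_add[OF summable_L1loc_dist summable_L1loc_dist]
      distrib_left[symmetric]
  proof (rule suminf_le)
    fix n
    show "(1/2) ^ Suc n * (L1_seminorm (real (Suc n)) (\<lambda>s. x s - z s) /
          (1 + L1_seminorm (real (Suc n)) (\<lambda>s. x s - z s)))
       \<le> (1/2) ^ Suc n * (L1_seminorm (real (Suc n)) (\<lambda>s. x s - y s) /
          (1 + L1_seminorm (real (Suc n)) (\<lambda>s. x s - y s)) +
        L1_seminorm (real (Suc n)) (\<lambda>s. y s - z s) /
          (1 + L1_seminorm (real (Suc n)) (\<lambda>s. y s - z s)))"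
      by (intro mult_left_mono frac L1_seminorm_nonneg L1_seminorm_triangle assms) simp
  next
    show "summable (\<lambda>n. (1/2) ^ Suc n * (L1_seminorm (real (Suc n)) (\<lambda>s. x s - y s) /
          (1 + L1_seminorm (real (Suc n)) (\<lambda>s. x s - y s)) +
        L1_seminorm (real (Suc n)) (\<lambda>s. y s - z s) /
          (1 + L1_seminorm (real (Suc n)) (\<lambda>s. y s - z s))))"
      unfolding distrib_left by (intro summable_add summable_L1loc_dist)
  qed (rule summable_L1loc_dist)
qed

text \<open>The filter is arbitrary because both sequences of time steps and the limit
  \<open>at t within {0..T}\<close> occur; in the latter case membership in \<open>L1loc\<close> is
  known only for times in the interval, hence eventually.\<close>

lemma L1loc_dist_tendsto_seminorm:
  assumes "\<forall>\<^sub>F i in G. y i \<in> L1loc" "\<forall>\<^sub>F i in G. z i \<in> L1loc" and d: "((\<lambda>i. L1loc_dist (y i) (z i)) \<longlongrightarrow> 0) G"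
  shows "((\<lambda>i. L1_seminorm R (\<lambda>x. y i x - z i x)) \<longlongrightarrow> 0) G"
proof -
  define n where "n = nat \<lceil>R\<rceil>"
  have R: "R \<le> real (Suc n)" unfolding n_def by linarith
  have "\<forall>\<^sub>F i in G. L1loc_dist (y i) (z i) < (1/2) / 2 ^ Suc n"
    using d by (rule order_tendstoD) simp
  with assms(1,2) have "\<forall>\<^sub>F i in G. L1_seminorm R (\<lambda>x. y i x - z i x) \<le> 2 ^ Suc (Suc n) * L1loc_dist (y i) (z i)"
  proof eventually_elim
    case (elim i)
    have "L1_seminorm R (\<lambda>x. y i x - z i x) \<le> L1_seminorm (real (Suc n)) (\<lambda>x. y i x - z i x)"
      by (intro L1_seminorm_mono L1loc_diff elim R)
    also have "\<dots> \<le> 2 ^ Suc (Suc n) * L1loc_dist (y i) (z i)"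
      using elim by (intro L1_seminorm_le_dist) (simp add: field_simps)
    finally show ?case .
  qed
  moreover have "((\<lambda>i. 2 ^ Suc (Suc n) * L1loc_dist (y i) (z i)) \<longlongrightarrow> 0) G"
    by (intro tendsto_mult_right_zero d)
  ultimately show ?thesis
    by (rule tendsto_sandwich[OF always_eventually _ tendsto_const, rotated])
      (simp add: L1_seminorm_nonneg)
qed

section \<open>Almost everywhere convergence from fast convergence in L1loc\<close>

lemma nn_integral_eq_L1_seminorm:
  assumes "y \<in> L1loc"
  shows "(\<integral>\<^sup>+x\<in>{-R..R}. ennreal (norm (y x)) \<partial>lborel) = ennreal (L1_seminorm R y)"
proof -
  have "(\<integral>\<^sup>+x. ennreal (indicator {-R..R} x *\<^sub>R norm (y x)) \<partial>lborel) = ennreal (L1_seminorm R y)"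
    unfolding L1_seminorm_def set_lebesgue_integral_def
    by (rule nn_integral_eq_integral)
      (use set_integrable_norm[OF L1loc_integrable[OF assms]] in \<open>auto simp: set_integrable_def\<close>)
  then show ?thesis
    by (simp add: ennreal_mult' ennreal_indicator mult.commute)
qed

text \<open>By monotone convergence the series of the norms has a finite integral over each window,
  hence is finite almost everywhere there, and the terms of a convergent series tend to 0. Countably
  many windows cover the line.\<close>

lemma AE_tendsto_of_seminorm:
  assumes y: "\<And>i. y i \<in> L1loc" and sum: "\<And>R. summable (\<lambda>i. L1_seminorm (real R) (y i))"
  shows "AE x in lborel. (\<lambda>i. y i x) \<longlonglongrightarrow> 0"
proof -
  have [measurable]: "y i \<in> borel_measurable borel" for i
    by (rule L1loc_borel_measurable[OF y])
  have "AE x in lborel. x \<in> {-real R..real R} \<longrightarrow> (\<lambda>i. y i x) \<longlonglongrightarrow> 0" for R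
  proof -
    have "(\<integral>\<^sup>+x. (\<Sum>i. ennreal (norm (y i x)) * indicator {-real R..real R} x) \<partial>lborel)
        = (\<Sum>i. \<integral>\<^sup>+x\<in>{-real R..real R}. ennreal (norm (y i x)) \<partial>lborel)"
      by (rule nn_integral_suminf) measurable
    also have "\<dots> = (\<Sum>i. ennreal (L1_seminorm (real R) (y i)))"
      by (simp add: nn_integral_eq_L1_seminorm[OF y])
    also have "\<dots> = ennreal (\<Sum>i. L1_seminorm (real R) (y i))"
      by (intro suminf_ennreal2 L1_seminorm_nonneg sum)
    finally have "(\<integral>\<^sup>+x. (\<Sum>i. ennreal (norm (y i x)) * indicator {-real R..real R} x) \<partial>lborel) \<noteq> \<infinity>"
      by simp
    then have "AE x in lborel. (\<Sum>i. ennreal (norm (y i x)) * indicator {-real R..real R} x) \<noteq> \<infinity>"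
      by (intro nn_integral_PInf_AE) auto
    then show ?thesis
    proof eventually_elim
      case (elim x)
      show ?case
      proof
        assume "x \<in> {-real R..real R}"
        with elim have "(\<Sum>i. ennreal (norm (y i x))) \<noteq> top" by simp
        then have "summable (\<lambda>i. norm (y i x))"
          by (intro summable_suminf_not_top) auto
        then show "(\<lambda>i. y i x) \<longlonglongrightarrow> 0"
          by (rule tendsto_norm_zero_cancel[OF summable_LIMSEQ_zero])
      qed
    qed
  qed
  then have "AE x in lborel. \<forall>R::nat. x \<in> {-real R..real R} \<longrightarrow> (\<lambda>i. y i x) \<longlonglongrightarrow> 0"
    by (subst AE_all_countable) blast
  then show ?thesis
  proof eventually_elim
    case (elim x)
    have "\<bar>x\<bar> \<le> real (nat \<lceil>\<bar>x\<bar>\<rceil>)" by linarith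
    then have "x \<in> {- real (nat \<lceil>\<bar>x\<bar>\<rceil>)..real (nat \<lceil>\<bar>x\<bar>\<rceil>)}"
      unfolding abs_le_iff atLeastAtMost_iff by linarith
    then show ?case using elim by blast
  qed
qed

lemma summable_L1_seminorm:
  assumes "\<And>i. y i \<in> L1loc" "\<And>i. z i \<in> L1loc"
    and d: "\<And>i. L1loc_dist (y i) (z i) < (1/2) ^ i"
  shows "summable (\<lambda>i. L1_seminorm (real R) (\<lambda>x. y i x - z i x))"
proof (rule summable_comparison_test)
  show "summable (\<lambda>i. 2 ^ Suc (Suc R) * (1/2::real) ^ i)"
    by (intro summable_mult) simp
  show "\<exists>N. \<forall>i\<ge>N. norm (L1_seminorm (real R) (\<lambda>x. y i x - z i x)) \<le> 2 ^ Suc (Suc R) * (1/2) ^ i"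
  \<comment> \<open>From i = R + 2 on, 2^(R+1) (1/2)^i is at most 1/2, the smallness required for
    the window R + 1. The metric has no window 0, hence the shift by one.\<close>
  proof (intro exI[of _ "Suc (Suc R)"] allI impI)
    fix i assume i: "Suc (Suc R) \<le> i"
    have "(1/2::real) ^ i \<le> (1/2) ^ Suc (Suc R)"
      using i by (intro power_decreasing) auto
    then have "2 ^ Suc R * (1/2::real) ^ i \<le> 2 ^ Suc R * (1/2) ^ Suc (Suc R)"
      by (intro mult_left_mono) auto
    also have "\<dots> = 1/2"
      by (simp add: power_divide)
    finally have "2 ^ Suc R * L1loc_dist (y i) (z i) \<le> 1/2"
      by (rule order.trans[OF mult_left_mono[OF less_imp_le[OF d[of i]]], rotated]) simp
    then have "L1_seminorm (real (Suc R)) (\<lambda>x. y i x - z i x) \<le> 2 ^ Suc (Suc R) * L1loc_dist (y i) (z i)"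
      by (rule L1_seminorm_le_dist)
    with L1_seminorm_mono[OF L1loc_diff[OF assms(1,2)]]
    have "L1_seminorm (real R) (\<lambda>x. y i x - z i x) \<le> 2 ^ Suc (Suc R) * L1loc_dist (y i) (z i)"
      by (rule order.trans) simp
    also have "2 ^ Suc (Suc R) * L1loc_dist (y i) (z i) \<le> 2 ^ Suc (Suc R) * (1/2) ^ i"
      using d[of i] by (intro mult_left_mono) auto
    finally show "norm (L1_seminorm (real R) (\<lambda>x. y i x - z i x)) \<le> 2 ^ Suc (Suc R) * (1/2) ^ i"
      by (simp only: real_norm_def abs_of_nonneg L1_seminorm_nonneg)
  qed
qed

lemma L1loc_dist_AE_tendsto:
  assumes "\<And>i. y i \<in> L1loc" "\<And>i. z i \<in> L1loc"
    and "\<And>i. L1loc_dist (y i) (z i) < (1/2) ^ i"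
  shows "AE x in lborel. (\<lambda>i. y i x - z i x) \<longlonglongrightarrow> 0"
  by (rule AE_tendsto_of_seminorm) (auto intro: L1loc_diff assms summable_L1_seminorm)

text \<open>Applied with \<open>Q i j\<close> saying that the j-th distance is below (1/2)^i. A
  subsequence this fast has summable seminorms, hence converges almost everywhere; if the distances
  are small uniformly in t, one subsequence serves every t.\<close>

lemma eventually_strict_mono_subseq:
  assumes ev: "\<And>i. \<forall>\<^sub>F j in sequentially. Q i j"
  obtains s :: "nat \<Rightarrow> nat" where "strict_mono s" "\<And>i. Q i (s i)"
proof -
  have "\<exists>s. \<forall>i. Q i (s i) \<and> s i < s (Suc i)"
  proof (rule dependent_nat_choice)
    show "\<exists>j. Q 0 j"
      by (rule eventually_happens'[OF sequentially_bot ev])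
    show "\<exists>l. Q (Suc i) l \<and> j < l" for i j
      by (rule eventually_happens'[OF sequentially_bot eventually_conj[OF ev eventually_gt_at_top]])
  qed
  then show ?thesis using that by (auto simp: strict_mono_Suc_iff)
qed

lemma L1loc_dist_AE_subseq:
  assumes "\<And>i. y i \<in> L1loc" "z \<in> L1loc" and d: "(\<lambda>i. L1loc_dist (y i) z) \<longlonglongrightarrow> 0"
  obtains s where "strict_mono s" "AE x in lborel. (\<lambda>i. y (s i) x) \<longlonglongrightarrow> z x"
proof -
  have "\<forall>\<^sub>F j in sequentially. L1loc_dist (y j) z < (1/2) ^ i" for i
    using d by (rule order_tendstoD) simp
  then obtain s where s: "strict_mono s" "\<And>i. L1loc_dist (y (s i)) z < (1/2) ^ i"
    by (rule eventually_strict_mono_subseq[of "\<lambda>i j. L1loc_dist (y j) z < (1/2) ^ i"]) blast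
  from L1loc_dist_AE_tendsto[of "\<lambda>i. y (s i)" "\<lambda>_. z"] assms(1,2) s(2)
  have "AE x in lborel. (\<lambda>i. y (s i) x - z x) \<longlonglongrightarrow> 0" by simp
  then have "AE x in lborel. (\<lambda>i. y (s i) x) \<longlonglongrightarrow> z x"
    by eventually_elim (rule Lim_null[THEN iffD2])
  with s(1) show ?thesis by (rule that)
qed

lemma C_L1loc_tendsto_sequentially:
  assumes "C_L1loc T u" "t \<in> {0..T}" "\<And>i. t' i \<in> {0..T}" "t' \<longlonglongrightarrow> t"
  shows "(\<lambda>i. L1loc_dist (u (t' i)) (u t)) \<longlonglongrightarrow> 0"
proof -
  have ev: "((\<lambda>s. L1loc_dist (u s) (u t)) \<longlongrightarrow> 0) (at t within {0..T})"
    using assms(1,2) by (simp add: C_L1loc_def)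
  have 0: "L1loc_dist (u t) (u t) = 0"
    unfolding L1loc_dist_def by (simp add: set_lebesgue_integral_def)
  have "((\<lambda>s. L1loc_dist (u s) (u t)) \<longlongrightarrow> L1loc_dist (u t) (u t)) (at t within {0..T})"
    using ev 0 by simp
  then have "continuous (at t within {0..T}) (\<lambda>s. L1loc_dist (u s) (u t))"
    by (simp add: continuous_within)
  then show ?thesis
    using assms 0 unfolding continuous_within_sequentially by (force simp: o_def)
qed

text \<open>Continuity gives no growth bound on f; the L-infinity bound confines y to a closed ball,
  where f is bounded by compactness.\<close>

lemma L1loc_comp_bounded:
  fixes f :: "real ^ 'd \<Rightarrow> real ^ 'd::finite"
  assumes f: "continuous_on UNIV f" and y: "y \<in> L1loc" and bdd: "AE x in lborel. norm (y x) \<le> M"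
  shows "(\<lambda>x. f (y x)) \<in> L1loc"
proof -
  have "compact (f ` cball 0 M)"
    by (intro compact_continuous_image continuous_on_subset[OF f]) auto
  then obtain B where B: "\<forall>z\<in>f ` cball 0 M. norm z \<le> B"
    using compact_imp_bounded bounded_iff by metis
  show ?thesis
  proof (rule L1loc_bounded)
    show "(\<lambda>x. f (y x)) \<in> borel_measurable borel"
      using measurable_compose[OF L1loc_borel_measurable[OF y] borel_measurable_continuous_onI[OF f]] .
    show "AE x in lborel. norm (f (y x)) \<le> B"
      using bdd by eventually_elim (use B in auto)
  qed
qed

lemma AE_bounded_limit:
  assumes "\<And>i. AE x in lborel. norm (y i x) \<le> M" "AE x in lborel. (\<lambda>i. y i x) \<longlonglongrightarrow> z x"
  shows "AE x in lborel. norm (z x :: real ^ 'd::finite) \<le> M"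
proof -
  from assms(1) have "AE x in lborel. \<forall>i. norm (y i x) \<le> M"
    by (simp add: AE_all_countable)
  with assms(2) show ?thesis
  proof eventually_elim
    case (elim x)
    then show ?case
      by (intro Lim_bounded[OF tendsto_norm, where M=0]) auto
  qed
qed

text \<open>Dominated convergence, with twice a bound of f on the ball of radius M as majorant. With
  f the identity it turns bounded convergence almost everywhere into convergence of the
  seminorms.\<close>

lemma L1_seminorm_comp_tendsto:
  fixes f :: "real ^ 'd \<Rightarrow> real ^ 'd::finite"
  assumes f: "continuous_on UNIV f" and y: "\<And>i. y i \<in> L1loc" and z: "z \<in> L1loc"
    and bdd: "\<And>i. AE x in lborel. norm (y i x) \<le> M"
    and lim: "AE x in lborel. (\<lambda>i. y i x) \<longlonglongrightarrow> z x"
  shows "(\<lambda>i. L1_seminorm R (\<lambda>x. f (y i x) - f (z x))) \<longlonglongrightarrow> 0"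
proof -
  have bdz: "AE x in lborel. norm (z x) \<le> M"
    by (rule AE_bounded_limit[OF bdd lim])
  have "compact (f ` cball 0 M)"
    by (intro compact_continuous_image continuous_on_subset[OF f]) auto
  then obtain B where B: "\<forall>z\<in>f ` cball 0 M. norm z \<le> B"
    using compact_imp_bounded bounded_iff by metis
  have [measurable]: "(\<lambda>x. f (y i x)) \<in> borel_measurable borel" "(\<lambda>x. f (z x)) \<in> borel_measurable borel" for i
    by (auto intro!: L1loc_borel_measurable L1loc_comp_bounded[OF f] y z bdd bdz)
  have "(\<lambda>i. LINT x|lborel. indicator {-R..R} x *\<^sub>R norm (f (y i x) - f (z x))) \<longlonglongrightarrow> (LINT x::real|lborel. 0)"
  proof (rule integral_dominated_convergence[where w="\<lambda>x. indicator {-R..R} x *\<^sub>R (B + B)"])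
    show "integrable lborel (\<lambda>x. indicator {-R..R} x *\<^sub>R (B + B))"
      by (intro integrable_scaleR_left) (auto simp: emeasure_lborel_Icc_eq)
    show "AE x in lborel. (\<lambda>i. indicator {-R..R} x *\<^sub>R norm (f (y i x) - f (z x))) \<longlonglongrightarrow> 0"
      using lim
    proof eventually_elim
      case (elim x)
      have "(\<lambda>i. f (y i x)) \<longlonglongrightarrow> f (z x)"
        by (rule continuous_on_tendsto_compose[OF f elim]) auto
      then have "(\<lambda>i. indicator {-R..R} x *\<^sub>R norm (f (y i x) - f (z x))) \<longlonglongrightarrow> indicator {-R..R} x *\<^sub>R norm (f (z x) - f (z x))"
        by (intro tendsto_intros)
      then show ?case by simp
    qed
    show "AE x in lborel. norm (indicator {-R..R} x *\<^sub>R norm (f (y i x) - f (z x))) \<le> indicator {-R..R} x *\<^sub>R (B + B)" for i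
      using bdd[of i] bdz
    proof eventually_elim
      case (elim x)
      then have "norm (f (y i x)) \<le> B" "norm (f (z x)) \<le> B" using B by auto
      then have "norm (f (y i x) - f (z x)) \<le> B + B"
        by (intro order.trans[OF norm_triangle_ineq4] add_mono)
      then show ?case by (simp add: indicator_def)
    qed
  qed measurable
  then show ?thesis
    by (simp add: L1_seminorm_def set_lebesgue_integral_def)
qed

text \<open>The approximating constants may depend on the window and on the accuracy. Along a
  subsequence they converge to K x for almost every x of the window; as they do not depend on x,
  neither does the limit.\<close>

lemma AE_constant:
  fixes K :: "'d::finite fld"
  assumes K: "K \<in> L1loc"
    and c: "\<And>(R::nat) e. 0 < R \<Longrightarrow> 0 < e \<Longrightarrow> \<exists>c. L1_seminorm (real R) (\<lambda>x. K x - c) \<le> e"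
  shows "\<exists>c. AE x in lborel. K x = c"
proof -
  \<comment> \<open>Every window contains [-1, 1], which has positive measure. A point of it where
    an almost everywhere statement holds serves to identify the limit on one window and to match the
    constants of different windows.\<close>
  have ex: "\<exists>x\<in>{-1..1}. Q x" if "AE x in lborel. Q x" for Q :: "real \<Rightarrow> bool"
  proof (rule ccontr)
    assume "\<not> (\<exists>x\<in>{-1..1}. Q x)"
    with that have "AE x in lborel. x \<notin> {-1..1::real}"
      by (auto elim: eventually_mono)
    then have "{-1..1::real} \<in> null_sets lborel"
      by (subst AE_iff_null_sets) simp_all
    then show False by (simp add: null_sets_def emeasure_lborel_Icc_eq)
  qed
  have "\<exists>c. AE x in lborel. x \<in> {-real (Suc R)..real (Suc R)} \<longrightarrow> K x = c" for R
  proof -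
    let ?I = "{-real (Suc R)..real (Suc R)}"
    have "\<exists>c. L1_seminorm (real (Suc R)) (\<lambda>x. K x - c) \<le> inverse (real (Suc m))" for m
      by (rule c) auto
    then obtain c where c: "\<And>m. L1_seminorm (real (Suc R)) (\<lambda>x. K x - c m) \<le> inverse (real (Suc m))"
      by metis
    have L: "(\<lambda>x. K x - c m) \<in> L1loc" for m
      by (intro L1loc_diff K L1loc_bounded[where B="norm (c m)"]) auto
    have "\<exists>r. strict_mono r \<and> (AE x in lborel. (\<lambda>m. indicator ?I x *\<^sub>R (K x - c (r m))) \<longlonglongrightarrow> 0)"
    proof (rule tendsto_L1_AE_subseq)
      show "integrable lborel (\<lambda>x. indicator ?I x *\<^sub>R (K x - c m))" for m
        using L1loc_integrable[OF L] by (simp add: set_integrable_def)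
      have "(\<lambda>m. L1_seminorm (real (Suc R)) (\<lambda>x. K x - c m)) \<longlonglongrightarrow> 0"
        by (rule tendsto_sandwich[OF _ _ tendsto_const LIMSEQ_inverse_real_of_nat])
          (simp_all add: L1_seminorm_nonneg c del: of_nat_Suc)
      then show "(\<lambda>m. LINT x|lborel. norm (indicator ?I x *\<^sub>R (K x - c m))) \<longlonglongrightarrow> 0"
        by (simp add: L1_seminorm_def set_lebesgue_integral_def)
    qed
    then obtain r where r: "AE x in lborel. (\<lambda>m. indicator ?I x *\<^sub>R (K x - c (r m))) \<longlonglongrightarrow> 0"
      by blast
    have lim: "(\<lambda>m. c (r m)) \<longlonglongrightarrow> K x"
      if "x \<in> ?I" "(\<lambda>m. indicator ?I x *\<^sub>R (K x - c (r m))) \<longlonglongrightarrow> 0" for x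
    proof -
      have "(\<lambda>m. K x - c (r m)) \<longlonglongrightarrow> 0" using that by simp
      then have "(\<lambda>m. K x - (K x - c (r m))) \<longlonglongrightarrow> K x - 0" by (intro tendsto_intros)
      then show ?thesis by simp
    qed
    from ex[OF r] obtain x0 where x0: "x0 \<in> {-1..1}" "(\<lambda>m. indicator ?I x0 *\<^sub>R (K x0 - c (r m))) \<longlonglongrightarrow> 0"
      by blast
    then have "x0 \<in> ?I" by auto
    note lim0 = lim[OF this x0(2)]
    from r have "AE x in lborel. x \<in> ?I \<longrightarrow> K x = K x0"
      by eventually_elim (use lim lim0 LIMSEQ_unique in blast)
    then show ?thesis by blast
  qed
  then obtain C where C: "\<And>R. AE x in lborel. x \<in> {-real (Suc R)..real (Suc R)} \<longrightarrow> K x = C R"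
    by metis
  have C0: "C R = C 0" for R
  proof -
    from C[of R] C[of 0] have "AE x in lborel. (x \<in> {-real (Suc R)..real (Suc R)} \<longrightarrow> K x = C R) \<and> (x \<in> {-1..1} \<longrightarrow> K x = C 0)"
      by eventually_elim simp
    from ex[OF this] show ?thesis by force
  qed
  have "AE x in lborel. \<forall>R. x \<in> {-real (Suc R)..real (Suc R)} \<longrightarrow> K x = C R"
    using C by (subst AE_all_countable) blast
  then have "AE x in lborel. K x = C 0"
  proof eventually_elim
    case (elim x)
    have "x \<in> {-real (Suc (nat \<lceil>\<bar>x\<bar>\<rceil>))..real (Suc (nat \<lceil>\<bar>x\<bar>\<rceil>))}"
      unfolding atLeastAtMost_iff by linarith
    with elim C0 show ?case by metis
  qed
  then show ?thesis by blast
qed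

section \<open>Primitives and cell averages\<close>

lemma set_integral_Icc_combine:
  fixes y :: "real \<Rightarrow> real ^ 'd::finite"
  assumes "a \<le> b" "b \<le> c" "set_integrable lborel {a..c} y"
  shows "(LINT x:{a..c}|lborel. y x) = (LINT x:{a..b}|lborel. y x) + (LINT x:{b..c}|lborel. y x)"
proof -
  have "(LINT x:{a..b} \<union> {b..c}|lborel. y x) = (LINT x:{a..b}|lborel. y x) + (LINT x:{b..c}|lborel. y x)"
  proof (rule set_integral_Un_AE)
    show "AE x in lborel. \<not> (x \<in> {a..b} \<and> x \<in> {b..c})"
      using AE_lborel_singleton[of b] by eventually_elim auto
  qed (use assms in \<open>auto intro: set_integrable_subset[OF assms(3)]\<close>)
  then show ?thesis
    using assms(1,2) by (simp add: ivl_disj_un_two_touch)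
qed

lemma set_integral_le_L1_seminorm:
  assumes "y \<in> L1loc" "-R \<le> a" "b \<le> R"
  shows "norm (LINT x:{a..b}|lborel. y x) \<le> L1_seminorm R y"
proof -
  have "norm (LINT x:{a..b}|lborel. y x) \<le> (LINT x:{a..b}|lborel. norm (y x))"
    by (rule set_integral_norm_bound[OF L1loc_integrable[OF assms(1)]])
  also have "\<dots> \<le> L1_seminorm R y"
    unfolding L1_seminorm_def set_lebesgue_integral_def
    by (rule integral_mono)
      (use assms set_integrable_norm[OF L1loc_integrable[OF assms(1)]]
        in \<open>auto simp: set_integrable_def indicator_def\<close>)
  finally show ?thesis .
qed

text \<open>The signed integral from 0 to x without a case distinction: at least one of the two
  intervals is empty or a point.\<close>

definition primitive :: "'d::finite fld \<Rightarrow> 'd fld" where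
  "primitive y x = (LINT s:{0..x}|lborel. y s) - (LINT s:{x..0}|lborel. y s)"

lemma set_integral_point: "(LINT s:{a..a}|lborel. y s) = (0 :: real ^ 'd::finite)" for a :: real
proof -
  have "AE s in lborel. indicator {a..a} s *\<^sub>R y s = 0"
    using AE_lborel_singleton[of a] by eventually_elim auto
  then show ?thesis unfolding set_lebesgue_integral_def
    by (rule integral_eq_zero_AE)
qed

lemma set_integral_Icc_empty: "b \<le> a \<Longrightarrow> (LINT s:{a..b}|lborel. y s) = (0 :: real ^ 'd::finite)" for a :: real
  using set_integral_point[of b y] by (cases "a = b") (auto simp: set_lebesgue_integral_def)

lemma primitive_diff:
  assumes y: "y \<in> L1loc" and "a \<le> b"
  shows "primitive y b - primitive y a = (LINT s:{a..b}|lborel. y s)"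
proof -
  note c = set_integral_Icc_combine[OF _ _ L1loc_integrable[OF y]]
  consider "0 \<le> a" | "a \<le> 0" "0 \<le> b" | "b \<le> 0" by linarith
  then show ?thesis
  proof cases
    case 1
    then show ?thesis using assms(2) c[of 0 a b] by (simp add: primitive_def set_integral_Icc_empty)
  next
    case 2
    then show ?thesis using c[of a 0 b] by (simp add: primitive_def set_integral_Icc_empty)
  next
    case 3
    then show ?thesis using assms(2) c[of a b 0] by (simp add: primitive_def set_integral_Icc_empty)
  qed
qed

lemma norm_primitive_le:
  assumes "y \<in> L1loc" "\<bar>x\<bar> \<le> R"
  shows "norm (primitive y x) \<le> L1_seminorm R y"
proof (cases "0 \<le> x")
  case True
  then show ?thesis
    using assms(2) set_integral_le_L1_seminorm[OF assms(1), of R 0 x]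
    by (simp add: primitive_def set_integral_Icc_empty)
next
  case False
  then have "(LINT s:{0..x}|lborel. y s) = 0" by (intro set_integral_Icc_empty) simp
  then show ?thesis
    using assms(2) False set_integral_le_L1_seminorm[OF assms(1), of R x 0]
    by (simp add: primitive_def del: atLeastatMost_empty)
qed

lemma primitive_subtract:
  assumes "y \<in> L1loc" "z \<in> L1loc"
  shows "primitive (\<lambda>x. y x - z x) x = primitive y x - primitive z x"
  using assms by (simp add: primitive_def L1loc_integrable set_integral_diff)

lemma set_integral_bounded_le:
  fixes y :: "real \<Rightarrow> real ^ 'd::finite"
  assumes "a \<le> b" and y: "set_integrable lborel {a..b} y" and bdd: "AE x in lborel. norm (y x) \<le> B"
  shows "norm (LINT s:{a..b}|lborel. y s) \<le> B * (b - a)"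
proof -
  have "norm (LINT s:{a..b}|lborel. y s) \<le> (LINT s:{a..b}|lborel. norm (y s))"
    by (rule set_integral_norm_bound[OF y])
  also have "\<dots> \<le> (LINT s:{a..b}|lborel. B)"
  proof (rule set_integral_mono_AE)
    show "AE x\<in>{a..b} in lborel. norm (y x) \<le> B"
      using bdd by eventually_elim auto
    show "set_integrable lborel {a..b} (\<lambda>s. B)"
      unfolding set_integrable_def
      by (intro integrable_scaleR_left) (auto simp: emeasure_lborel_Icc_eq)
  qed (rule set_integrable_norm[OF y])
  also have "\<dots> = B * (b - a)"
    using assms(1) by (simp add: set_lebesgue_integral_def measure_def emeasure_lborel_Icc)
  finally show ?thesis .
qed

lemma primitive_lipschitz:
  assumes "y \<in> L1loc" "AE x in lborel. norm (y x) \<le> B"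
  shows "norm (primitive y b - primitive y a) \<le> B * \<bar>b - a\<bar>"
proof (cases "a \<le> b")
  case True
  then show ?thesis
    using primitive_diff[OF assms(1) True] set_integral_bounded_le[OF True L1loc_integrable[OF assms(1)] assms(2)]
    by simp
next
  case False
  then have "b \<le> a" by simp
  then show ?thesis
    using primitive_diff[OF assms(1)] set_integral_bounded_le[OF _ L1loc_integrable[OF assms(1)] assms(2), of b a]
    by (simp add: norm_minus_commute)
qed

lemma primitive_continuous:
  assumes y: "y \<in> L1loc"
  shows "continuous_on UNIV (primitive y)"
proof (rule continuous_at_imp_continuous_on, rule ballI)
  fix x :: real
  define R where "R = \<bar>x\<bar> + 1"
  have "y integrable_on {-R..R}"
    by (rule set_borel_integral_eq_integral(1)[OF L1loc_integrable[OF y]])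
  then have "continuous_on {-R..R} (\<lambda>s. primitive y (-R) + integral {-R..s} y)"
    by (intro continuous_intros indefinite_integral_continuous_1)
  moreover have "primitive y (-R) + integral {-R..s} y = primitive y s" if "s \<in> {-R..R}" for s
    using primitive_diff[OF y, of "-R" s] that
      set_borel_integral_eq_integral(2)[OF L1loc_integrable[OF y], of "-R" s]
    by (simp add: algebra_simps)
  ultimately have "continuous_on {-R..R} (primitive y)"
    by (rule continuous_on_eq)
  moreover have "x \<in> interior {-R..R}"
    by (auto simp: R_def)
  ultimately show "isCont (primitive y) x"
    by (rule continuous_on_interior)
qed

text \<open>Compact intervals form a generator of the Borel sets that is stable under intersection,
  so the vanishing of the integral extends to all Borel sets by the pi-lambda theorem, and then the
  density is zero almost everywhere.\<close>

lemma AE_zero_of_Icc_integrals: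
  fixes y :: "'d::finite fld"
  assumes y: "y \<in> L1loc" and zero: "\<And>a b. (LINT x:{a..b}|lborel. y x) = 0"
  shows "AE x in lborel. y x = 0"
proof -
  have "AE x in lborel. x \<in> {-real R..real R} \<longrightarrow> y x = 0" for R :: nat
  proof -
    \<comment> \<open>Truncation makes the function integrable on the whole line, as complements and
      countable unions require; an interval cut by the window is again an interval.\<close>
    define z where "z = (\<lambda>x. indicator {-real R..real R} x *\<^sub>R y x)"
    have z: "integrable lborel z"
      using L1loc_integrable[OF y] by (simp add: z_def set_integrable_def)
    have zi: "set_integrable lborel A z" if "A \<in> sets borel" for A
      using integrable_mult_indicator[OF _ z] that by (simp add: set_integrable_def)
    have Icc: "(LINT x:{a..b}|lborel. z x) = 0" for a b
    proof -
      have "(LINT x:{a..b}|lborel. z x) = (LINT x:{max a (-real R)..min b (real R)}|lborel. y x)"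
        unfolding set_lebesgue_integral_def z_def
        by (intro Bochner_Integration.integral_cong) (auto simp: indicator_def)
      then show ?thesis by (simp add: zero)
    qed
    have total: "(LINT x|lborel. z x) = 0"
    proof -
      have "(LINT x|lborel. z x) = (LINT x:{-real R..real R}|lborel. y x)"
        by (simp add: z_def set_lebesgue_integral_def)
      then show ?thesis by (simp add: zero)
    qed
    let ?G = "range (\<lambda>(a, b). {a..b::real})"
    have "(LINT x:A|lborel. z x) = 0" if "A \<in> sets lborel" for A
    proof -
      have sets: "sets borel = sigma_sets UNIV ?G"
        unfolding borel_eq_atLeastAtMost by (rule sets_measure_of) simp
      have "A \<in> sigma_sets UNIV ?G" using that sets by simp
      moreover have stable: "Int_stable ?G"
        by (auto simp: Int_stable_def)
      have Pow: "?G \<subseteq> Pow UNIV" by simp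
      ultimately show ?thesis
      proof (induction rule: sigma_sets_induct_disjoint[OF stable Pow, consumes 1, case_names basic empty compl union])
        case (basic A)
        then obtain a b where "A = {a..b}" by auto
        then show ?case by (simp add: Icc)
      next
        case empty
        then show ?case by (simp add: set_lebesgue_integral_def)
      next
        case (compl A)
        then have A: "A \<in> sets borel" using sets by simp
        have "(LINT x:A \<union> (UNIV - A)|lborel. z x) = (LINT x:A|lborel. z x) + (LINT x:UNIV - A|lborel. z x)"
          using A by (intro set_integral_Un zi) auto
        then show ?case using compl total by (simp add: set_lebesgue_integral_def)
      next
        case (union A)
        then have A: "A i \<in> sets borel" for i using sets by auto
        have "(LINT x:(\<Union>i. A i)|lborel. z x) = (\<Sum>i. LINT x:A i|lborel. z x)"
          using A union by (intro lebesgue_integral_countable_add zi) (auto simp: disjoint_family_on_def)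
        with union show ?case by simp
      qed
    qed
    then have "AE x in lborel. z x = 0"
      by (rule sigma_finite_measure.density_zero[OF lborel.sigma_finite_measure_axioms z])
    then show ?thesis by eventually_elim (auto simp: z_def)
  qed
  then have "AE x in lborel. \<forall>R::nat. x \<in> {-real R..real R} \<longrightarrow> y x = 0"
    by (subst AE_all_countable) blast
  then show ?thesis
  proof eventually_elim
    case (elim x)
    have "x \<in> {-real (nat \<lceil>\<bar>x\<bar>\<rceil>)..real (nat \<lceil>\<bar>x\<bar>\<rceil>)}"
      unfolding atLeastAtMost_iff by linarith
    with elim show ?case by blast
  qed
qed

text \<open>Telescoping in both directions from 0. The bound b is the accumulated error per cell; b
  = 0 is used for exactly preserved cell averages.\<close>

lemma norm_diff_int_steps_le:
  fixes Q :: "int \<Rightarrow> 'a::real_normed_vector"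
  assumes "\<And>j. norm (Q j - Q (j - 1)) \<le> b"
  shows "norm (Q j - Q 0) \<le> \<bar>real_of_int j\<bar> * b"
proof (induction j rule: int_induct[where k=0])
  case base
  show ?case by simp
next
  case (step1 i)
  have "norm (Q (i + 1) - Q 0) \<le> norm (Q (i + 1) - Q i) + norm (Q i - Q 0)"
    by (rule norm_diff_triangle_le[OF order_refl order_refl])
  with step1 assms[of "i + 1"] show ?case by (simp add: algebra_simps)
next
  case (step2 i)
  have "norm (Q (i - 1) - Q 0) \<le> norm (Q (i - 1) - Q i) + norm (Q i - Q 0)"
    by (rule norm_diff_triangle_le[OF order_refl order_refl])
  with step2 assms[of i] show ?case by (simp add: algebra_simps norm_minus_commute)
qed

lemma set_integral_cell:
  fixes y :: "'d::finite fld"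
  shows "(LINT x:cell lam k j|lborel. y x) = (LINT x:{half_pt lam k (j - 1)..half_pt lam k j}|lborel. y x)"
  unfolding set_lebesgue_integral_def
  by (rule integral_discrete_difference[where X="{half_pt lam k (j - 1), half_pt lam k j}"])
    (auto simp: cell_def indicator_def)

text \<open>No approximation property ties \<open>y m\<close> to \<open>u0\<close>, only equal cell
  averages. They make the difference of the primitives equal at all half points, and every x is
  within one mesh width of a half point, so in the limit this difference is constant, hence 0 as it
  is at 0.\<close>

lemma cell_averages_limit:
  fixes u0 :: "'d::finite fld" and y :: "nat \<Rightarrow> 'd fld"
  assumes u0: "u0 \<in> L1loc" and z: "z \<in> L1loc" and y: "\<And>m. y m \<in> L1loc"
    and bdd: "\<And>m. AE x in lborel. norm (y m x) \<le> M" and lim: "(\<lambda>m. L1loc_dist (y m) z) \<longlonglongrightarrow> 0"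
    and k: "\<And>m. 0 < k m" "k \<longlonglongrightarrow> 0" and lam: "0 < lam"
    and cells: "\<And>m j. (LINT x:cell lam (k m) j|lborel. y m x) = (LINT x:cell lam (k m) j|lborel. u0 x)"
  shows "AE x in lborel. z x = u0 x"
proof -
  define D where "D = (\<lambda>m x. primitive (y m) x - primitive u0 x)"
  have grid: "D m (half_pt lam (k m) j) = D m (half_pt lam (k m) 0)" for m j
  proof -
    have "norm (D m (half_pt lam (k m) j) - D m (half_pt lam (k m) (j - 1))) \<le> 0" for j
    proof -
      have le: "half_pt lam (k m) (j - 1) \<le> half_pt lam (k m) j"
        unfolding half_pt_def using k(1)[of m] lam by (intro mult_right_mono) auto
      have "D m (half_pt lam (k m) j) - D m (half_pt lam (k m) (j - 1))
          = (primitive (y m) (half_pt lam (k m) j) - primitive (y m) (half_pt lam (k m) (j - 1)))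
            - (primitive u0 (half_pt lam (k m) j) - primitive u0 (half_pt lam (k m) (j - 1)))"
        by (simp add: D_def)
      also have "\<dots> = 0"
        unfolding primitive_diff[OF y le] primitive_diff[OF u0 le] using cells[of m j] by (simp add: set_integral_cell)
      finally show ?thesis by simp
    qed
    from norm_diff_int_steps_le[of "\<lambda>j. D m (half_pt lam (k m) j)", OF this, of j] show ?thesis by simp
  qed
  \<comment> \<open>With h = \<open>k m / lam\<close> and i the floor of x / h, both x and this half
    point lie in [i h, (i + 1) h].\<close>
  define p where "p = (\<lambda>m x. half_pt lam (k m) \<lfloor>x / (k m / lam)\<rfloor>)"
  have px: "\<bar>p m x - x\<bar> \<le> k m / lam" for m x
  proof -
    define h where "h = k m / lam"
    have h: "0 < h" using k(1)[of m] lam by (simp add: h_def)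
    have "real_of_int \<lfloor>x / h\<rfloor> * h \<le> x"
      by (rule iffD1[OF pos_le_divide_eq[OF h] of_int_floor_le])
    moreover have "x < (real_of_int \<lfloor>x / h\<rfloor> + 1) * h"
      by (rule iffD1[OF pos_divide_less_eq[OF h]]) linarith
    ultimately show ?thesis unfolding p_def half_pt_def h_def[symmetric]
      by (simp add: abs_le_iff algebra_simps)
  qed
  have kl: "(\<lambda>m. k m / lam) \<longlonglongrightarrow> 0" by (rule tendsto_divide_zero[OF k(2)])
  have plim: "(\<lambda>m. p m x) \<longlonglongrightarrow> x" for x
    by (rule LIM_zero_cancel, rule Lim_null_comparison[OF _ kl]) (simp add: px)
  \<comment> \<open>The primitives of the \<open>y m\<close> are Lipschitz with a common constant;
    \<open>u0\<close> may be unbounded, but its primitive is one fixed continuous function.\<close>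
  have near: "(\<lambda>m. D m (p m x) - D m x) \<longlonglongrightarrow> 0" for x
  proof -
    have "0 \<le> M * \<bar>1 - 0\<bar>"
      by (rule order.trans[OF norm_ge_zero primitive_lipschitz[OF y bdd]])
    then have M: "0 \<le> M" by simp
    have a: "(\<lambda>m. primitive (y m) (p m x) - primitive (y m) x) \<longlonglongrightarrow> 0"
    proof (rule Lim_null_comparison)
      show "(\<lambda>m. M * (k m / lam)) \<longlonglongrightarrow> 0" by (rule tendsto_mult_right_zero[OF kl])
      show "\<forall>\<^sub>F m in sequentially. norm (primitive (y m) (p m x) - primitive (y m) x) \<le> M * (k m / lam)"
        by (intro always_eventually allI order.trans[OF primitive_lipschitz[OF y bdd] mult_left_mono[OF px M]])
    qed
    have "(\<lambda>m. primitive u0 (p m x)) \<longlonglongrightarrow> primitive u0 x"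
      by (rule continuous_on_tendsto_compose[OF primitive_continuous[OF u0] plim]) auto
    then have b: "(\<lambda>m. primitive u0 (p m x) - primitive u0 x) \<longlonglongrightarrow> 0"
      by (rule LIM_zero)
    from tendsto_diff[OF a b] show ?thesis by (simp add: D_def algebra_simps)
  qed
  have Dlim: "(\<lambda>m. D m x) \<longlonglongrightarrow> primitive z x - primitive u0 x" for x
  proof -
    have "(\<lambda>m. primitive (y m) x - primitive z x) \<longlonglongrightarrow> 0"
    proof (rule Lim_null_comparison)
      show "(\<lambda>m. L1_seminorm \<bar>x\<bar> (\<lambda>s. y m s - z s)) \<longlonglongrightarrow> 0"
        by (rule L1loc_dist_tendsto_seminorm) (simp_all add: y z lim)
      show "\<forall>\<^sub>F m in sequentially. norm (primitive (y m) x - primitive z x) \<le> L1_seminorm \<bar>x\<bar> (\<lambda>s. y m s - z s)"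
        unfolding primitive_subtract[OF y z, symmetric]
        by (intro always_eventually allI norm_primitive_le L1loc_diff y z) simp
    qed
    from LIM_zero_cancel[OF this] show ?thesis
      unfolding D_def by (intro tendsto_intros)
  qed
  have "primitive z x - primitive u0 x = 0" for x
  proof -
    \<comment> \<open>The two values at half points cancel and \<open>D m 0\<close> vanishes, so
      this difference is \<open>D m x\<close>.\<close>
    have "(\<lambda>m. (D m (p m 0) - D m 0) - (D m (p m x) - D m x)) \<longlonglongrightarrow> 0"
      using tendsto_diff[OF near[of 0] near[of x]] by simp
    moreover have "D m (p m 0) = D m (p m x)" for m
      unfolding p_def by (rule trans[OF grid grid[symmetric]])
    moreover have "D m 0 = 0" for m
      by (simp add: D_def primitive_def)
    ultimately have "(\<lambda>m. D m x) \<longlonglongrightarrow> 0" by simp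
    from LIMSEQ_unique[OF Dlim this] show ?thesis .
  qed
  then have pz: "primitive (\<lambda>x. z x - u0 x) x = 0" for x
    by (simp add: primitive_subtract[OF z u0])
  have "AE x in lborel. z x - u0 x = 0"
  proof (rule AE_zero_of_Icc_integrals[OF L1loc_diff[OF z u0]])
    fix a b :: real
    show "(LINT x:{a..b}|lborel. z x - u0 x) = 0"
    proof (cases "a \<le> b")
      case True
      then show ?thesis using primitive_diff[OF L1loc_diff[OF z u0] True] pz by simp
    next
      case False
      then show ?thesis by (intro set_integral_Icc_empty) simp
    qed
  qed
  then show ?thesis by eventually_elim simp
qed

section \<open>Flux integrals\<close>

text \<open>The subsequence is chosen uniformly in t, so for every t in A, not only for almost every
  t, the functions converge almost everywhere in x. The pointwise \<open>lim\<close> in both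
  variables is then Borel and represents each \<open>v t\<close>.\<close>

lemma jointly_measurable_version:
  fixes Y :: "nat \<Rightarrow> real \<Rightarrow> 'd::finite fld"
  assumes meas: "\<And>m. (\<lambda>(t, x). Y m t x) \<in> borel_measurable (borel :: (real \<times> real) measure)"
    and Y: "\<And>m t. t \<in> A \<Longrightarrow> Y m t \<in> L1loc" and v: "\<And>t. t \<in> A \<Longrightarrow> v t \<in> L1loc"
    and bdd: "\<And>m t. t \<in> A \<Longrightarrow> AE x in lborel. norm (Y m t x) \<le> M"
    and lim: "\<And>e. 0 < e \<Longrightarrow> \<forall>\<^sub>F m in sequentially. \<forall>t\<in>A. L1loc_dist (Y m t) (v t) < e"
    and M: "0 \<le> M"
  obtains w where "(\<lambda>(t, x). w t x) \<in> borel_measurable (borel :: (real \<times> real) measure)"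
    "\<And>t x. norm (w t x) \<le> M" "\<And>t. t \<in> A \<Longrightarrow> AE x in lborel. w t x = v t x"
proof -
  have "\<forall>\<^sub>F m in sequentially. \<forall>t\<in>A. L1loc_dist (Y m t) (v t) < (1/2) ^ i" for i
    by (rule lim) simp
  then obtain s where s: "strict_mono s" "\<And>i. \<forall>t\<in>A. L1loc_dist (Y (s i) t) (v t) < (1/2) ^ i"
    by (rule eventually_strict_mono_subseq[of "\<lambda>i m. \<forall>t\<in>A. L1loc_dist (Y m t) (v t) < (1/2) ^ i"]) blast
  define g where "g = (\<lambda>p. lim (\<lambda>i. Y (s i) (fst p) (snd p)))"
  have "(\<lambda>p. Y (s i) (fst p) (snd p)) \<in> borel_measurable (borel :: (real \<times> real) measure)" for i
    using meas[of "s i"] by (simp add: case_prod_unfold)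
  then have g[measurable]: "g \<in> borel_measurable (borel :: (real \<times> real) measure)"
    unfolding g_def by (rule borel_measurable_lim_metric)
  \<comment> \<open>Where the sequence diverges, \<open>lim\<close> has an unspecified value; the
    cut-off by 0 makes the bound M hold at every point and changes nothing where a sequence bounded
    by M converges.\<close>
  define w where "w = (\<lambda>t x. if norm (g (t, x)) \<le> M then g (t, x) else 0)"
  show ?thesis
  proof (rule that)
    have "(\<lambda>p. if norm (g p) \<le> M then g p else 0) \<in> borel_measurable (borel :: (real \<times> real) measure)"
      by measurable
    also have "(\<lambda>p. if norm (g p) \<le> M then g p else 0) = (\<lambda>(t, x). w t x)"
      by (auto simp: w_def fun_eq_iff)
    finally show "(\<lambda>(t, x). w t x) \<in> borel_measurable (borel :: (real \<times> real) measure)" .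
    show "norm (w t x) \<le> M" for t x
      using M by (simp add: w_def)
    show "AE x in lborel. w t x = v t x" if t: "t \<in> A" for t
    proof -
      have "AE x in lborel. (\<lambda>i. Y (s i) t x - v t x) \<longlonglongrightarrow> 0"
        using s(2) t by (intro L1loc_dist_AE_tendsto Y v) auto
      moreover have "AE x in lborel. \<forall>i. norm (Y (s i) t x) \<le> M"
        using bdd[OF t] by (simp add: AE_all_countable)
      ultimately show ?thesis
      proof eventually_elim
        case (elim x)
        then have c: "(\<lambda>i. Y (s i) t x) \<longlonglongrightarrow> v t x"
          using Lim_null by blast
        then have "norm (v t x) \<le> M"
          by (rule Lim_bounded[OF tendsto_norm, where M=0]) (use elim in auto)
        with limI[OF c] show ?case by (simp add: w_def g_def)
      qed
    qed
  qed
qed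

section \<open>Uniqueness of the continuous representative\<close>

lemma continuous_on_AE_eq:
  fixes g g' :: "real \<Rightarrow> real ^ 'd::finite"
  assumes "continuous_on UNIV g" "continuous_on UNIV g'" and ae: "AE x in lborel. g x = g' x"
  shows "g = g'"
proof -
  have o: "open {x. g x \<noteq> g' x}"
    by (rule open_Collect_neq) (use assms in auto)
  have "{x. g x \<noteq> g' x} = {}"
  proof (rule ccontr)
    assume "{x. g x \<noteq> g' x} \<noteq> {}"
    then have "\<not> negligible {x. g x \<noteq> g' x}"
      using o open_not_negligible by blast
    moreover have "AE x in lebesgue. x \<notin> {x. g x \<noteq> g' x}"
      using ae by (intro AE_completion) auto
    ultimately show False
      by (simp add: negligible_iff_null_sets AE_iff_null_sets borel_open[OF o] fmeasurable_def)
  qed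
  then show ?thesis by auto
qed

text \<open>Fubini turns a statement for every t and almost every x into one for almost every x and
  almost every t. Joint measurability of both versions makes the exceptional set measurable in the
  product, as the exchange demands.\<close>

lemma AE_versions_eq:
  fixes w w' :: "real \<Rightarrow> 'd::finite fld"
  assumes w: "(\<lambda>(t, x). w t x) \<in> borel_measurable (borel :: (real \<times> real) measure)"
    and w': "(\<lambda>(t, x). w' t x) \<in> borel_measurable (borel :: (real \<times> real) measure)"
    and eq: "\<And>t. t \<in> A \<Longrightarrow> AE x in lborel. w t x = w' t x"
    and A: "A \<in> sets borel"
  shows "AE x in lborel. AE t in lborel. t \<in> A \<longrightarrow> w t x = w' t x"
proof -
  have m: "(\<lambda>p. w (fst p) (snd p)) \<in> borel_measurable (borel \<Otimes>\<^sub>M borel)"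
    "(\<lambda>p. w' (fst p) (snd p)) \<in> borel_measurable (borel \<Otimes>\<^sub>M borel)"
    using w w' by (simp_all add: borel_prod case_prod_unfold)
  have s: "{p \<in> space (lborel \<Otimes>\<^sub>M lborel). fst p \<in> A \<longrightarrow> w (fst p) (snd p) = w' (fst p) (snd p)}
      \<in> sets (lborel \<Otimes>\<^sub>M lborel)"
  proof -
    note [measurable] = m A
    have "Measurable.pred (borel \<Otimes>\<^sub>M borel) (\<lambda>p. fst p \<in> A \<longrightarrow> w (fst p) (snd p) = w' (fst p) (snd p))"
      by measurable
    then show ?thesis
      unfolding pred_def by (simp add: space_pair_measure cong: sets_pair_measure_cong)
  qed
  have "AE t in lborel. AE x in lborel. t \<in> A \<longrightarrow> w t x = w' t x"
  proof (rule AE_I2)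
    fix t
    show "AE x in lborel. t \<in> A \<longrightarrow> w t x = w' t x"
      using eq[of t] by (cases "t \<in> A") auto
  qed
  then show ?thesis
    by (subst (asm) lborel_pair.AE_commute[OF s])
qed

text \<open>By Fubini the time integrals of two versions agree for almost every x, and continuous
  functions equal almost everywhere are equal. The choice in \<open>flux_integral\<close> is thereby
  determined as soon as a representative exists.\<close>

lemma is_flux_integral_unique:
  assumes "is_flux_integral f u t1 t2 g" "is_flux_integral f u t1 t2 g'"
  shows "g = g'"
proof -
  obtain w where w: "(\<lambda>(t, x). w t x) \<in> borel_measurable (borel :: (real \<times> real) measure)"
    "\<And>t. t \<in> {t1..t2} \<Longrightarrow> AE x in lborel. w t x = u t x"
    "AE x in lborel. set_integrable lborel {t1..t2} (\<lambda>t. f (w t x)) \<and> g x = (LINT t:{t1..t2}|lborel. f (w t x))"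
    using assms(1) unfolding is_flux_integral_def by blast
  obtain w' where w': "(\<lambda>(t, x). w' t x) \<in> borel_measurable (borel :: (real \<times> real) measure)"
    "\<And>t. t \<in> {t1..t2} \<Longrightarrow> AE x in lborel. w' t x = u t x"
    "AE x in lborel. set_integrable lborel {t1..t2} (\<lambda>t. f (w' t x)) \<and> g' x = (LINT t:{t1..t2}|lborel. f (w' t x))"
    using assms(2) unfolding is_flux_integral_def by blast
  have "AE x in lborel. AE t in lborel. t \<in> {t1..t2} \<longrightarrow> w t x = w' t x"
  proof (rule AE_versions_eq[OF w(1) w'(1)])
    fix t assume "t \<in> {t1..t2}"
    from w(2)[OF this] w'(2)[OF this] show "AE x in lborel. w t x = w' t x"
      by eventually_elim simp
  qed simp
  with w(3) w'(3) have "AE x in lborel. g x = g' x"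
  proof eventually_elim
    case (elim x)
    have "(LINT t:{t1..t2}|lborel. f (w t x)) = (LINT t:{t1..t2}|lborel. f (w' t x))"
      unfolding set_lebesgue_integral_def
    proof (rule integral_cong_AE)
      show "AE t in lborel. indicator {t1..t2} t *\<^sub>R f (w t x) = indicator {t1..t2} t *\<^sub>R f (w' t x)"
        using elim(3) by eventually_elim (auto simp: indicator_def)
    qed (use elim in \<open>auto simp: set_integrable_def\<close>)
    then show ?case using elim by simp
  qed
  then show ?thesis
    using assms by (intro continuous_on_AE_eq) (auto simp: is_flux_integral_def)
qed

lemma flux_integral_eqI: "is_flux_integral f u t1 t2 g \<Longrightarrow> flux_integral f u t1 t2 = g"
  unfolding flux_integral_def by (metis is_flux_integral_unique someI)

text \<open>The norm goes inside the time integral, then Tonelli applies. Nonnegative integrals are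
  used because the exact short-time flux is known to be integrable in t for almost every x, not
  jointly in (t, x).\<close>

lemma nn_integral_set_integral_diff_le:
  fixes \<phi> \<psi> :: "real \<Rightarrow> 'd::finite fld"
  assumes \<phi>: "(\<lambda>(t, x). \<phi> t x) \<in> borel_measurable (borel :: (real \<times> real) measure)"
    and \<psi>: "(\<lambda>(t, x). \<psi> t x) \<in> borel_measurable (borel :: (real \<times> real) measure)"
    and int: "AE x in lborel. set_integrable lborel {0..k} (\<lambda>t. \<phi> t x) \<and> set_integrable lborel {0..k} (\<lambda>t. \<psi> t x)"
    and le: "\<And>t. t \<in> {0..k} \<Longrightarrow> (\<integral>\<^sup>+x\<in>A. ennreal (norm (\<phi> t x - \<psi> t x)) \<partial>lborel) \<le> ennreal e"
    and [measurable]: "A \<in> sets borel" and "0 \<le> k" "0 \<le> e"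
  shows "(\<integral>\<^sup>+x\<in>A. ennreal (norm ((LINT t:{0..k}|lborel. \<phi> t x) - (LINT t:{0..k}|lborel. \<psi> t x))) \<partial>lborel)
    \<le> ennreal (k * e)"
proof -
  define g where "g = (\<lambda>p. ennreal (norm (\<phi> (fst p) (snd p) - \<psi> (fst p) (snd p))) * indicator {0..k} (fst p) * indicator A (snd p))"
  have [measurable]: "(\<lambda>p. \<phi> (fst p) (snd p)) \<in> borel_measurable (borel \<Otimes>\<^sub>M borel)"
    "(\<lambda>p. \<psi> (fst p) (snd p)) \<in> borel_measurable (borel \<Otimes>\<^sub>M borel)"
    using \<phi> \<psi> by (simp_all add: borel_prod case_prod_unfold)
  have "g \<in> borel_measurable (borel \<Otimes>\<^sub>M borel)"
    unfolding g_def by measurable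
  then have g[measurable]: "g \<in> borel_measurable (lborel \<Otimes>\<^sub>M lborel)"
    by (simp cong: measurable_cong_sets sets_pair_measure_cong)
  have "(\<integral>\<^sup>+x\<in>A. ennreal (norm ((LINT t:{0..k}|lborel. \<phi> t x) - (LINT t:{0..k}|lborel. \<psi> t x))) \<partial>lborel)
      \<le> (\<integral>\<^sup>+x. (\<integral>\<^sup>+t. g (t, x) \<partial>lborel) \<partial>lborel)"
  proof (rule nn_integral_mono_AE, use int in eventually_elim)
    case (elim x)
    have "ennreal (norm ((LINT t:{0..k}|lborel. \<phi> t x) - (LINT t:{0..k}|lborel. \<psi> t x)))
        = ennreal (norm (LINT t|lborel. indicator {0..k} t *\<^sub>R (\<phi> t x - \<psi> t x)))"
      using elim set_integral_diff(2)[of lborel "{0..k}" "\<lambda>t. \<phi> t x" "\<lambda>t. \<psi> t x"]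
      by (simp add: set_lebesgue_integral_def)
    also have "\<dots> \<le> (\<integral>\<^sup>+t. ennreal (norm (indicator {0..k} t *\<^sub>R (\<phi> t x - \<psi> t x))) \<partial>lborel)"
      by (rule integral_norm_bound_ennreal)
        (use elim set_integral_diff(1)[of lborel "{0..k}" "\<lambda>t. \<phi> t x" "\<lambda>t. \<psi> t x"]
          in \<open>simp add: set_integrable_def\<close>)
    also have "\<dots> = (\<integral>\<^sup>+t. ennreal (norm (\<phi> t x - \<psi> t x)) * indicator {0..k} t \<partial>lborel)"
      by (intro nn_integral_cong) (auto simp: indicator_def)
    finally show ?case
      by (cases "x \<in> A") (simp_all add: g_def)
  qed
  also have "\<dots> = (\<integral>\<^sup>+t. (\<integral>\<^sup>+x. g (t, x) \<partial>lborel) \<partial>lborel)"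
    using lborel_pair.Fubini[OF g] by simp
  also have "\<dots> \<le> (\<integral>\<^sup>+t. ennreal e * indicator {0..k} t \<partial>lborel)"
    by (intro nn_integral_mono) (use le in \<open>auto simp: g_def indicator_def\<close>)
  also have "\<dots> = ennreal e * ennreal k"
    using \<open>0 \<le> k\<close> by (simp add: nn_integral_cmult_indicator)
  also have "\<dots> = ennreal (k * e)"
    using assms(6,7) by (simp add: ennreal_mult mult.commute)
  finally show ?thesis .
qed

text \<open>A point y lies in [x, x + h] only for x in [y - h, y], an interval of length h, so
  exchanging the integrals produces the factor h. It later absorbs the number n of time steps, as n
  h <= T / lam.\<close>

lemma nn_integral_shear_le:
  fixes g :: "real \<Rightarrow> ennreal"
  assumes g: "g \<in> borel_measurable borel" and h: "0 \<le> h"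
  shows "(\<integral>\<^sup>+x\<in>{-R..R}. (\<integral>\<^sup>+y\<in>{x..x+h}. g y \<partial>lborel) \<partial>lborel) \<le> ennreal h * (\<integral>\<^sup>+y\<in>{-R..R+h}. g y \<partial>lborel)"
proof -
  note [measurable] = g
  have "(\<lambda>p. g (snd p) * indicator {p. fst p \<le> snd p \<and> snd p \<le> fst p + h} p * indicator {-R..R} (fst p))
     \<in> borel_measurable (borel \<Otimes>\<^sub>M borel)"
    by measurable
  then have m: "(\<lambda>p. g (snd p) * indicator {p. fst p \<le> snd p \<and> snd p \<le> fst p + h} p * indicator {-R..R} (fst p))
     \<in> borel_measurable (lborel \<Otimes>\<^sub>M lborel)"
    by (simp cong: measurable_cong_sets sets_pair_measure_cong)
  have "(\<integral>\<^sup>+x\<in>{-R..R}. (\<integral>\<^sup>+y\<in>{x..x+h}. g y \<partial>lborel) \<partial>lborel)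
      = (\<integral>\<^sup>+x. (\<integral>\<^sup>+y. g y * indicator {p. fst p \<le> snd p \<and> snd p \<le> fst p + h} (x, y) * indicator {-R..R} x \<partial>lborel) \<partial>lborel)"
  proof (intro nn_integral_cong)
    fix x :: real
    show "(\<integral>\<^sup>+y\<in>{x..x+h}. g y \<partial>lborel) * indicator {-R..R} x
      = (\<integral>\<^sup>+y. g y * indicator {p. fst p \<le> snd p \<and> snd p \<le> fst p + h} (x, y) * indicator {-R..R} x \<partial>lborel)"
      by (subst nn_integral_multc[symmetric]) (auto intro!: nn_integral_cong simp: indicator_def)
  qed
  also have "\<dots> = (\<integral>\<^sup>+y. (\<integral>\<^sup>+x. g y * indicator {p. fst p \<le> snd p \<and> snd p \<le> fst p + h} (x, y) * indicator {-R..R} x \<partial>lborel) \<partial>lborel)"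
    using lborel_pair.Fubini[OF m] by simp
  also have "\<dots> \<le> (\<integral>\<^sup>+y. (\<integral>\<^sup>+x. (g y * indicator {-R..R+h} y) * indicator {y - h..y} x \<partial>lborel) \<partial>lborel)"
    by (intro nn_integral_mono) (auto simp: indicator_def)
  also have "\<dots> = (\<integral>\<^sup>+y. (g y * indicator {-R..R+h} y) * ennreal h \<partial>lborel)"
    using h by (simp add: nn_integral_cmult_indicator)
  also have "\<dots> = (\<integral>\<^sup>+y\<in>{-R..R+h}. g y \<partial>lborel) * ennreal h"
    by (rule nn_integral_multc) measurable
  finally show ?thesis by (simp add: mult.commute)
qed

lemma set_integral_Icc_translate:
  fixes \<phi> :: "real \<Rightarrow> real ^ 'd::finite"
  shows "(LINT t:{a..a + k}|lborel. \<phi> t) = (LINT t:{0..k}|lborel. \<phi> (a + t))"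
proof -
  have "(LINT t|lborel. indicator {a..a + k} t *\<^sub>R \<phi> t)
      = \<bar>1\<bar> *\<^sub>R (LINT t|lborel. indicator {a..a + k} (a + 1 * t) *\<^sub>R \<phi> (a + 1 * t))"
    by (rule lborel_integral_real_affine) simp
  also have "\<dots> = (LINT t|lborel. indicator {0..k} t *\<^sub>R \<phi> (a + t))"
    by (simp add: indicator_def)
  finally show ?thesis by (simp add: set_lebesgue_integral_def)
qed

lemma set_integral_sum_steps:
  fixes \<phi> :: "real \<Rightarrow> real ^ 'd::finite"
  assumes "0 \<le> k" "set_integrable lborel {0..real n * k} \<phi>"
  shows "(LINT t:{0..real n * k}|lborel. \<phi> t) = (\<Sum>i<n. LINT t:{0..k}|lborel. \<phi> (real i * k + t))"
  using assms(2)
proof (induction n)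
  case 0
  show ?case using set_integral_point[of 0 \<phi>] by simp
next
  case (Suc n)
  have *: "real (Suc n) * k = real n * k + k" by (simp add: algebra_simps)
  have i: "set_integrable lborel {0..real n * k} \<phi>"
    using assms(1) by (intro set_integrable_subset[OF Suc.prems]) (auto simp: * simp del: of_nat_Suc)
  have "(LINT t:{0..real (Suc n) * k}|lborel. \<phi> t)
      = (LINT t:{0..real n * k}|lborel. \<phi> t) + (LINT t:{real n * k..real (Suc n) * k}|lborel. \<phi> t)"
    using assms(1) by (intro set_integral_Icc_combine Suc.prems) (auto simp: * simp del: of_nat_Suc)
  then show ?case
    unfolding * by (simp add: Suc.IH[OF i] set_integral_Icc_translate)
qed

section \<open>Piecewise linear interpolants in time\<close>

text \<open>On each time strip the expression is a fixed Borel function of (t, x), and there are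
  countably many strips.\<close>

lemma time_interpolant_measurable:
  assumes [measurable]: "\<And>n. th n \<in> borel_measurable borel"
  shows "(\<lambda>(t, x). time_interpolant k th t x) \<in> borel_measurable (borel :: (real \<times> real) measure)"
proof -
  have "(\<lambda>p. (1 / k) *\<^sub>R ((real (Suc n) * k - fst p) *\<^sub>R th n (snd p) + (fst p - real n * k) *\<^sub>R th (Suc n) (snd p)))
      \<in> borel_measurable (borel \<Otimes>\<^sub>M borel)" for n
    by measurable
  moreover have "(\<lambda>p. nat \<lfloor>fst p / k\<rfloor>) \<in> measurable (borel \<Otimes>\<^sub>M borel) (count_space UNIV)"
    by measurable
  ultimately have "(\<lambda>p. (\<lambda>n p. (1 / k) *\<^sub>R ((real (Suc n) * k - fst p) *\<^sub>R th n (snd p) + (fst p - real n * k) *\<^sub>R th (Suc n) (snd p)))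
      (nat \<lfloor>fst p / k\<rfloor>) p) \<in> borel_measurable (borel \<Otimes>\<^sub>M borel)"
    by (rule measurable_compose_countable)
  then show ?thesis
    by (simp add: time_interpolant_def Let_def case_prod_unfold borel_prod)
qed

lemma time_interpolant_segment:
  assumes k: "0 < k" and t: "real n * k \<le> t" "t < real (Suc n) * k"
  shows "time_interpolant k th t x
    = ((real (Suc n) * k - t) / k) *\<^sub>R th n x + ((t - real n * k) / k) *\<^sub>R th (Suc n) x"
proof -
  have "\<lfloor>t / k\<rfloor> = int n"
    using k t by (simp add: floor_eq_iff pos_le_divide_eq pos_divide_less_eq add.commute)
  then show ?thesis
    by (simp add: time_interpolant_def Let_def scaleR_add_right del: of_nat_Suc)
qed

lemma time_interpolant_grid:
  assumes "0 < k"
  shows "time_interpolant k th (real n * k) = th n"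
  using assms by (intro ext) (subst time_interpolant_segment[where n=n], auto simp: algebra_simps)

lemma AE_greaterThanLessThan_ex:
  assumes "AE t in lborel. Q t" "a < (b::real)"
  shows "\<exists>t. a < t \<and> t < b \<and> Q t"
proof (rule ccontr)
  assume "\<not> ?thesis"
  with assms(1) have "AE t in lborel. t \<notin> {a<..<b}"
    by (auto elim: eventually_mono)
  then have "{a<..<b} \<in> null_sets lborel"
    by (subst AE_iff_null_sets) simp_all
  then show False using assms(2) by (simp add: null_sets_def emeasure_lborel_Ioo)
qed

text \<open>\<open>Linf_bound\<close> speaks of almost every t, and the grid times are a null set. A
  bound inside a linear segment at a sequence s -> 0 passes to its left endpoint.\<close>

lemma AE_norm_le_of_segment:
  fixes y z :: "'d::finite fld"
  assumes "AE s in lborel. 0 < s \<and> s < 1 \<longrightarrow> (AE x in lborel. norm ((1 - s) *\<^sub>R y x + s *\<^sub>R z x) \<le> M)"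
  shows "AE x in lborel. norm (y x) \<le> M"
proof -
  have "\<forall>i. \<exists>s. 0 < s \<and> s < inverse (real (Suc i)) \<and> (AE x in lborel. norm ((1 - s) *\<^sub>R y x + s *\<^sub>R z x) \<le> M)"
  proof
    fix i
    have "inverse (real (Suc i)) \<le> 1" by (simp add: inverse_le_1_iff)
    with AE_greaterThanLessThan_ex[OF assms, of 0 "inverse (real (Suc i))"]
    show "\<exists>s. 0 < s \<and> s < inverse (real (Suc i)) \<and> (AE x in lborel. norm ((1 - s) *\<^sub>R y x + s *\<^sub>R z x) \<le> M)"
      by force
  qed
  from choice[OF this] obtain s where s: "\<And>i. 0 < s i" "\<And>i. s i < inverse (real (Suc i))"
    "\<And>i. AE x in lborel. norm ((1 - s i) *\<^sub>R y x + s i *\<^sub>R z x) \<le> M"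
    by blast
  have s0: "s \<longlonglongrightarrow> 0"
    by (rule tendsto_sandwich[OF _ _ tendsto_const LIMSEQ_inverse_real_of_nat])
      (simp_all add: s less_imp_le del: of_nat_Suc)
  have "(\<lambda>i. (1 - s i) *\<^sub>R y x + s i *\<^sub>R z x) \<longlonglongrightarrow> (1 - 0) *\<^sub>R y x + 0 *\<^sub>R z x" for x
    by (intro tendsto_intros s0)
  then show ?thesis
    by (intro AE_bounded_limit[where y="\<lambda>i x. (1 - s i) *\<^sub>R y x + s i *\<^sub>R z x" and z=y, OF s(3)]) simp
qed

text \<open>Affine maps preserve null sets. This serves to parametrize a time step by s in (0, 1)
  and, with c = -1, to reverse a segment.\<close>

lemma AE_lborel_affine:
  assumes "AE t in lborel. Q t" "(c::real) \<noteq> 0"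
  shows "AE s in lborel. Q (a + c * s)"
proof -
  obtain Z where Z: "Z \<in> null_sets lborel" "{t. \<not> Q t} \<subseteq> Z"
    using assms(1) by (auto elim!: AE_E3) (metis (mono_tags, lifting) mem_Collect_eq subsetI)
  have "AE t in lborel. t \<notin> Z" using Z(1) by (rule AE_not_in)
  then have "AE t in density (distr lborel borel (\<lambda>x. a + c * x)) (\<lambda>_. ennreal \<bar>c\<bar>). t \<notin> Z"
    by (subst lborel_real_affine[OF assms(2), symmetric])
  then have "AE t in distr lborel borel (\<lambda>x. a + c * x). t \<notin> Z"
    using assms(2) by (simp add: AE_density)
  moreover have "{x \<in> space borel. x \<notin> Z} \<in> sets borel"
    using null_setsD2[OF Z(1)] by simp
  ultimately have "AE s in lborel. a + c * s \<notin> Z"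
    by (subst (asm) AE_distr_iff) auto
  then show ?thesis by eventually_elim (use Z(2) in blast)
qed

lemma time_interpolant_nodes_bounded:
  fixes th :: "nat \<Rightarrow> 'd::finite fld"
  assumes k: "0 < k" and N: "0 < N" "real N * k = T" and bdd: "Linf_bound T (time_interpolant k th) M" and n: "n \<le> N"
  shows "AE x in lborel. norm (th n x) \<le> M"
proof -
  have seg: "AE s in lborel. 0 < s \<and> s < 1 \<longrightarrow> (AE x in lborel. norm ((1 - s) *\<^sub>R th i x + s *\<^sub>R th (Suc i) x) \<le> M)"
    if i: "i < N" for i
  proof -
    have "AE s in lborel. real i * k + k * s \<in> {0..T} \<longrightarrow> (AE x in lborel. norm (time_interpolant k th (real i * k + k * s) x) \<le> M)"
      using AE_lborel_affine[OF bdd[unfolded Linf_bound_def], of k "real i * k"] k by simp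
    then show ?thesis
    proof eventually_elim
      case (elim s)
      show ?case
      proof
        assume s: "0 < s \<and> s < 1"
        have "real (Suc i) * k \<le> T" using i k N(2) by (metis Suc_leI less_eq_real_def mult_right_mono of_nat_mono)
        moreover have ks: "k * s < k" "0 < k * s" using s k by auto
        moreover have "real (Suc i) * k = real i * k + k" by (simp add: algebra_simps)
        moreover have "0 \<le> real i * k" using k by simp
        ultimately have mem: "real i * k + k * s \<in> {0..T}"
          unfolding atLeastAtMost_iff by linarith
        have "time_interpolant k th (real i * k + k * s) x = (1 - s) *\<^sub>R th i x + s *\<^sub>R th (Suc i) x" for x
        proof -
          have "(real (Suc i) * k - (real i * k + k * s)) / k = 1 - s" "(real i * k + k * s - real i * k) / k = s"
            using k by (simp_all add: field_simps)
          moreover have "time_interpolant k th (real i * k + k * s) x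
            = ((real (Suc i) * k - (real i * k + k * s)) / k) *\<^sub>R th i x + ((real i * k + k * s - real i * k) / k) *\<^sub>R th (Suc i) x"
            using ks by (intro time_interpolant_segment[OF k]) (simp_all add: algebra_simps)
          ultimately show ?thesis by (simp only:)
        qed
        with elim mem show "AE x in lborel. norm ((1 - s) *\<^sub>R th i x + s *\<^sub>R th (Suc i) x) \<le> M" by simp
      qed
    qed
  qed
  show ?thesis
  proof (cases "n < N")
    case True
    then show ?thesis by (rule AE_norm_le_of_segment[OF seg])
  next
    case False
    with n N obtain i where i: "n = Suc i" "i < N" by (cases n) auto
    \<comment> \<open>The last node is not a left endpoint within [0, T]; substituting 1 - s makes
      it the left endpoint of the reversed last segment.\<close>
    have "AE s in lborel. 0 < s \<and> s < 1 \<longrightarrow> (AE x in lborel. norm ((1 - s) *\<^sub>R th (Suc i) x + s *\<^sub>R th i x) \<le> M)"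
      using AE_lborel_affine[OF seg[OF i(2)], of "-1" 1] by (simp add: add.commute conj_commute)
    then show ?thesis unfolding i(1) by (rule AE_norm_le_of_segment)
  qed
qed

text \<open>Values between nodes are convex combinations of two bounded nodes; this upgrades the
  bound from almost every t to every t.\<close>

lemma time_interpolant_bounded:
  fixes th :: "nat \<Rightarrow> 'd::finite fld"
  assumes k: "0 < k" and N: "real N * k = T" and t: "t \<in> {0..T}"
    and th: "\<And>n. n \<le> N \<Longrightarrow> AE x in lborel. norm (th n x) \<le> M"
  shows "AE x in lborel. norm (time_interpolant k th t x) \<le> M"
\<comment> \<open>At t = T the index is N and the formula mentions \<open>th (Suc N)\<close>, for
  which no bound is available; the grid value avoids it.\<close>
proof (cases "t = T")
  case True
  then show ?thesis using time_interpolant_grid[OF k, of th N] th[of N] N by simp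
next
  case False
  define n where "n = nat \<lfloor>t / k\<rfloor>"
  have "real n = of_int \<lfloor>t / k\<rfloor>" using t k by (simp add: n_def)
  then have "real n \<le> t / k" "t / k < real n + 1" by linarith+
  then have n: "real n * k \<le> t" "t < real (Suc n) * k"
    using k by (simp_all add: pos_le_divide_eq pos_divide_less_eq algebra_simps)
  from n(1) t False N have "real n * k < real N * k" by auto
  with k have "n < N" by simp
  then have "AE x in lborel. norm (th n x) \<le> M" "AE x in lborel. norm (th (Suc n) x) \<le> M"
    by (auto intro: th)
  then show ?thesis
  proof eventually_elim
    case (elim x)
    define a b where "a = (real (Suc n) * k - t) / k" and "b = (t - real n * k) / k"
    have ab: "0 \<le> a" "0 \<le> b" "a + b = 1"
      using n k by (simp_all add: a_def b_def field_simps)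
    have "norm (a *\<^sub>R th n x + b *\<^sub>R th (Suc n) x) \<le> a * M + b * M"
      using elim ab(1,2) by (intro norm_triangle_mono) (simp_all add: mult_left_mono)
    also have "\<dots> = M" using ab(3) by (simp flip: distrib_right)
    finally show ?case by (simp only: time_interpolant_segment[OF k n] a_def b_def)
  qed
qed

section \<open>The limit of a consistent scheme\<close>

text \<open>\<open>\<theta> m n\<close> is the \<open>n\<close>-th iterate for the time step \<open>k m\<close>, \<open>\<sigma> m n\<close> the exact short-time solution
  starting from it, and \<open>w\<close> a jointly measurable version of the limit \<open>v\<close>.\<close>

locale convergent_fv_scheme =
  fixes f :: "real ^ 'd \<Rightarrow> real ^ 'd::finite"
    and T lam q C M :: real and k :: "nat \<Rightarrow> real" and N :: "nat \<Rightarrow> nat"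
    and \<theta> :: "nat \<Rightarrow> nat \<Rightarrow> 'd fld" and \<sigma> :: "nat \<Rightarrow> nat \<Rightarrow> real \<Rightarrow> 'd fld"
    and v w :: "real \<Rightarrow> 'd fld"
  assumes T_pos: "0 < T" and lam_pos: "0 < lam" and q_pos: "0 < q" and C_nonneg: "0 \<le> C" and M_nonneg: "0 \<le> M"
    and k_pos: "\<And>m. 0 < k m" and k_lim: "k \<longlonglongrightarrow> 0" and Nk: "\<And>m. real (N m) * k m = T"
    and f_cont: "continuous_on UNIV f"
    and \<theta>_L1loc: "\<And>m n. n \<le> N m \<Longrightarrow> \<theta> m n \<in> L1loc"
    and \<theta>_bounded: "\<And>m n. n \<le> N m \<Longrightarrow> AE x in lborel. norm (\<theta> m n x) \<le> M"
    and v_cont: "C_L1loc T v"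
    and \<theta>_lim: "\<And>e. 0 < e \<Longrightarrow> \<forall>\<^sub>F m in sequentially. \<forall>n\<le>N m. L1loc_dist (\<theta> m n) (v (real n * k m)) < e"
    and \<sigma>_balance: "\<And>m n. n < N m \<Longrightarrow> balance_law f (k m) (\<sigma> m n)"
    and \<sigma>_init: "\<And>m n. n < N m \<Longrightarrow> AE x in lborel. \<sigma> m n 0 x = \<theta> m n x"
    and \<sigma>_persist: "\<And>r n \<tau> t. strict_mono r \<Longrightarrow> \<forall>i. n i < N (r i) \<and> 0 \<le> \<tau> i \<and> \<tau> i \<le> k (r i) \<Longrightarrow>
          t \<in> {0..T} \<Longrightarrow> (\<lambda>i::nat. L1loc_dist (\<theta> (r i) (n i)) (v t)) \<longlonglongrightarrow> 0 \<Longrightarrow>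
          (\<exists>B. \<forall>i. AE x in lborel. norm (\<sigma> (r i) (n i) (\<tau> i) x) \<le> B) \<and>
          (\<lambda>i. L1loc_dist (\<sigma> (r i) (n i) (\<tau> i)) (v t)) \<longlonglongrightarrow> 0"
    and conservation: "\<And>m n j. n < N m \<Longrightarrow>
          norm ((LINT x:{half_pt lam (k m) (j - 1)..half_pt lam (k m) j}|lborel. \<theta> m (Suc n) x - \<theta> m n x)
            + (flux_integral f (\<sigma> m n) 0 (k m) (half_pt lam (k m) j)
              - flux_integral f (\<sigma> m n) 0 (k m) (half_pt lam (k m) (j - 1)))) \<le> C * k m powr (2 + q)"
    and w_meas: "(\<lambda>(t, x). w t x) \<in> borel_measurable (borel :: (real \<times> real) measure)"
    and w_bounded: "\<And>t x. norm (w t x) \<le> M"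
    and w_version: "\<And>t. t \<in> {0..T} \<Longrightarrow> AE x in lborel. w t x = v t x"
begin

lemma v_L1loc: "t \<in> {0..T} \<Longrightarrow> v t \<in> L1loc"
  using v_cont by (simp add: C_L1loc_def)

lemma v_bounded: "t \<in> {0..T} \<Longrightarrow> AE x in lborel. norm (v t x) \<le> M"
  using w_version[of t] w_bounded by (auto elim!: eventually_mono) metis

lemma \<sigma>_L1loc: "n < N m \<Longrightarrow> 0 \<le> \<tau> \<Longrightarrow> \<tau> \<le> k m \<Longrightarrow> \<sigma> m n \<tau> \<in> L1loc"
  using \<sigma>_balance by (simp add: balance_law_def)

lemma step_time_le:
  assumes "n < N m" "\<tau> \<le> k m"
  shows "real n * k m + \<tau> \<le> T"
proof -
  have "real n * k m + \<tau> \<le> real (Suc n) * k m"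
    using assms(2) by (simp add: algebra_simps)
  also have "\<dots> \<le> real (N m) * k m"
    using assms(1) k_pos[of m] by (intro mult_right_mono) auto
  finally show ?thesis by (simp add: Nk)
qed

lemma grid_time_mem: "n \<le> N m \<Longrightarrow> real n * k m \<in> {0..T}"
  using k_pos[of m] Nk[of m] mult_right_mono[of "real n" "real (N m)" "k m"] by auto

lemma step_time_mem: "n < N m \<Longrightarrow> 0 \<le> \<tau> \<Longrightarrow> \<tau> \<le> k m \<Longrightarrow> real n * k m + \<tau> \<in> {0..T}"
  using k_pos[of m] step_time_le by auto

section \<open>Compactness over all time steps\<close>

lemma \<theta>_dist_tendsto:
  assumes r: "strict_mono r" and n: "\<And>i. n i \<le> N (r i)"
  shows "(\<lambda>i. L1loc_dist (\<theta> (r i) (n i)) (v (real (n i) * k (r i)))) \<longlonglongrightarrow> 0"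
proof (rule order_tendstoI)
  fix e :: real
  assume "0 < e"
  from eventually_compose_filterlim[OF \<theta>_lim[OF this] filterlim_subseq[OF r]]
  show "\<forall>\<^sub>F i in sequentially. L1loc_dist (\<theta> (r i) (n i)) (v (real (n i) * k (r i))) < e"
    by eventually_elim (use n in auto)
next
  fix e :: real
  assume "e < 0"
  then show "\<forall>\<^sub>F i in sequentially. e < L1loc_dist (\<theta> (r i) (n i)) (v (real (n i) * k (r i)))"
    by (intro always_eventually allI) (rule order.strict_trans2[OF _ L1loc_dist_nonneg])
qed

text \<open>Any choice of steps and in-step times has its times in the compact interval [0, T],
  hence a subsequence converging to some t. As the step sizes tend to 0, the grid times have the
  same limit. Continuity of v, uniform convergence of the iterates and persistence then give all
  three functions the limit \<open>v t\<close> in L1loc.\<close>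

lemma step_compactness:
  fixes r n :: "nat \<Rightarrow> nat" and \<tau> :: "nat \<Rightarrow> real"
  assumes r: "strict_mono r" and n: "\<And>i. n i < N (r i)" and \<tau>: "\<And>i. 0 \<le> \<tau> i" "\<And>i. \<tau> i \<le> k (r i)"
  obtains s t B where "strict_mono s" "t \<in> {0..T}"
    "\<And>i. AE x in lborel. norm (\<sigma> (r (s i)) (n (s i)) (\<tau> (s i)) x) \<le> B"
    "AE x in lborel. (\<lambda>i. \<sigma> (r (s i)) (n (s i)) (\<tau> (s i)) x) \<longlonglongrightarrow> v t x"
    "AE x in lborel. (\<lambda>i. \<theta> (r (s i)) (n (s i)) x) \<longlonglongrightarrow> v t x"
    "AE x in lborel. (\<lambda>i. v (real (n (s i)) * k (r (s i)) + \<tau> (s i)) x) \<longlonglongrightarrow> v t x"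
proof -
  have mem: "real (n i) * k (r i) + \<tau> i \<in> {0..T}" for i
    by (intro step_time_mem n \<tau>)
  have "seq_compact {0..T}" by (simp add: compact_imp_seq_compact)
  from seq_compactE[OF this, of "\<lambda>i. real (n i) * k (r i) + \<tau> i"] mem
  obtain t s0 where t: "t \<in> {0..T}" and s0: "strict_mono s0"
      "(\<lambda>i. real (n (s0 i)) * k (r (s0 i)) + \<tau> (s0 i)) \<longlonglongrightarrow> t"
    unfolding o_def by blast
  have rs: "strict_mono (\<lambda>i. r (s0 i))"
    using strict_mono_o[OF r s0(1)] by (simp add: o_def)
  have ks: "(\<lambda>i. k (r (s0 i))) \<longlonglongrightarrow> 0"
    using LIMSEQ_subseq_LIMSEQ[OF k_lim rs] by (simp add: o_def)
  have "(\<lambda>i. \<tau> (s0 i)) \<longlonglongrightarrow> 0"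
    by (rule tendsto_sandwich[OF _ _ tendsto_const ks]) (simp_all add: \<tau>)
  from tendsto_diff[OF s0(2) this] have t0: "(\<lambda>i. real (n (s0 i)) * k (r (s0 i))) \<longlonglongrightarrow> t"
    by simp
  have d1: "(\<lambda>i. L1loc_dist (v (real (n (s0 i)) * k (r (s0 i)))) (v t)) \<longlonglongrightarrow> 0"
    by (rule C_L1loc_tendsto_sequentially[OF v_cont t _ t0]) (rule grid_time_mem[OF less_imp_le[OF n]])
  have d2: "(\<lambda>i. L1loc_dist (v (real (n (s0 i)) * k (r (s0 i)) + \<tau> (s0 i))) (v t)) \<longlonglongrightarrow> 0"
    by (rule C_L1loc_tendsto_sequentially[OF v_cont t mem s0(2)])
  have d3: "(\<lambda>i. L1loc_dist (\<theta> (r (s0 i)) (n (s0 i))) (v t)) \<longlonglongrightarrow> 0"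
  proof (rule tendsto_sandwich[OF always_eventually always_eventually tendsto_const])
    show "(\<lambda>i. L1loc_dist (\<theta> (r (s0 i)) (n (s0 i))) (v (real (n (s0 i)) * k (r (s0 i))))
        + L1loc_dist (v (real (n (s0 i)) * k (r (s0 i)))) (v t)) \<longlonglongrightarrow> 0"
      using tendsto_add[OF \<theta>_dist_tendsto[OF rs] d1] n by (simp add: less_imp_le)
    show "\<forall>i. L1loc_dist (\<theta> (r (s0 i)) (n (s0 i))) (v t)
        \<le> L1loc_dist (\<theta> (r (s0 i)) (n (s0 i))) (v (real (n (s0 i)) * k (r (s0 i))))
          + L1loc_dist (v (real (n (s0 i)) * k (r (s0 i)))) (v t)"
      using \<theta>_L1loc[OF less_imp_le[OF n]] v_L1loc[OF grid_time_mem[OF less_imp_le[OF n]]] v_L1loc[OF t]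
      by (auto intro!: L1loc_dist_triangle)
  qed (simp add: L1loc_dist_nonneg)
  have "\<forall>i. n (s0 i) < N (r (s0 i)) \<and> 0 \<le> \<tau> (s0 i) \<and> \<tau> (s0 i) \<le> k (r (s0 i))"
    by (simp add: n \<tau>)
  from \<sigma>_persist[OF rs this t d3]
  obtain B where B: "\<And>i. AE x in lborel. norm (\<sigma> (r (s0 i)) (n (s0 i)) (\<tau> (s0 i)) x) \<le> B"
    and d4: "(\<lambda>i. L1loc_dist (\<sigma> (r (s0 i)) (n (s0 i)) (\<tau> (s0 i))) (v t)) \<longlonglongrightarrow> 0"
    by blast
  \<comment> \<open>Three successive extractions for the three functions; limits found earlier
    persist along further subsequences.\<close>
  obtain s1 where s1: "strict_mono s1"
    "AE x in lborel. (\<lambda>i. \<sigma> (r (s0 (s1 i))) (n (s0 (s1 i))) (\<tau> (s0 (s1 i))) x) \<longlonglongrightarrow> v t x"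
    by (rule L1loc_dist_AE_subseq[OF \<sigma>_L1loc[OF n \<tau>] v_L1loc[OF t] d4]) blast
  obtain s2 where s2: "strict_mono s2"
    "AE x in lborel. (\<lambda>i. \<theta> (r (s0 (s1 (s2 i)))) (n (s0 (s1 (s2 i)))) x) \<longlonglongrightarrow> v t x"
    by (rule L1loc_dist_AE_subseq[OF \<theta>_L1loc[OF less_imp_le[OF n]] v_L1loc[OF t]
          LIMSEQ_subseq_LIMSEQ[OF d3 s1(1), unfolded o_def]]) blast
  have s12: "strict_mono (\<lambda>i. s1 (s2 i))"
    using strict_mono_o[OF s1(1) s2(1)] by (simp add: o_def)
  obtain s3 where s3: "strict_mono s3"
    "AE x in lborel. (\<lambda>i. v (real (n (s0 (s1 (s2 (s3 i))))) * k (r (s0 (s1 (s2 (s3 i))))) + \<tau> (s0 (s1 (s2 (s3 i))))) x) \<longlonglongrightarrow> v t x"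
    by (rule L1loc_dist_AE_subseq[OF v_L1loc[OF mem] v_L1loc[OF t]
          LIMSEQ_subseq_LIMSEQ[OF d2 s12, unfolded o_def]]) blast
  define s where "s = (\<lambda>i. s0 (s1 (s2 (s3 i))))"
  have s23: "strict_mono (\<lambda>i. s2 (s3 i))"
    using strict_mono_o[OF s2(1) s3(1)] by (simp add: o_def)
  show ?thesis
  proof (rule that[of s t B])
    show "strict_mono s"
      using strict_mono_o[OF s0(1) strict_mono_o[OF s1(1) s23]] by (simp add: o_def s_def)
    show "AE x in lborel. (\<lambda>i. \<sigma> (r (s i)) (n (s i)) (\<tau> (s i)) x) \<longlonglongrightarrow> v t x"
      using s1(2) by eventually_elim (auto dest: LIMSEQ_subseq_LIMSEQ[OF _ s23] simp: s_def o_def)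
    show "AE x in lborel. (\<lambda>i. \<theta> (r (s i)) (n (s i)) x) \<longlonglongrightarrow> v t x"
      using s2(2) by eventually_elim (auto dest: LIMSEQ_subseq_LIMSEQ[OF _ s3(1)] simp: s_def o_def)
  qed (use t B s3(2) in \<open>simp_all add: s_def\<close>)
qed

text \<open>If the property failed for infinitely many m, bad steps and in-step times could be
  chosen along an enumeration of these m, against the good index that the hypothesis provides for
  every such choice. Uniformity is thus reduced to sequences, where compactness applies.\<close>

lemma eventually_all_steps:
  assumes "\<And>r n \<tau>. strict_mono r \<Longrightarrow> (\<And>i. n i < N (r i)) \<Longrightarrow> (\<And>i. 0 \<le> \<tau> i) \<Longrightarrow> (\<And>i. \<tau> i \<le> k (r i)) \<Longrightarrow>
      \<exists>i::nat. Q (r i) (n i) (\<tau> i)"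
  shows "\<forall>\<^sub>F m in sequentially. \<forall>n<N m. \<forall>\<tau>\<in>{0..k m}. Q m n \<tau>"
proof (rule ccontr)
  define P where "P = (\<lambda>m. \<not> (\<forall>n<N m. \<forall>\<tau>\<in>{0..k m}. Q m n \<tau>))"
  assume "\<not> ?thesis"
  then have "\<exists>\<^sub>F m in sequentially. P m"
    unfolding P_def not_eventually .
  then have inf: "infinite {m. P m}"
    by (simp add: frequently_cofinite flip: cofinite_eq_sequentially)
  define r where "r = enumerate {m. P m}"
  have "P (r i)" for i
    using enumerate_in_set[OF inf] by (simp add: r_def)
  then have "\<forall>i. \<exists>p. fst p < N (r i) \<and> snd p \<in> {0..k (r i)} \<and> \<not> Q (r i) (fst p) (snd p)"
    unfolding P_def by force
  from choice[OF this] obtain p where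
    p: "\<And>i. fst (p i) < N (r i)" "\<And>i. snd (p i) \<in> {0..k (r i)}" "\<And>i. \<not> Q (r i) (fst (p i)) (snd (p i))"
    by blast
  have "strict_mono r"
    unfolding r_def by (rule strict_mono_enumerate[OF inf])
  from assms[OF this, of "\<lambda>i. fst (p i)" "\<lambda>i. snd (p i)"] p show False
    by force
qed

text \<open>Both functions are compared with \<open>f (v t)\<close> at an accumulation time t of the
  chosen steps. Local integrability is part of the claim because an L-infinity bound for \<sigma> is
  known only along sequences, with B depending on the sequence.\<close>

lemma flux_approximation:
  assumes e: "0 < e"
  shows "\<forall>\<^sub>F m in sequentially. \<forall>n<N m. \<forall>\<tau>\<in>{0..k m}.
    (\<lambda>x. f (\<sigma> m n \<tau> x)) \<in> L1loc \<and> L1_seminorm R (\<lambda>x. f (\<sigma> m n \<tau> x) - f (v (real n * k m + \<tau>) x)) < e"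
proof (rule eventually_all_steps)
  fix r :: "nat \<Rightarrow> nat" and n and \<tau> :: "nat \<Rightarrow> real"
  assume r: "strict_mono r" and n: "\<And>i. n i < N (r i)" and \<tau>: "\<And>i. 0 \<le> \<tau> i" "\<And>i. \<tau> i \<le> k (r i)"
  obtain s t B where s: "strict_mono s" and t: "t \<in> {0..T}"
    and B: "\<And>i. AE x in lborel. norm (\<sigma> (r (s i)) (n (s i)) (\<tau> (s i)) x) \<le> B"
    and lims: "AE x in lborel. (\<lambda>i. \<sigma> (r (s i)) (n (s i)) (\<tau> (s i)) x) \<longlonglongrightarrow> v t x"
    "AE x in lborel. (\<lambda>i. v (real (n (s i)) * k (r (s i)) + \<tau> (s i)) x) \<longlonglongrightarrow> v t x"
    by (rule step_compactness[OF r n \<tau>]) blast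
  let ?y = "\<lambda>i. \<sigma> (r (s i)) (n (s i)) (\<tau> (s i))"
  let ?z = "\<lambda>i. v (real (n (s i)) * k (r (s i)) + \<tau> (s i))"
  have y: "?y i \<in> L1loc" for i by (intro \<sigma>_L1loc n \<tau>)
  have mem: "real (n (s i)) * k (r (s i)) + \<tau> (s i) \<in> {0..T}" for i
    by (intro step_time_mem n \<tau>)
  have fy: "(\<lambda>x. f (?y i x)) \<in> L1loc" for i
    by (rule L1loc_comp_bounded[OF f_cont y B])
  have fz: "(\<lambda>x. f (?z i x)) \<in> L1loc" for i
    by (rule L1loc_comp_bounded[OF f_cont v_L1loc[OF mem] v_bounded[OF mem]])
  have fv: "(\<lambda>x. f (v t x)) \<in> L1loc"
    by (rule L1loc_comp_bounded[OF f_cont v_L1loc[OF t] v_bounded[OF t]])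
  have l1: "(\<lambda>i. L1_seminorm R (\<lambda>x. f (?y i x) - f (v t x))) \<longlonglongrightarrow> 0"
    by (rule L1_seminorm_comp_tendsto[OF f_cont y v_L1loc[OF t] B lims(1)])
  have l2: "(\<lambda>i. L1_seminorm R (\<lambda>x. f (?z i x) - f (v t x))) \<longlonglongrightarrow> 0"
    by (rule L1_seminorm_comp_tendsto[OF f_cont v_L1loc[OF mem] v_L1loc[OF t] v_bounded[OF mem] lims(2)])
  have "(\<lambda>i. L1_seminorm R (\<lambda>x. f (?y i x) - f (v t x)) + L1_seminorm R (\<lambda>x. f (?z i x) - f (v t x))) \<longlonglongrightarrow> 0"
    using tendsto_add[OF l1 l2] by simp
  from order_tendstoD(2)[OF this e]
  obtain i where i: "L1_seminorm R (\<lambda>x. f (?y i x) - f (v t x)) + L1_seminorm R (\<lambda>x. f (?z i x) - f (v t x)) < e"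
    using eventually_happens'[OF sequentially_bot] by blast
  have "L1_seminorm R (\<lambda>x. f (v t x) - f (?z i x)) = L1_seminorm R (\<lambda>x. f (?z i x) - f (v t x))"
    by (simp add: L1_seminorm_def norm_minus_commute)
  with L1_seminorm_triangle[OF fy fv fz, of R i i] i
  have "L1_seminorm R (\<lambda>x. f (?y i x) - f (?z i x)) < e" by simp
  with fy show "\<exists>i. (\<lambda>x. f (\<sigma> (r i) (n i) (\<tau> i) x)) \<in> L1loc \<and>
      L1_seminorm R (\<lambda>x. f (\<sigma> (r i) (n i) (\<tau> i) x) - f (v (real (n i) * k (r i) + \<tau> i) x)) < e"
    by blast
qed

text \<open>The same comparison with the identity in place of f. At \<open>\<tau> = k m\<close> it
  bounds the increment of one exact step, which controls how much the flux varies in space.\<close>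

lemma data_approximation:
  assumes e: "0 < e"
  shows "\<forall>\<^sub>F m in sequentially. \<forall>n<N m. \<forall>\<tau>\<in>{0..k m}. L1_seminorm R (\<lambda>x. \<sigma> m n \<tau> x - \<theta> m n x) < e"
proof (rule eventually_all_steps)
  fix r :: "nat \<Rightarrow> nat" and n and \<tau> :: "nat \<Rightarrow> real"
  assume r: "strict_mono r" and n: "\<And>i. n i < N (r i)" and \<tau>: "\<And>i. 0 \<le> \<tau> i" "\<And>i. \<tau> i \<le> k (r i)"
  obtain s t B where s: "strict_mono s" and t: "t \<in> {0..T}"
    and B: "\<And>i. AE x in lborel. norm (\<sigma> (r (s i)) (n (s i)) (\<tau> (s i)) x) \<le> B"
    and lims: "AE x in lborel. (\<lambda>i. \<sigma> (r (s i)) (n (s i)) (\<tau> (s i)) x) \<longlonglongrightarrow> v t x"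
    "AE x in lborel. (\<lambda>i. \<theta> (r (s i)) (n (s i)) x) \<longlonglongrightarrow> v t x"
    by (rule step_compactness[OF r n \<tau>]) blast
  let ?y = "\<lambda>i. \<sigma> (r (s i)) (n (s i)) (\<tau> (s i))"
  let ?z = "\<lambda>i. \<theta> (r (s i)) (n (s i))"
  have y: "?y i \<in> L1loc" for i by (intro \<sigma>_L1loc n \<tau>)
  have z: "?z i \<in> L1loc" for i by (intro \<theta>_L1loc less_imp_le n)
  have zB: "AE x in lborel. norm (?z i x) \<le> M" for i by (intro \<theta>_bounded less_imp_le n)
  have l1: "(\<lambda>i. L1_seminorm R (\<lambda>x. ?y i x - v t x)) \<longlonglongrightarrow> 0"
    by (rule L1_seminorm_comp_tendsto[OF continuous_on_id y v_L1loc[OF t] B lims(1)])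
  have l2: "(\<lambda>i. L1_seminorm R (\<lambda>x. ?z i x - v t x)) \<longlonglongrightarrow> 0"
    by (rule L1_seminorm_comp_tendsto[OF continuous_on_id z v_L1loc[OF t] zB lims(2)])
  have "(\<lambda>i. L1_seminorm R (\<lambda>x. ?y i x - v t x) + L1_seminorm R (\<lambda>x. ?z i x - v t x)) \<longlonglongrightarrow> 0"
    using tendsto_add[OF l1 l2] by simp
  from order_tendstoD(2)[OF this e]
  obtain i where i: "L1_seminorm R (\<lambda>x. ?y i x - v t x) + L1_seminorm R (\<lambda>x. ?z i x - v t x) < e"
    using eventually_happens'[OF sequentially_bot] by blast
  have "L1_seminorm R (\<lambda>x. v t x - ?z i x) = L1_seminorm R (\<lambda>x. ?z i x - v t x)"
    by (simp add: L1_seminorm_def norm_minus_commute)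
  with L1_seminorm_triangle[OF y v_L1loc[OF t] z, of R i i] i
  have "L1_seminorm R (\<lambda>x. ?y i x - ?z i x) < e" by simp
  then show "\<exists>i. L1_seminorm R (\<lambda>x. \<sigma> (r i) (n i) (\<tau> i) x - \<theta> (r i) (n i) x) < e"
    by blast
qed

section \<open>Exact fluxes and the telescoped cell balances\<close>

definition flux :: "nat \<Rightarrow> nat \<Rightarrow> 'd fld" where
  "flux m n = flux_integral f (\<sigma> m n) 0 (k m)"

lemma is_flux_integral_flux:
  assumes "n < N m"
  shows "is_flux_integral f (\<sigma> m n) 0 (k m) (flux m n)"
proof -
  obtain g where g: "is_flux_integral f (\<sigma> m n) 0 (k m) g"
    using \<sigma>_balance[OF assms] k_pos[of m] unfolding balance_law_def
    by (metis less_eq_real_def order_refl)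
  then show ?thesis by (simp add: flux_def flux_integral_eqI[OF g])
qed

lemma flux_continuous: "n < N m \<Longrightarrow> continuous_on UNIV (flux m n)"
  using is_flux_integral_flux by (simp add: is_flux_integral_def)

text \<open>The exact balance law on [a, b] x [0, k m] trades the spatial variation of the flux for
  the increment of the exact solution over one step. The bound is an \<open>ennreal\<close> integral
  so that it can be averaged over the left endpoint by Tonelli.\<close>

lemma norm_flux_diff_le:
  assumes n: "n < N m" and "a \<le> b"
  shows "ennreal (norm (flux m n b - flux m n a))
    \<le> (\<integral>\<^sup>+y\<in>{a..b}. ennreal (norm (\<sigma> m n (k m) y - \<theta> m n y)) \<partial>lborel)"
proof -
  have k0: "0 \<le> k m" using k_pos[of m] by simp
  have L: "\<sigma> m n (k m) \<in> L1loc" "\<sigma> m n 0 \<in> L1loc" "\<theta> m n \<in> L1loc"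
    using \<sigma>_L1loc[OF n] \<theta>_L1loc n k0 by auto
  note [measurable] = L[THEN L1loc_borel_measurable]
  have "(LINT x:{a..b}|lborel. \<sigma> m n (k m) x) - (LINT x:{a..b}|lborel. \<sigma> m n 0 x)
      = - (flux m n b - flux m n a)"
    using \<sigma>_balance[OF n] k0 assms(2) unfolding balance_law_def flux_def by auto
  moreover have "(LINT x:{a..b}|lborel. \<sigma> m n 0 x) = (LINT x:{a..b}|lborel. \<theta> m n x)"
    unfolding set_lebesgue_integral_def
  proof (rule integral_cong_AE)
    show "AE x in lborel. indicator {a..b} x *\<^sub>R \<sigma> m n 0 x = indicator {a..b} x *\<^sub>R \<theta> m n x"
      using \<sigma>_init[OF n] by eventually_elim simp
  qed measurable
  ultimately have eq: "flux m n b - flux m n a = - (LINT x:{a..b}|lborel. \<sigma> m n (k m) x - \<theta> m n x)"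
    by (simp only: set_integral_diff(2)[OF L1loc_integrable[OF L(1)] L1loc_integrable[OF L(3)]] minus_minus)
  have "norm (flux m n b - flux m n a) = norm (LINT x|lborel. indicator {a..b} x *\<^sub>R (\<sigma> m n (k m) x - \<theta> m n x))"
    unfolding eq by (simp add: set_lebesgue_integral_def)
  also have "ennreal \<dots> \<le> (\<integral>\<^sup>+x. ennreal (norm (indicator {a..b} x *\<^sub>R (\<sigma> m n (k m) x - \<theta> m n x))) \<partial>lborel)"
    by (rule integral_norm_bound_ennreal)
      (use L1loc_integrable[OF L1loc_diff[OF L(1,3)]] in \<open>simp add: set_integrable_def\<close>)
  also have "\<dots> = (\<integral>\<^sup>+y\<in>{a..b}. ennreal (norm (\<sigma> m n (k m) y - \<theta> m n y)) \<partial>lborel)"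
    by (intro nn_integral_cong) (auto simp: indicator_def)
  finally show ?thesis .
qed

text \<open>The residual of the balance law on \<open>[0, x]\<close> over \<open>n\<close> time steps, up to a constant. By conservation
  it nearly takes the same value at all half points of the grid.\<close>

definition cell_balance :: "nat \<Rightarrow> nat \<Rightarrow> real \<Rightarrow> real ^ 'd" where
  "cell_balance m n x = (\<Sum>i<n. flux m i x) + (primitive (\<theta> m n) x - primitive (\<theta> m 0) x)"

text \<open>The primitives of consecutive iterates telescope in n, so each time step adds one
  residual of \<open>conservation\<close>.\<close>

lemma cell_balance_step:
  assumes "n \<le> N m"
  shows "norm (cell_balance m n (half_pt lam (k m) j) - cell_balance m n (half_pt lam (k m) (j - 1)))
    \<le> real n * (C * k m powr (2 + q))"
  using assms
proof (induction n)
  case 0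
  show ?case by (simp add: cell_balance_def)
next
  case (Suc n)
  let ?a = "half_pt lam (k m) (j - 1)" and ?b = "half_pt lam (k m) j"
  have ab: "?a \<le> ?b"
    unfolding half_pt_def using k_pos[of m] lam_pos by (intro mult_right_mono) auto
  have n: "n < N m" using Suc.prems by simp
  have L: "\<theta> m n \<in> L1loc" "\<theta> m (Suc n) \<in> L1loc" using \<theta>_L1loc Suc.prems by auto
  let ?r = "(LINT x:{?a..?b}|lborel. \<theta> m (Suc n) x - \<theta> m n x) + (flux m n ?b - flux m n ?a)"
  have "(LINT x:{?a..?b}|lborel. \<theta> m (Suc n) x - \<theta> m n x)
      = (primitive (\<theta> m (Suc n)) ?b - primitive (\<theta> m (Suc n)) ?a) - (primitive (\<theta> m n) ?b - primitive (\<theta> m n) ?a)"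
    by (simp add: primitive_diff[OF L(1) ab] primitive_diff[OF L(2) ab]
        set_integral_diff(2)[OF L1loc_integrable[OF L(2)] L1loc_integrable[OF L(1)]])
  then have "cell_balance m (Suc n) ?b - cell_balance m (Suc n) ?a
      = (cell_balance m n ?b - cell_balance m n ?a) + ?r"
    by (simp add: cell_balance_def algebra_simps)
  also have "norm \<dots> \<le> real n * (C * k m powr (2 + q)) + C * k m powr (2 + q)"
    using Suc.IH n conservation[OF n, of j]
    by (intro norm_triangle_mono) (simp_all add: flux_def)
  finally show ?case by (simp add: algebra_simps)
qed

text \<open>The number of cells and the number of steps, N m = T / k m, use up two powers of the
  step size and leave k^q. The extra cell allows for a half point just beyond the window.\<close>

lemma cell_balance_le:
  assumes n: "n \<le> N m" and j: "\<bar>real_of_int j\<bar> \<le> R * lam / k m + 1" and R: "0 \<le> R"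
  shows "norm (cell_balance m n (half_pt lam (k m) j) - cell_balance m n (half_pt lam (k m) 0))
    \<le> (R * lam + k m) * (T * C * k m powr q)"
proof -
  have k: "0 < k m" by (rule k_pos)
  have "norm (cell_balance m n (half_pt lam (k m) j) - cell_balance m n (half_pt lam (k m) 0))
      \<le> \<bar>real_of_int j\<bar> * (real n * (C * k m powr (2 + q)))"
    by (rule norm_diff_int_steps_le[of "\<lambda>j. cell_balance m n (half_pt lam (k m) j)", OF cell_balance_step[OF n]])
  also have "\<dots> \<le> (R * lam / k m + 1) * (real (N m) * (C * k m powr (2 + q)))"
    using n C_nonneg order.trans[OF abs_ge_zero j] by (intro mult_mono j) auto
  also have "k m powr (2 + q) = k m * (k m * k m powr q)"
    using k by (simp add: powr_add power2_eq_square)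
  also have "(R * lam / k m + 1) * (real (N m) * (C * (k m * (k m * k m powr q))))
      = ((R * lam / k m + 1) * k m) * ((real (N m) * k m) * C * k m powr q)"
    by (simp add: mult_ac)
  also have "(R * lam / k m + 1) * k m = R * lam + k m"
    using k by (simp add: field_simps)
  finally show ?thesis by (simp add: Nk)
qed

section \<open>Convergence of the time-integrated fluxes\<close>

lemma f_w_bounded: obtains B where "0 \<le> B" "\<And>s x. norm (f (w s x)) \<le> B"
proof -
  have "compact (f ` cball 0 M)"
    by (intro compact_continuous_image continuous_on_subset[OF f_cont]) auto
  then obtain B where "\<forall>z\<in>f ` cball 0 M. norm z \<le> B"
    using compact_imp_bounded bounded_iff by metis
  then have B: "norm (f (w s x)) \<le> B" for s x
    using w_bounded[of s x] by auto
  show ?thesis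
    by (rule that[OF _ B]) (rule order.trans[OF norm_ge_zero B])
qed

lemma f_w_meas: "(\<lambda>(t, x). f (w t x)) \<in> borel_measurable (borel :: (real \<times> real) measure)"
  using measurable_compose[OF w_meas borel_measurable_continuous_onI[OF f_cont]]
  by (simp add: case_prod_unfold)

lemma f_w_meas_pair [measurable]: "(\<lambda>p. f (w (fst p) (snd p))) \<in> borel_measurable (borel \<Otimes>\<^sub>M borel)"
  using f_w_meas by (simp add: case_prod_unfold borel_prod)

text \<open>As \<open>w\<close> is bounded at every point, this holds for every x, so time integrals
  can be split into steps without exceptional points.\<close>

lemma f_w_integrable: "set_integrable lborel {a..b} (\<lambda>s. f (w s x))"
proof -
  obtain B where B: "0 \<le> B" "\<And>s x. norm (f (w s x)) \<le> B" using f_w_bounded by blast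
  have "(\<lambda>s. f (w s x)) \<in> borel_measurable borel"
    using measurable_compose[OF measurable_Pair1'[of x borel borel] f_w_meas_pair]
      measurable_compose[OF measurable_Pair2'[of x borel borel] f_w_meas_pair] by simp
  then have "(\<lambda>s. f (w s x)) \<in> L1loc"
    by (rule L1loc_bounded[where B=B]) (simp add: B)
  then show ?thesis by (rule L1loc_integrable)
qed

lemma w_flux_meas [measurable]: "(\<lambda>x. LINT s:{a..b}|lborel. f (w (c + s) x)) \<in> borel_measurable borel"
proof -
  have "(\<lambda>p. indicator {a..b} (snd p) *\<^sub>R f (w (c + snd p) (fst p))) \<in> borel_measurable (borel \<Otimes>\<^sub>M borel)"
    using measurable_compose[of "\<lambda>p. (c + snd p, fst p)" "borel \<Otimes>\<^sub>M borel" "borel \<Otimes>\<^sub>M borel", OF _ f_w_meas_pair]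
    by simp
  then have "(\<lambda>(x, s). indicator {a..b} s *\<^sub>R f (w (c + s) x)) \<in> borel_measurable (borel \<Otimes>\<^sub>M lborel)"
    by (simp add: case_prod_unfold cong: measurable_cong_sets sets_pair_measure_cong)
  then show ?thesis
    unfolding set_lebesgue_integral_def
    by (rule lborel.borel_measurable_lebesgue_integral)
qed

text \<open>The flux is represented through some jointly measurable version z of the short-time
  solution. In each time slice z and w may be replaced by \<sigma> and v up to null sets, and
  Tonelli integrates the slice bound e over a time of length \<open>k m\<close>.\<close>

lemma flux_step_approximation:
  assumes n: "n < N m" and e: "0 \<le> e"
    and approx: "\<And>\<tau>. \<tau> \<in> {0..k m} \<Longrightarrow> (\<lambda>x. f (\<sigma> m n \<tau> x)) \<in> L1loc \<and>
        L1_seminorm R (\<lambda>x. f (\<sigma> m n \<tau> x) - f (v (real n * k m + \<tau>) x)) \<le> e"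
  shows "(\<integral>\<^sup>+x\<in>{-R..R}. ennreal (norm ((LINT s:{0..k m}|lborel. f (w (real n * k m + s) x)) - flux m n x)) \<partial>lborel)
    \<le> ennreal (k m * e)"
proof -
  have k0: "0 \<le> k m" using k_pos[of m] by simp
  obtain z where z: "(\<lambda>(t, x). z t x) \<in> borel_measurable (borel :: (real \<times> real) measure)"
    "\<And>t. t \<in> {0..k m} \<Longrightarrow> AE x in lborel. z t x = \<sigma> m n t x"
    "AE x in lborel. set_integrable lborel {0..k m} (\<lambda>t. f (z t x)) \<and> flux m n x = (LINT t:{0..k m}|lborel. f (z t x))"
    using is_flux_integral_flux[OF n] unfolding is_flux_integral_def by blast
  have "(\<integral>\<^sup>+x\<in>{-R..R}. ennreal (norm ((LINT s:{0..k m}|lborel. f (w (real n * k m + s) x)) - flux m n x)) \<partial>lborel)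
      = (\<integral>\<^sup>+x\<in>{-R..R}. ennreal (norm ((LINT s:{0..k m}|lborel. f (w (real n * k m + s) x)) - (LINT s:{0..k m}|lborel. f (z s x)))) \<partial>lborel)"
    using z(3) by (intro nn_integral_cong_AE) (auto elim: eventually_mono)
  also have "\<dots> \<le> ennreal (k m * e)"
  proof (rule nn_integral_set_integral_diff_le)
    have "(\<lambda>p. f (w (real n * k m + fst p) (snd p))) \<in> borel_measurable (borel \<Otimes>\<^sub>M borel)"
      using measurable_compose[of "\<lambda>p. (real n * k m + fst p, snd p)" "borel \<Otimes>\<^sub>M borel" "borel \<Otimes>\<^sub>M borel", OF _ f_w_meas_pair]
      by simp
    then show "(\<lambda>(t, x). f (w (real n * k m + t) x)) \<in> borel_measurable (borel :: (real \<times> real) measure)"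
      by (simp add: case_prod_unfold borel_prod)
    show "(\<lambda>(t, x). f (z t x)) \<in> borel_measurable (borel :: (real \<times> real) measure)"
      using measurable_compose[OF z(1) borel_measurable_continuous_onI[OF f_cont]]
      by (simp add: case_prod_unfold)
    have "set_integrable lborel {0..k m} (\<lambda>t. f (w (real n * k m + t) x))" for x
    proof -
      have "integrable lborel (\<lambda>t. indicator {real n * k m..real n * k m + k m} (real n * k m + 1 * t) *\<^sub>R f (w (real n * k m + 1 * t) x))"
        by (rule lborel_integrable_real_affine)
          (use f_w_integrable[of "real n * k m" "real n * k m + k m" x] in \<open>simp_all add: set_integrable_def\<close>)
      moreover have "indicator {real n * k m..real n * k m + k m} (real n * k m + 1 * t) = (indicator {0..k m} t :: real)" for t
        by (simp add: indicator_def)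
      ultimately show ?thesis by (simp add: set_integrable_def)
    qed
    with z(3) show "AE x in lborel. set_integrable lborel {0..k m} (\<lambda>t. f (w (real n * k m + t) x)) \<and>
        set_integrable lborel {0..k m} (\<lambda>t. f (z t x))"
      by (auto elim: eventually_mono)
  next
    fix t assume t: "t \<in> {0..k m}"
    then have mem: "real n * k m + t \<in> {0..T}"
      by (intro step_time_mem n) auto
    have L: "(\<lambda>x. f (v (real n * k m + t) x)) \<in> L1loc"
      by (rule L1loc_comp_bounded[OF f_cont v_L1loc[OF mem] v_bounded[OF mem]])
    have "(\<integral>\<^sup>+x\<in>{-R..R}. ennreal (norm (f (w (real n * k m + t) x) - f (z t x))) \<partial>lborel)
        = (\<integral>\<^sup>+x\<in>{-R..R}. ennreal (norm (f (\<sigma> m n t x) - f (v (real n * k m + t) x))) \<partial>lborel)"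
    proof (rule nn_integral_cong_AE, use z(2)[OF t] w_version[OF mem] in eventually_elim)
      case (elim x)
      then show ?case by (simp add: norm_minus_commute)
    qed
    also have "\<dots> = ennreal (L1_seminorm R (\<lambda>x. f (\<sigma> m n t x) - f (v (real n * k m + t) x)))"
      using approx[OF t] by (intro nn_integral_eq_L1_seminorm L1loc_diff L) auto
    also have "\<dots> \<le> ennreal e"
      using approx[OF t] by (intro ennreal_leI) auto
    finally show "(\<integral>\<^sup>+x\<in>{-R..R}. ennreal (norm (f (w (real n * k m + t) x) - f (z t x))) \<partial>lborel) \<le> ennreal e" .
  qed (use k0 e in auto)
  finally show ?thesis .
qed

text \<open>Each of the n steps contributes \<open>k m * e\<close>; since e is the same for all
  steps, the total is at most T e.\<close>

lemma flux_sum_approximation: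
  assumes n: "n \<le> N m" and e: "0 \<le> e"
    and approx: "\<And>i \<tau>. i < n \<Longrightarrow> \<tau> \<in> {0..k m} \<Longrightarrow> (\<lambda>x. f (\<sigma> m i \<tau> x)) \<in> L1loc \<and>
        L1_seminorm R (\<lambda>x. f (\<sigma> m i \<tau> x) - f (v (real i * k m + \<tau>) x)) \<le> e"
  shows "(\<integral>\<^sup>+x\<in>{-R..R}. ennreal (norm ((LINT s:{0..real n * k m}|lborel. f (w s x)) - (\<Sum>i<n. flux m i x))) \<partial>lborel)
    \<le> ennreal (T * e)"
proof -
  have k0: "0 \<le> k m" using k_pos[of m] by simp
  have [measurable]: "flux m i \<in> borel_measurable borel" if "i < n" for i
    using flux_continuous[of i m] that n by (intro borel_measurable_continuous_onI) auto
  let ?d = "\<lambda>i x. (LINT s:{0..k m}|lborel. f (w (real i * k m + s) x)) - flux m i x"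
  have "(\<integral>\<^sup>+x\<in>{-R..R}. ennreal (norm ((LINT s:{0..real n * k m}|lborel. f (w s x)) - (\<Sum>i<n. flux m i x))) \<partial>lborel)
      \<le> (\<integral>\<^sup>+x. (\<Sum>i<n. ennreal (norm (?d i x)) * indicator {-R..R} x) \<partial>lborel)"
  proof (rule nn_integral_mono)
    fix x
    have "(LINT s:{0..real n * k m}|lborel. f (w s x)) - (\<Sum>i<n. flux m i x) = (\<Sum>i<n. ?d i x)"
      by (simp add: set_integral_sum_steps[OF k0 f_w_integrable] sum_subtractf)
    then have "ennreal (norm ((LINT s:{0..real n * k m}|lborel. f (w s x)) - (\<Sum>i<n. flux m i x)))
        \<le> (\<Sum>i<n. ennreal (norm (?d i x)))"
      by (simp add: sum_ennreal ennreal_leI norm_sum)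
    then show "ennreal (norm ((LINT s:{0..real n * k m}|lborel. f (w s x)) - (\<Sum>i<n. flux m i x))) * indicator {-R..R} x
        \<le> (\<Sum>i<n. ennreal (norm (?d i x)) * indicator {-R..R} x)"
      unfolding sum_distrib_right[symmetric] by (rule mult_right_mono) simp
  qed
  also have "\<dots> = (\<Sum>i<n. \<integral>\<^sup>+x\<in>{-R..R}. ennreal (norm (?d i x)) \<partial>lborel)"
    by (rule nn_integral_sum) (auto intro!: borel_measurable_times_ennreal)
  also have "\<dots> \<le> (\<Sum>i<n. ennreal (k m * e))"
    using n e approx by (intro sum_mono flux_step_approximation) auto
  also have "\<dots> = ennreal (real n * k m * e)"
    using k0 e by (simp add: ennreal_of_nat_eq_real_of_nat ennreal_mult[symmetric] mult.assoc)
  also have "\<dots> \<le> ennreal (T * e)"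
    using grid_time_mem[OF n] e by (intro ennreal_leI mult_right_mono) auto
  finally show ?thesis .
qed

text \<open>For a solution, the balance law between 0 and x makes this the time-integrated flux
  through 0, whatever x is. Constancy almost everywhere is the form of the balance law that
  tolerates exceptional null sets.\<close>

definition potential :: "real \<Rightarrow> 'd fld" where
  "potential t x = (LINT s:{0..t}|lborel. f (w s x)) + (primitive (v t) x - primitive (v 0) x)"

lemma zero_mem: "0 \<in> {0..T}"
  using T_pos by simp

lemma potential_L1loc:
  assumes t: "t \<in> {0..T}"
  shows "potential t \<in> L1loc"
proof -
  obtain B where B: "0 \<le> B" "\<And>s x. norm (f (w s x)) \<le> B" using f_w_bounded by blast
  have "(\<lambda>x. LINT s:{0..t}|lborel. f (w s x)) \<in> L1loc"
  proof (rule L1loc_bounded)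
    show "(\<lambda>x. LINT s:{0..t}|lborel. f (w s x)) \<in> borel_measurable borel"
      using w_flux_meas[of 0 t 0] by simp
    show "AE x in lborel. norm (LINT s:{0..t}|lborel. f (w s x)) \<le> B * (t - 0)"
      using t by (intro AE_I2 set_integral_bounded_le f_w_integrable) (auto simp: B)
  qed
  moreover have "(\<lambda>x. primitive (v t) x - primitive (v 0) x) \<in> L1loc"
    using primitive_continuous[OF v_L1loc] t zero_mem
    by (intro L1loc_diff L1loc_continuous) auto
  ultimately show ?thesis
    unfolding potential_def by (rule L1loc_add)
qed

definition steps_before :: "nat \<Rightarrow> real \<Rightarrow> nat" where
  "steps_before m t = nat \<lfloor>t / k m\<rfloor>"

lemma steps_before:
  assumes t: "t \<in> {0..T}"
  shows "real (steps_before m t) * k m \<le> t" "t \<le> real (steps_before m t) * k m + k m" "steps_before m t \<le> N m"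
proof -
  have k: "0 < k m" by (rule k_pos)
  have *: "real (steps_before m t) = of_int \<lfloor>t / k m\<rfloor>"
    using t k by (simp add: steps_before_def)
  have 1: "real (steps_before m t) \<le> t / k m" "t / k m \<le> real (steps_before m t) + 1"
    unfolding * by linarith+
  from 1 k show le: "real (steps_before m t) * k m \<le> t" "t \<le> real (steps_before m t) * k m + k m"
    by (simp_all add: pos_le_divide_eq pos_divide_le_eq algebra_simps)
  from le(1) t have "real (steps_before m t) * k m \<le> real (N m) * k m"
    by (simp add: Nk)
  with k show "steps_before m t \<le> N m" by simp
qed

lemma \<theta>_steps_before_tendsto:
  assumes t: "t \<in> {0..T}"
  shows "(\<lambda>m. L1_seminorm R (\<lambda>x. \<theta> m (steps_before m t) x - v t x)) \<longlonglongrightarrow> 0"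
proof -
  have "(\<lambda>m. t - k m) \<longlonglongrightarrow> t"
    using tendsto_diff[OF tendsto_const k_lim, of t] by simp
  from tendsto_sandwich[OF always_eventually always_eventually this tendsto_const]
  have lim: "(\<lambda>m. real (steps_before m t) * k m) \<longlonglongrightarrow> t"
    using steps_before[OF t] by (simp add: algebra_simps)
  have mem: "real (steps_before m t) * k m \<in> {0..T}" for m
    by (intro grid_time_mem steps_before t)
  have d1: "(\<lambda>m. L1loc_dist (\<theta> m (steps_before m t)) (v (real (steps_before m t) * k m))) \<longlonglongrightarrow> 0"
    by (rule \<theta>_dist_tendsto) (auto intro: steps_before t strict_monoI)
  have d2: "(\<lambda>m. L1loc_dist (v (real (steps_before m t) * k m)) (v t)) \<longlonglongrightarrow> 0"
    by (rule C_L1loc_tendsto_sequentially[OF v_cont t mem lim])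
  have "(\<lambda>m. L1loc_dist (\<theta> m (steps_before m t)) (v t)) \<longlonglongrightarrow> 0"
  proof (rule tendsto_sandwich[OF always_eventually always_eventually tendsto_const])
    show "(\<lambda>m. L1loc_dist (\<theta> m (steps_before m t)) (v (real (steps_before m t) * k m))
        + L1loc_dist (v (real (steps_before m t) * k m)) (v t)) \<longlonglongrightarrow> 0"
      using tendsto_add[OF d1 d2] by simp
    show "\<forall>m. L1loc_dist (\<theta> m (steps_before m t)) (v t)
        \<le> L1loc_dist (\<theta> m (steps_before m t)) (v (real (steps_before m t) * k m))
          + L1loc_dist (v (real (steps_before m t) * k m)) (v t)"
      using \<theta>_L1loc[OF steps_before(3)[OF t]] v_L1loc[OF mem] v_L1loc[OF t]
      by (auto intro!: L1loc_dist_triangle)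
  qed (simp add: L1loc_dist_nonneg)
  then show ?thesis
    using \<theta>_L1loc[OF steps_before(3)[OF t]] v_L1loc[OF t]
    by (intro L1loc_dist_tendsto_seminorm) auto
qed

lemma steps_before_0: "steps_before m 0 = 0"
  by (simp add: steps_before_def)

text \<open>Origin of the constant: T e from replacing the time-integrated flux of the limit by the
  sum of exact fluxes; (T / lam) e from moving n fluxes to a half point, each at cost h e; 12 R e
  from six pointwise errors of size e on a window of length 2 R. The data are compared on the window
  R + 1 since moving by h <= 1 may leave the window R.\<close>

lemma potential_estimate:
  assumes t: "t \<in> {0..T}" and R: "0 \<le> R" and e: "0 \<le> e"
    and B: "0 \<le> B" "\<And>s x. norm (f (w s x)) \<le> B"
    and n_def: "n = steps_before m t"
    and flux_approx: "\<And>i \<tau>. i < N m \<Longrightarrow> \<tau> \<in> {0..k m} \<Longrightarrow> (\<lambda>x. f (\<sigma> m i \<tau> x)) \<in> L1loc \<and>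
        L1_seminorm R (\<lambda>x. f (\<sigma> m i \<tau> x) - f (v (real i * k m + \<tau>) x)) \<le> e"
    and data_approx: "\<And>i. i < N m \<Longrightarrow> L1_seminorm (R + 1) (\<lambda>x. \<sigma> m i (k m) x - \<theta> m i x) \<le> e"
    and \<theta>_approx: "L1_seminorm R (\<lambda>x. \<theta> m n x - v t x) \<le> e" "L1_seminorm R (\<lambda>x. \<theta> m 0 x - v 0 x) \<le> e"
    and small: "k m * B \<le> e" "k m / lam \<le> 1" "M * (k m / lam) \<le> e" "(R * lam + k m) * (T * C * k m powr q) \<le> e"
  shows "\<exists>c. L1_seminorm R (\<lambda>x. potential t x - c) \<le> (T + T / lam + 12 * R) * e"
proof -
  define h where "h = k m / lam"
  have h: "0 < h" using k_pos lam_pos by (simp add: h_def)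
  have n: "n \<le> N m" using steps_before[OF t] by (simp add: n_def)
  \<comment> \<open>The constant is the residual at one reference half point; the cell balances make
    all half points near the window equivalent up to e.\<close>
  define c where "c = cell_balance m n (half_pt lam (k m) 0)"
  define A where "A = (\<lambda>x. (LINT s:{0..real n * k m}|lborel. f (w s x)) - (\<Sum>i<n. flux m i x))"
  define g where "g = (\<lambda>i y. ennreal (norm (\<sigma> m i (k m) y - \<theta> m i y)))"
  have L: "\<sigma> m i (k m) \<in> L1loc" "\<theta> m i \<in> L1loc" if "i < n" for i
    using that n k_pos[of m] by (auto intro!: \<sigma>_L1loc \<theta>_L1loc)
  have g_meas: "g i \<in> borel_measurable borel" if "i < n" for i
  proof -
    note [measurable] = L[OF that, THEN L1loc_borel_measurable]
    show ?thesis unfolding g_def by measurable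
  qed
  have \<theta>L: "\<theta> m n \<in> L1loc" "\<theta> m 0 \<in> L1loc" using n by (auto intro: \<theta>_L1loc)
  have vL: "v t \<in> L1loc" "v 0 \<in> L1loc" using t zero_mem by (auto intro: v_L1loc)
  have pointwise: "ennreal (norm (potential t x - c))
      \<le> ennreal (norm (A x)) + (\<Sum>i<n. \<integral>\<^sup>+y\<in>{x..x+h}. g i y \<partial>lborel) + ennreal (6 * e)"
    if x: "x \<in> {-R..R}" for x
  proof -
    \<comment> \<open>The shift by 1/2 selects the half point in (x, x + h], to the right of x, so
      that the segment between them lies in the interval of the shear estimate.\<close>
    define j where "j = \<lfloor>x / h + 1 / 2\<rfloor>"
    define p where "p = half_pt lam (k m) j"
    have j1: "real_of_int j \<le> x / h + 1 / 2" "x / h + 1 / 2 < real_of_int j + 1"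
      unfolding j_def by linarith+
    have p: "p = (real_of_int j + 1 / 2) * h" by (simp add: p_def half_pt_def h_def)
    have "x / h < real_of_int j + 1 / 2" "real_of_int j + 1 / 2 \<le> x / h + 1" using j1 by linarith+
    then have xp: "x \<le> p" "p \<le> x + h"
      unfolding p using h by (simp_all add: pos_divide_less_eq field_simps)
    have "\<bar>x / h\<bar> \<le> R / h" using x h by (simp add: abs_le_iff divide_right_mono field_simps)
    then have "\<bar>real_of_int j\<bar> \<le> R / h + 1" using j1 by linarith
    then have j: "\<bar>real_of_int j\<bar> \<le> R * lam / k m + 1" by (simp add: h_def)
    have x': "\<bar>x\<bar> \<le> R" using x by auto
    \<comment> \<open>One replacement per summand: the flux of the limit by exact fluxes, t by the
      last grid time, v by the iterates at both ends, x by the half point p in the fluxes and in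
      both primitives, and finally p by the reference half point.\<close>
    have eq: "potential t x - c =
        A x + ((LINT s:{0..t}|lborel. f (w s x)) - (LINT s:{0..real n * k m}|lborel. f (w s x)))
        + (primitive (v t) x - primitive (\<theta> m n) x) + (primitive (\<theta> m 0) x - primitive (v 0) x)
        + (\<Sum>i<n. flux m i x - flux m i p)
        + (primitive (\<theta> m n) x - primitive (\<theta> m n) p) + (primitive (\<theta> m 0) p - primitive (\<theta> m 0) x)
        + (cell_balance m n p - c)"
      by (simp add: potential_def A_def cell_balance_def sum_subtractf)
    have "norm (potential t x - c) \<le> norm (A x) + k m * B + e + e + (\<Sum>i<n. norm (flux m i p - flux m i x)) + e + e + e"
      unfolding eq
    proof (intro norm_triangle_mono order_refl)
      have "(LINT s:{0..t}|lborel. f (w s x)) - (LINT s:{0..real n * k m}|lborel. f (w s x))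
          = (LINT s:{real n * k m..t}|lborel. f (w s x))"
        using set_integral_Icc_combine[OF _ _ f_w_integrable, of 0 "real n * k m" t x] steps_before[OF t, of m] k_pos[of m]
        by (simp add: n_def)
      also have "norm \<dots> \<le> B * (t - real n * k m)"
        using steps_before(1)[OF t, of m]
        by (intro set_integral_bounded_le f_w_integrable) (auto simp: n_def B)
      also have "\<dots> \<le> B * k m"
        using steps_before(2)[OF t, of m] B(1) by (intro mult_left_mono) (auto simp: n_def)
      finally show "norm ((LINT s:{0..t}|lborel. f (w s x)) - (LINT s:{0..real n * k m}|lborel. f (w s x))) \<le> k m * B"
        by (simp add: mult.commute)
      show "norm (primitive (v t) x - primitive (\<theta> m n) x) \<le> e"
        unfolding norm_minus_commute[of "primitive (v t) x"] primitive_subtract[OF \<theta>L(1) vL(1), symmetric]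
        using norm_primitive_le[OF L1loc_diff[OF \<theta>L(1) vL(1)] x'] \<theta>_approx(1) by (rule order.trans)
      show "norm (primitive (\<theta> m 0) x - primitive (v 0) x) \<le> e"
        unfolding primitive_subtract[OF \<theta>L(2) vL(2), symmetric]
        using norm_primitive_le[OF L1loc_diff[OF \<theta>L(2) vL(2)] x'] \<theta>_approx(2) by (rule order.trans)
      show "norm (\<Sum>i<n. flux m i x - flux m i p) \<le> (\<Sum>i<n. norm (flux m i p - flux m i x))"
        by (rule order.trans[OF norm_sum]) (simp add: norm_minus_commute)
      have "M * \<bar>p - x\<bar> \<le> M * h" using xp M_nonneg by (intro mult_left_mono) auto
      with small(3) have M: "M * \<bar>p - x\<bar> \<le> e" by (simp add: h_def)
      show "norm (primitive (\<theta> m n) x - primitive (\<theta> m n) p) \<le> e"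
        unfolding norm_minus_commute[of "primitive (\<theta> m n) x"]
        using primitive_lipschitz[OF \<theta>L(1) \<theta>_bounded[OF n]] M by (rule order.trans)
      show "norm (primitive (\<theta> m 0) p - primitive (\<theta> m 0) x) \<le> e"
        using primitive_lipschitz[OF \<theta>L(2) \<theta>_bounded] M by (rule order.trans) simp
      show "norm (cell_balance m n p - c) \<le> e"
        using cell_balance_le[OF n j R] small(4) unfolding p_def c_def by (rule order.trans)
    qed
    then have "norm (potential t x - c) \<le> norm (A x) + (\<Sum>i<n. norm (flux m i p - flux m i x)) + 6 * e"
      using small(1) by linarith
    then have "ennreal (norm (potential t x - c))
        \<le> ennreal (norm (A x) + (\<Sum>i<n. norm (flux m i p - flux m i x)) + 6 * e)"
      by (rule ennreal_leI)
    also have "\<dots> = ennreal (norm (A x)) + (\<Sum>i<n. ennreal (norm (flux m i p - flux m i x))) + ennreal (6 * e)"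
      using e by (simp add: ennreal_plus sum_ennreal sum_nonneg)
    also have "\<dots> \<le> ennreal (norm (A x)) + (\<Sum>i<n. \<integral>\<^sup>+y\<in>{x..x+h}. g i y \<partial>lborel) + ennreal (6 * e)"
    proof (intro add_mono order_refl sum_mono)
      fix i assume "i \<in> {..<n}"
      then have "i < N m" using n by simp
      from norm_flux_diff_le[OF this xp(1)]
      have "ennreal (norm (flux m i p - flux m i x)) \<le> (\<integral>\<^sup>+y\<in>{x..p}. g i y \<partial>lborel)" by (simp add: g_def)
      also have "\<dots> \<le> (\<integral>\<^sup>+y\<in>{x..x+h}. g i y \<partial>lborel)"
        using xp by (intro nn_integral_mono) (auto simp: indicator_def)
      finally show "ennreal (norm (flux m i p - flux m i x)) \<le> (\<integral>\<^sup>+y\<in>{x..x+h}. g i y \<partial>lborel)" .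
    qed
    finally show ?thesis .
  qed
  have A_meas [measurable]: "A \<in> borel_measurable borel"
  proof -
    have "(\<lambda>x. \<Sum>i<n. flux m i x) \<in> borel_measurable borel"
      using n by (intro borel_measurable_continuous_onI continuous_on_sum flux_continuous) auto
    then show ?thesis
      unfolding A_def using w_flux_meas[of 0 "real n * k m" 0] by simp
  qed
  have G_meas: "(\<lambda>x. \<integral>\<^sup>+y\<in>{x..x+h}. g i y \<partial>lborel) \<in> borel_measurable borel" if i: "i < n" for i
  proof -
    note [measurable] = g_meas[OF i]
    have "(\<lambda>p. g i (snd p) * indicator {p. fst p \<le> snd p \<and> snd p \<le> fst p + h} p) \<in> borel_measurable (borel \<Otimes>\<^sub>M borel)"
      by measurable
    then have "(\<lambda>(x, y). g i y * indicator {p. fst p \<le> snd p \<and> snd p \<le> fst p + h} (x, y)) \<in> borel_measurable (borel \<Otimes>\<^sub>M lborel)"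
      by (simp add: case_prod_unfold cong: measurable_cong_sets sets_pair_measure_cong)
    then have "(\<lambda>x. \<integral>\<^sup>+y. g i y * indicator {p. fst p \<le> snd p \<and> snd p \<le> fst p + h} (x, y) \<partial>lborel) \<in> borel_measurable borel"
      by (rule lborel.borel_measurable_nn_integral)
    moreover have "indicator {p. fst p \<le> snd p \<and> snd p \<le> fst p + h} (x, y) = (indicator {x..x+h} y :: ennreal)" for x y
      by (simp add: indicator_def)
    ultimately show ?thesis by simp
  qed
  have "ennreal (L1_seminorm R (\<lambda>x. potential t x - c)) = (\<integral>\<^sup>+x\<in>{-R..R}. ennreal (norm (potential t x - c)) \<partial>lborel)"
    by (rule nn_integral_eq_L1_seminorm[symmetric])
      (intro L1loc_diff potential_L1loc t L1loc_continuous continuous_on_const)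
  also have "\<dots> \<le> (\<integral>\<^sup>+x. (ennreal (norm (A x)) * indicator {-R..R} x
      + (\<Sum>i<n. (\<integral>\<^sup>+y\<in>{x..x+h}. g i y \<partial>lborel) * indicator {-R..R} x)) + ennreal (6 * e) * indicator {-R..R} x \<partial>lborel)"
    using pointwise by (intro nn_integral_mono) (auto simp: indicator_def)
  also have "\<dots> = (\<integral>\<^sup>+x\<in>{-R..R}. ennreal (norm (A x)) \<partial>lborel)
      + (\<Sum>i<n. \<integral>\<^sup>+x\<in>{-R..R}. (\<integral>\<^sup>+y\<in>{x..x+h}. g i y \<partial>lborel) \<partial>lborel) + (\<integral>\<^sup>+x. ennreal (6 * e) * indicator {-R..R} x \<partial>lborel)"
  proof -
    have G: "(\<lambda>x. (\<integral>\<^sup>+y\<in>{x..x+h}. g i y \<partial>lborel) * indicator {-R..R} x) \<in> borel_measurable lborel" if "i < n" for i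
      using G_meas[OF that] by simp
    have [measurable]: "(\<lambda>x. \<Sum>i<n. (\<integral>\<^sup>+y\<in>{x..x+h}. g i y \<partial>lborel) * indicator {-R..R} x) \<in> borel_measurable lborel"
      using G by (intro borel_measurable_sum) auto
    have "(\<integral>\<^sup>+x. (\<Sum>i<n. (\<integral>\<^sup>+y\<in>{x..x+h}. g i y \<partial>lborel) * indicator {-R..R} x) \<partial>lborel)
        = (\<Sum>i<n. \<integral>\<^sup>+x\<in>{-R..R}. (\<integral>\<^sup>+y\<in>{x..x+h}. g i y \<partial>lborel) \<partial>lborel)"
      using G by (intro nn_integral_sum) auto
    moreover have "(\<integral>\<^sup>+x. (ennreal (norm (A x)) * indicator {-R..R} x
          + (\<Sum>i<n. (\<integral>\<^sup>+y\<in>{x..x+h}. g i y \<partial>lborel) * indicator {-R..R} x)) + ennreal (6 * e) * indicator {-R..R} x \<partial>lborel)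
        = (\<integral>\<^sup>+x. ennreal (norm (A x)) * indicator {-R..R} x
          + (\<Sum>i<n. (\<integral>\<^sup>+y\<in>{x..x+h}. g i y \<partial>lborel) * indicator {-R..R} x) \<partial>lborel) + (\<integral>\<^sup>+x. ennreal (6 * e) * indicator {-R..R} x \<partial>lborel)"
      by (rule nn_integral_add) measurable
    moreover have "(\<integral>\<^sup>+x. ennreal (norm (A x)) * indicator {-R..R} x
          + (\<Sum>i<n. (\<integral>\<^sup>+y\<in>{x..x+h}. g i y \<partial>lborel) * indicator {-R..R} x) \<partial>lborel)
        = (\<integral>\<^sup>+x\<in>{-R..R}. ennreal (norm (A x)) \<partial>lborel)
          + (\<integral>\<^sup>+x. (\<Sum>i<n. (\<integral>\<^sup>+y\<in>{x..x+h}. g i y \<partial>lborel) * indicator {-R..R} x) \<partial>lborel)"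
      by (rule nn_integral_add) measurable
    ultimately show ?thesis by (simp only:)
  qed
  also have "\<dots> \<le> ennreal (T * e) + (\<Sum>i<n. ennreal (h * e)) + ennreal (6 * e * (2 * R))"
  proof (intro add_mono sum_mono)
    show "(\<integral>\<^sup>+x\<in>{-R..R}. ennreal (norm (A x)) \<partial>lborel) \<le> ennreal (T * e)"
      unfolding A_def using n flux_approx by (intro flux_sum_approximation n e) auto
    have "emeasure lborel {-R..R} = ennreal (2 * R)"
      using R emeasure_lborel_Icc[of "-R" R] by simp
    then show "(\<integral>\<^sup>+x. ennreal (6 * e) * indicator {-R..R} x \<partial>lborel) \<le> ennreal (6 * e * (2 * R))"
      using R e by (subst nn_integral_cmult_indicator) (simp_all only: ennreal_mult[symmetric], simp_all)
    fix i assume "i \<in> {..<n}"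
    then have i: "i < n" by simp
    have "(\<integral>\<^sup>+x\<in>{-R..R}. (\<integral>\<^sup>+y\<in>{x..x+h}. g i y \<partial>lborel) \<partial>lborel) \<le> ennreal h * (\<integral>\<^sup>+y\<in>{-R..R+h}. g i y \<partial>lborel)"
      using h by (intro nn_integral_shear_le g_meas i) simp
    also have "(\<integral>\<^sup>+y\<in>{-R..R+h}. g i y \<partial>lborel) \<le> (\<integral>\<^sup>+y\<in>{-(R+1)..R+1}. g i y \<partial>lborel)"
      using small(2) by (intro nn_integral_mono) (auto simp: indicator_def h_def)
    also have "\<dots> = ennreal (L1_seminorm (R + 1) (\<lambda>x. \<sigma> m i (k m) x - \<theta> m i x))"
      unfolding g_def by (rule nn_integral_eq_L1_seminorm[OF L1loc_diff[OF L[OF i]]])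
    also have "\<dots> \<le> ennreal e"
      using data_approx[of i] i n by (intro ennreal_leI) auto
    finally show "(\<integral>\<^sup>+x\<in>{-R..R}. (\<integral>\<^sup>+y\<in>{x..x+h}. g i y \<partial>lborel) \<partial>lborel) \<le> ennreal (h * e)"
      using h e by (simp add: ennreal_mult mult_left_mono)
  qed
  also have "\<dots> = ennreal (T * e + real n * h * e + 12 * R * e)"
    using h e R T_pos by (simp add: ennreal_of_nat_eq_real_of_nat ennreal_mult[symmetric] ennreal_plus[symmetric] mult_ac del: ennreal_plus)
  finally have "L1_seminorm R (\<lambda>x. potential t x - c) \<le> T * e + real n * h * e + 12 * R * e"
    using h e R T_pos by (subst (asm) ennreal_le_iff) auto
  also have "real n * h \<le> T / lam"
    using grid_time_mem[OF n] lam_pos by (simp add: h_def divide_right_mono)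
  then have "T * e + real n * h * e + 12 * R * e \<le> T * e + T / lam * e + 12 * R * e"
    using e by (intro add_mono mult_right_mono order_refl)
  finally show ?thesis by (intro exI[of _ c]) (simp add: algebra_simps)
qed

lemma potential_AE_constant:
  assumes t: "t \<in> {0..T}"
  shows "\<exists>c. AE x in lborel. potential t x = c"
proof (rule AE_constant[OF potential_L1loc[OF t]])
  fix R :: nat and \<epsilon> :: real
  assume R: "0 < R" and \<epsilon>: "0 < \<epsilon>"
  define D where "D = T + T / lam + 12 * real R"
  have D: "0 < D" unfolding D_def using T_pos lam_pos by (intro add_pos_nonneg) auto
  \<comment> \<open>The factor D does not depend on m, so the accuracy can be fixed before m is
    taken large.\<close>
  define e where "e = \<epsilon> / D"
  have e: "0 < e" using \<epsilon> D by (simp add: e_def)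
  obtain B where B: "0 \<le> B" "\<And>s x. norm (f (w s x)) \<le> B" using f_w_bounded by blast
  have ev1: "\<forall>\<^sub>F m in sequentially. L1_seminorm R (\<lambda>x. \<theta> m (steps_before m t) x - v t x) < e"
    by (rule order_tendstoD(2)[OF \<theta>_steps_before_tendsto[OF t] e])
  have ev2: "\<forall>\<^sub>F m in sequentially. L1_seminorm R (\<lambda>x. \<theta> m 0 x - v 0 x) < e"
    using order_tendstoD(2)[OF \<theta>_steps_before_tendsto[OF zero_mem] e] by (simp add: steps_before_0)
  have "(\<lambda>m. k m * B) \<longlonglongrightarrow> 0" by (rule tendsto_mult_left_zero[OF k_lim])
  from order_tendstoD(2)[OF this e] have ev3: "\<forall>\<^sub>F m in sequentially. k m * B < e" .
  have kl: "(\<lambda>m. k m / lam) \<longlonglongrightarrow> 0" by (rule tendsto_divide_zero[OF k_lim])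
  from order_tendstoD(2)[OF this, of 1] have ev4: "\<forall>\<^sub>F m in sequentially. k m / lam < 1" by simp
  have "(\<lambda>m. M * (k m / lam)) \<longlonglongrightarrow> 0" by (rule tendsto_mult_right_zero[OF kl])
  from order_tendstoD(2)[OF this e] have ev5: "\<forall>\<^sub>F m in sequentially. M * (k m / lam) < e" .
  \<comment> \<open>Positivity of q makes the accumulated consistency error vanish.\<close>
  have "(\<lambda>m. k m powr q) \<longlonglongrightarrow> 0"
    by (rule tendsto_zero_powrI[OF k_lim tendsto_const _ q_pos]) (simp add: k_pos less_imp_le)
  then have "(\<lambda>m. (real R * lam + k m) * (T * C * k m powr q)) \<longlonglongrightarrow> (real R * lam + 0) * (T * C * 0)"
    by (intro tendsto_intros k_lim)
  then have "(\<lambda>m. (real R * lam + k m) * (T * C * k m powr q)) \<longlonglongrightarrow> 0" by simp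
  from order_tendstoD(2)[OF this e]
  have ev6: "\<forall>\<^sub>F m in sequentially. (real R * lam + k m) * (T * C * k m powr q) < e" .
  have "\<forall>\<^sub>F m in sequentially. \<exists>c. L1_seminorm R (\<lambda>x. potential t x - c) \<le> \<epsilon>"
    using flux_approximation[OF e, of R] data_approximation[OF e, of "real R + 1"] ev1 ev2 ev3 ev4 ev5 ev6
  proof eventually_elim
    case (elim m)
    have "\<exists>c. L1_seminorm R (\<lambda>x. potential t x - c) \<le> (T + T / lam + 12 * real R) * e"
      by (rule potential_estimate[OF t _ _ B refl]) (use elim e k_pos[of m] in \<open>auto simp: less_imp_le\<close>)
    then show ?case using D by (simp add: e_def flip: D_def)
  qed
  then show "\<exists>c. L1_seminorm (real R) (\<lambda>x. potential t x - c) \<le> \<epsilon>"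
    using eventually_happens'[OF sequentially_bot] by blast
qed

text \<open>Subtracting the constants of the potential at t1 and t2 expresses the flux integral over
  [t1, t2], for almost every x, as a constant minus an increment of primitives. This expression is
  continuous, so it is the representative, and the balance law becomes an identity at every pair x1,
  x2.\<close>

lemma limit_balance_law: "balance_law f T v"
proof -
  obtain c where c: "\<And>t. t \<in> {0..T} \<Longrightarrow> AE x in lborel. potential t x = c t"
    using potential_AE_constant by metis
  have fi: "is_flux_integral f v t1 t2 (\<lambda>x. (c t2 - c t1) - (primitive (v t2) x - primitive (v t1) x))"
    if t12: "0 \<le> t1" "t1 \<le> t2" "t2 \<le> T" for t1 t2
  proof -
    from t12 have t1: "t1 \<in> {0..T}" and t2: "t2 \<in> {0..T}" by auto
    show ?thesis
      unfolding is_flux_integral_def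
    proof (intro conjI exI)
      show "continuous_on UNIV (\<lambda>x. (c t2 - c t1) - (primitive (v t2) x - primitive (v t1) x))"
        using t1 t2 by (intro continuous_intros primitive_continuous[OF v_L1loc])
      show "(\<lambda>(t, x). w t x) \<in> borel_measurable (borel :: (real \<times> real) measure)"
        by (rule w_meas)
      show "\<forall>t\<in>{t1..t2}. AE x in lborel. w t x = v t x"
        using w_version t12 by auto
      show "AE x in lborel. set_integrable lborel {t1..t2} (\<lambda>t. f (w t x)) \<and>
          (c t2 - c t1) - (primitive (v t2) x - primitive (v t1) x) = (LINT t:{t1..t2}|lborel. f (w t x))"
        using c[OF t1] c[OF t2]
      proof eventually_elim
        case (elim x)
        have "(LINT t:{0..t2}|lborel. f (w t x)) = (LINT t:{0..t1}|lborel. f (w t x)) + (LINT t:{t1..t2}|lborel. f (w t x))"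
          by (rule set_integral_Icc_combine[OF t12(1,2) f_w_integrable])
        then show ?case
          unfolding elim[symmetric] by (simp add: f_w_integrable potential_def)
      qed
    qed
  qed
  show ?thesis
    unfolding balance_law_def
  proof (intro conjI allI impI ballI)
    fix t1 t2 assume "0 \<le> t1 \<and> t1 \<le> t2 \<and> t2 \<le> T"
    then show "\<exists>g. is_flux_integral f v t1 t2 g" using fi by blast
  next
    fix t assume "t \<in> {0..T}"
    then show "v t \<in> L1loc" by (rule v_L1loc)
  next
    fix x1 x2 :: real
    define R where "R = max \<bar>x1\<bar> \<bar>x2\<bar>"
    show "continuous_on {0..T} (\<lambda>t. LINT x:{x1..x2}|lborel. v t x)"
      unfolding continuous_on_def
    proof
      fix t assume t: "t \<in> {0..T}"
      have "((\<lambda>s. L1_seminorm R (\<lambda>x. v s x - v t x)) \<longlongrightarrow> 0) (at t within {0..T})"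
      proof (rule L1loc_dist_tendsto_seminorm)
        show "\<forall>\<^sub>F s in at t within {0..T}. v s \<in> L1loc"
          using v_L1loc by (auto simp: eventually_at_filter)
        show "((\<lambda>s. L1loc_dist (v s) (v t)) \<longlongrightarrow> 0) (at t within {0..T})"
          using v_cont t by (simp add: C_L1loc_def)
      qed (simp add: v_L1loc[OF t])
      moreover have "\<forall>\<^sub>F s in at t within {0..T}. norm ((LINT x:{x1..x2}|lborel. v s x) - (LINT x:{x1..x2}|lborel. v t x))
          \<le> L1_seminorm R (\<lambda>x. v s x - v t x)"
        unfolding eventually_at_filter
      proof (intro always_eventually allI impI)
        fix s assume "s \<in> {0..T}"
        then show "norm ((LINT x:{x1..x2}|lborel. v s x) - (LINT x:{x1..x2}|lborel. v t x))
          \<le> L1_seminorm R (\<lambda>x. v s x - v t x)"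
          using set_integral_le_L1_seminorm[OF L1loc_diff[OF v_L1loc v_L1loc[OF t]], of s R x1 x2]
            set_integral_diff(2)[OF L1loc_integrable[OF v_L1loc] L1loc_integrable[OF v_L1loc[OF t]], of s x1 x2]
          by (auto simp: R_def)
      qed
      ultimately have "((\<lambda>s. (LINT x:{x1..x2}|lborel. v s x) - (LINT x:{x1..x2}|lborel. v t x)) \<longlongrightarrow> 0) (at t within {0..T})"
        by (rule Lim_null_comparison[rotated])
      then show "((\<lambda>s. LINT x:{x1..x2}|lborel. v s x) \<longlongrightarrow> (LINT x:{x1..x2}|lborel. v t x)) (at t within {0..T})"
        by (rule Lim_null[THEN iffD2])
    qed
  next
    fix t1 t2 x1 x2 :: real assume *: "0 \<le> t1 \<and> t1 \<le> t2 \<and> t2 \<le> T \<and> x1 \<le> x2"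
    then have t: "t1 \<in> {0..T}" "t2 \<in> {0..T}" by auto
    show "(LINT x:{x1..x2}|lborel. v t2 x) - (LINT x:{x1..x2}|lborel. v t1 x)
          = - (flux_integral f v t1 t2 x2 - flux_integral f v t1 t2 x1)"
      using * by (simp add: flux_integral_eqI[OF fi] flip: primitive_diff[OF v_L1loc[OF t(1)]] primitive_diff[OF v_L1loc[OF t(2)]])
  qed
qed

lemma limit_Linf_bound: "Linf_bound T v M"
  unfolding Linf_bound_def using v_bounded by (intro AE_I2) blast

end

section \<open>From the hypotheses on the scheme to the convergent setting\<close>

lemma finite_admissible:
  assumes H: "\<And>k. 0 < k \<Longrightarrow> k < T / 2 \<Longrightarrow> H k \<subseteq> V k" and fin: "\<And>k. 0 < k \<Longrightarrow> k < T / 2 \<Longrightarrow> finite (H k)"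
  shows "admissible nb nc T V H"
  unfolding admissible_def
proof (intro allI impI conjI)
  fix k assume k: "0 < k \<and> k < T / 2"
  then have f: "finite (H k)" by (simp add: fin)
  show "H k \<subseteq> V k" using H k by simp
  show "\<exists>B. \<forall>\<xi>\<in>H k. nb \<xi> + nc \<xi> \<le> B"
    using f by (intro exI[of _ "Max ((\<lambda>\<xi>. nb \<xi> + nc \<xi>) ` H k)"]) auto
  fix X :: "nat \<Rightarrow> 'a fld"
  assume X: "\<forall>n. X n \<in> H k"
  then have "finite (X ` UNIV)"
    by (intro finite_subset[OF _ f]) auto
  \<comment> \<open>A sequence in a finite set takes some value infinitely often, so compactness is
    witnessed by a constant subsequence.\<close>
  from pigeonhole_infinite[OF infinite_UNIV_nat this]
  obtain n where n: "infinite {i. X i = X n}" by auto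
  have z: "L1loc_dist (X n) (X n) = 0"
    unfolding L1loc_dist_def by (simp add: set_lebesgue_integral_def)
  have "X (enumerate {i. X i = X n} i) = X n" for i
    using enumerate_in_set[OF n] by simp
  then show "\<exists>\<xi>\<in>H k. \<exists>r. strict_mono r \<and> (\<lambda>n. L1loc_dist (X (r n)) \<xi>) \<longlonglongrightarrow> 0"
    using X n z by (intro bexI[of _ "X n"] exI[of _ "enumerate {i. X i = X n}"]) (auto simp: strict_mono_enumerate)
qed

lemma fvs_iterate_mem:
  assumes "fv_projection U lam k V P" "finite_volume_scheme U lam k V P F \<Phi>" "u0 \<in> U"
  shows "fvs_iterate P \<Phi> u0 n \<in> V"
proof (induction n)
  case 0
  then show ?case using assms by (simp add: fv_projection_def)
next
  case (Suc n)
  then show ?case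
    using assms(1,2) unfolding fv_projection_def finite_volume_scheme_def approximate_evolution_def by auto
qed

text \<open>The projection keeps cell integrals, so the projected update satisfies the same discrete
  conservation law as the unprojected evolution.\<close>

lemma fvs_iterate_conservation:
  fixes n :: nat
  assumes "fv_projection U lam k V P" "finite_volume_scheme U lam k V P F \<Phi>" "u0 \<in> U"
  defines "\<xi> \<equiv> fvs_iterate P \<Phi> u0 n"
  shows "(LINT x:cell lam k j|lborel. fvs_iterate P \<Phi> u0 (Suc n) x) - (LINT x:cell lam k j|lborel. \<xi> x)
    = - (LINT t:{0..<k}|lborel. F \<xi> j t - F \<xi> (j - 1) t)"
proof -
  have \<xi>: "\<xi> \<in> V" unfolding \<xi>_def by (rule fvs_iterate_mem[OF assms(1-3)])
  obtain St where St: "approximate_evolution U lam k V F St" "\<And>\<xi>. \<xi> \<in> V \<Longrightarrow> \<Phi> \<xi> = P (St \<xi>)"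
    using assms(2) unfolding finite_volume_scheme_def by blast
  have "fvs_iterate P \<Phi> u0 (Suc n) = P (St \<xi>)"
    using St(2)[OF \<xi>] by (simp add: \<xi>_def)
  moreover have "St \<xi> \<in> U" "(LINT x:cell lam k j|lborel. St \<xi> x) - (LINT x:cell lam k j|lborel. \<xi> x)
      = - (LINT t:{0..<k}|lborel. F \<xi> j t - F \<xi> (j - 1) t)"
    using St(1) \<xi> unfolding approximate_evolution_def by blast+
  ultimately show ?thesis
    using assms(1) unfolding fv_projection_def by simp
qed

lemma banach_function_space_AE_cong:
  assumes "banach_function_space W nrm" "w \<in> W" "w' \<in> borel_measurable borel" "AE x in lborel. w' x = w x"
  shows "w' \<in> W"
proof -
  have "\<forall>w\<in>W. \<forall>w'\<in>borel_measurable borel. (AE x in lborel. w' x = w x) \<longrightarrow> w' \<in> W"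
    using assms(1) unfolding banach_function_space_def by (elim conjE)
  with assms(2-4) show ?thesis by blast
qed

theorem theorem4p1:
  fixes f :: "real ^ 'd \<Rightarrow> real ^ ('d::finite)"
    and Ub Uc :: "'d fld set" and nb nc :: "'d fld \<Rightarrow> real"
    and E :: "real \<Rightarrow> (real \<Rightarrow> 'd fld) \<Rightarrow> bool"
    and S :: "real \<Rightarrow> 'd fld \<Rightarrow> 'd fld"
    and T lam lam0 q :: real
    and V :: "real \<Rightarrow> 'd fld set"
    and P \<Phi> :: "real \<Rightarrow> 'd fld \<Rightarrow> 'd fld"
    and F :: "real \<Rightarrow> 'd fld \<Rightarrow> int \<Rightarrow> real \<Rightarrow> real ^ 'd"
    and k :: "nat \<Rightarrow> real" and N :: "nat \<Rightarrow> nat"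
    and u0 :: "'d fld" and \<Upsilon> :: "nat \<Rightarrow> real \<Rightarrow> 'd fld" and v :: "real \<Rightarrow> 'd fld"
  assumes "0 < T" and "continuous_on UNIV f"
    and "banach_function_space Ub nb" and "banach_function_space Uc nc"
    and "Ub \<inter> Uc \<subseteq> L1loc"
    and "persistence_space f Ub nb Uc nc T"
    and "0 < lam" and "lam < lam0"
    and "\<And>k. 0 < k \<Longrightarrow> k < T / 2 \<Longrightarrow> fv_space (Ub \<inter> Uc) lam k (V k)"
    and "\<And>k. 0 < k \<Longrightarrow> k < T / 2 \<Longrightarrow> fv_projection (Ub \<inter> Uc) lam k (V k) (P k)"
    and "\<And>k. 0 < k \<Longrightarrow> k < T / 2 \<Longrightarrow> short_time_solutions f Ub nb Uc nc E k (V k) S"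
    and "uniform_short_time_persistence T V S"
    and "\<And>k. 0 < k \<Longrightarrow> k < T / 2 \<Longrightarrow> approximate_fluxes f lam k (V k) (F k)"
    and "\<And>k. 0 < k \<Longrightarrow> k < T / 2 \<Longrightarrow>
           finite_volume_scheme (Ub \<inter> Uc) lam k (V k) (P k) (F k) (\<Phi> k)"
    and "0 < q" and "consistent_of_order q f nb nc T lam V S F"
    and "\<And>m. 0 < k m" and "decseq k" and "k \<longlonglongrightarrow> 0" and "\<And>m. real (N m) * k m = T"
    and "u0 \<in> Ub \<inter> Uc"
    and "\<And>m. \<Upsilon> m = time_interpolant (k m) (fvs_iterate (P (k m)) (\<Phi> (k m)) u0)"
    and bounded: "\<exists>M. \<forall>m. Linf_bound T (\<Upsilon> m) M"
    and limit: "C_L1loc T v"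
      "\<And>e. 0 < e \<Longrightarrow> \<forall>\<^sub>F m in sequentially. \<forall>t\<in>{0..T}. L1loc_dist (\<Upsilon> m t) (v t) < e"
  shows "solution f Ub nb Uc nc T v"
proof -
  note T = assms(1) and U_L1loc = assms(5) and lam = assms(7) and u0 = assms(21)
  \<comment> \<open>The hypotheses on the scheme speak of steps below T / 2; dropping finitely many
    indices changes no limit.\<close>
  obtain m0 where m0: "\<And>m. m0 \<le> m \<Longrightarrow> k m < T / 2"
    using order_tendstoD(2)[OF assms(19), of "T / 2"] T by (auto simp: eventually_sequentially)
  define \<kappa> \<nu> where "\<kappa> = (\<lambda>m. k (m + m0))" and "\<nu> = (\<lambda>m. N (m + m0))"
  define \<theta> where "\<theta> = (\<lambda>m. fvs_iterate (P (\<kappa> m)) (\<Phi> (\<kappa> m)) u0)"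
  define \<sigma> where "\<sigma> = (\<lambda>m n \<tau>. S \<tau> (\<theta> m n))"
  have \<kappa>: "0 < \<kappa> m" "\<kappa> m < T / 2" "real (\<nu> m) * \<kappa> m = T" for m
    using assms(17,20) m0 by (auto simp: \<kappa>_def \<nu>_def)
  have \<nu>: "0 < \<nu> m" for m
    using \<kappa>(3)[of m] T by (cases "\<nu> m") auto
  have \<kappa>_lim: "\<kappa> \<longlonglongrightarrow> 0"
    unfolding \<kappa>_def by (rule LIMSEQ_ignore_initial_segment[OF assms(19)])
  have V_sub: "V h \<subseteq> Ub \<inter> Uc" if "0 < h" "h < T / 2" for h
    using assms(9)[OF that] by (simp add: fv_space_def)
  have iterate_V: "fvs_iterate (P h) (\<Phi> h) u0 n \<in> V h" if "0 < h" "h < T / 2" for h n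
    by (rule fvs_iterate_mem[OF assms(10)[OF that] assms(14)[OF that] u0])
  have \<theta>_V: "\<theta> m n \<in> V (\<kappa> m)" for m n
    unfolding \<theta>_def by (rule iterate_V[OF \<kappa>(1,2)])
  have \<theta>_L1loc: "\<theta> m n \<in> L1loc" for m n
    using \<theta>_V V_sub[OF \<kappa>(1,2)] U_L1loc by blast
  define Y where "Y = (\<lambda>m. time_interpolant (\<kappa> m) (\<theta> m))"
  have Y: "\<Upsilon> (m + m0) = Y m" for m
    by (simp add: assms(22) Y_def \<kappa>_def \<theta>_def)
  obtain M0 where M0: "\<And>m. Linf_bound T (\<Upsilon> m) M0" using bounded by blast
  \<comment> \<open>With M nonnegative, 0 is a legitimate default value in the bounded version
    \<open>w\<close>.\<close>
  define M where "M = max M0 0"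
  have \<theta>_bounded: "AE x in lborel. norm (\<theta> m n x) \<le> M" if "n \<le> \<nu> m" for m n
  proof -
    have "Linf_bound T (time_interpolant (\<kappa> m) (\<theta> m)) M0"
      using M0[of "m + m0"] by (simp add: Y Y_def)
    from time_interpolant_nodes_bounded[OF \<kappa>(1) \<nu> \<kappa>(3) this that]
    show ?thesis by eventually_elim (simp add: M_def)
  qed
  have Y_bounded: "AE x in lborel. norm (Y m t x) \<le> M" if "t \<in> {0..T}" for m t
    unfolding Y_def by (rule time_interpolant_bounded[OF \<kappa>(1,3) that \<theta>_bounded])
  have Y_meas: "(\<lambda>(t, x). Y m t x) \<in> borel_measurable (borel :: (real \<times> real) measure)" for m
    unfolding Y_def by (rule time_interpolant_measurable[OF L1loc_borel_measurable[OF \<theta>_L1loc]])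
  have Y_L1loc: "Y m t \<in> L1loc" if "t \<in> {0..T}" for m t
  proof (rule L1loc_bounded[OF _ Y_bounded[OF that]])
    have "(\<lambda>x. Y m (fst (t, x)) (snd (t, x))) \<in> borel_measurable borel"
      using measurable_compose[OF measurable_Pair1'[of t borel borel], of "\<lambda>p. Y m (fst p) (snd p)" borel] Y_meas[of m]
      by (simp add: borel_prod case_prod_unfold)
    then show "Y m t \<in> borel_measurable borel" by simp
  qed
  have v_L1loc: "v t \<in> L1loc" if "t \<in> {0..T}" for t
    using limit(1) that by (simp add: C_L1loc_def)
  have Y_lim: "\<forall>\<^sub>F m in sequentially. \<forall>t\<in>{0..T}. L1loc_dist (Y m t) (v t) < e" if "0 < e" for e
    using sequentially_offset[OF limit(2)[OF that], of m0] by (simp add: Y)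
  obtain w where w: "(\<lambda>(t, x). w t x) \<in> borel_measurable (borel :: (real \<times> real) measure)"
    "\<And>t x. norm (w t x) \<le> M" "\<And>t. t \<in> {0..T} \<Longrightarrow> AE x in lborel. w t x = v t x"
    by (rule jointly_measurable_version[where A="{0..T}" and Y=Y and v=v and M=M])
      (use Y_meas Y_L1loc v_L1loc Y_bounded Y_lim in \<open>auto simp: M_def\<close>)
  (* Only the iterates enter, and for each step there are finitely many of them. *)
  define H where "H = (\<lambda>h. {fvs_iterate (P h) (\<Phi> h) u0 n | n. real n * h \<le> T})"
  have admissible: "admissible nb nc T V H"
  proof (rule finite_admissible)
    fix h :: real assume h: "0 < h" "h < T / 2"
    show "H h \<subseteq> V h" using iterate_V[OF h] by (auto simp: H_def)
    have "{n. real n * h \<le> T} \<subseteq> {..nat \<lfloor>T / h\<rfloor>}"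
    proof
      fix n assume "n \<in> {n. real n * h \<le> T}"
      then have "real n \<le> T / h" using h by (simp add: pos_le_divide_eq)
      then show "n \<in> {..nat \<lfloor>T / h\<rfloor>}" by (simp add: le_nat_floor)
    qed
    then have "finite {n. real n * h \<le> T}" by (rule finite_subset) simp
    then show "finite (H h)" unfolding H_def by (rule finite_image_set)
  qed
  \<comment> \<open>H collects the iterates for all step sizes at once, so one C serves every step
    size.\<close>
  have "\<exists>C>0. \<forall>h. 0 < h \<and> h < T / 2 \<longrightarrow> (\<forall>\<xi>\<in>H h. \<forall>j.
      norm ((LINT t:{0..<h}|lborel. F h \<xi> j t - F h \<xi> (j - 1) t)
        - (flux_integral f (\<lambda>t. S t \<xi>) 0 h (half_pt lam h j) - flux_integral f (\<lambda>t. S t \<xi>) 0 h (half_pt lam h (j - 1))))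
      \<le> C * h powr (2 + q))"
    using assms(16) admissible unfolding consistent_of_order_def by (elim allE impE)
  then obtain C where C: "0 < C" and consistent: "\<forall>h. 0 < h \<and> h < T / 2 \<longrightarrow> (\<forall>\<xi>\<in>H h. \<forall>j.
      norm ((LINT t:{0..<h}|lborel. F h \<xi> j t - F h \<xi> (j - 1) t)
        - (flux_integral f (\<lambda>t. S t \<xi>) 0 h (half_pt lam h j) - flux_integral f (\<lambda>t. S t \<xi>) 0 h (half_pt lam h (j - 1))))
      \<le> C * h powr (2 + q))"
    by (elim exE conjE)
  have \<sigma>_solution: "solution f Ub nb Uc nc (\<kappa> m) (\<sigma> m n)" "AE x in lborel. \<sigma> m n 0 x = \<theta> m n x" for m n
    using assms(11)[OF \<kappa>(1,2), of m] \<theta>_V[of m n] unfolding short_time_solutions_def \<sigma>_def by blast+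
  interpret convergent_fv_scheme f T lam q C M \<kappa> \<nu> \<theta> \<sigma> v w
  proof
    fix e :: real assume e: "0 < e"
    from Y_lim[OF e]
    show "\<forall>\<^sub>F m in sequentially. \<forall>n\<le>\<nu> m. L1loc_dist (\<theta> m n) (v (real n * \<kappa> m)) < e"
    proof eventually_elim
      case (elim m)
      show ?case
      proof (intro allI impI)
        fix n assume "n \<le> \<nu> m"
        then have "real n * \<kappa> m \<le> real (\<nu> m) * \<kappa> m" using \<kappa>(1)[of m] by (intro mult_right_mono) auto
        then have "real n * \<kappa> m \<in> {0..T}" using \<kappa>(1)[of m] \<kappa>(3)[of m] by auto
        with elim have "L1loc_dist (Y m (real n * \<kappa> m)) (v (real n * \<kappa> m)) < e" by blast
        then show "L1loc_dist (\<theta> m n) (v (real n * \<kappa> m)) < e"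
          by (simp add: Y_def time_interpolant_grid[OF \<kappa>(1)])
      qed
    qed
  next
    fix r n :: "nat \<Rightarrow> nat" and \<tau> :: "nat \<Rightarrow> real" and t
    assume r: "strict_mono r" and n: "\<forall>i. n i < \<nu> (r i) \<and> 0 \<le> \<tau> i \<and> \<tau> i \<le> \<kappa> (r i)" and t: "t \<in> {0..T}"
      and d: "(\<lambda>i. L1loc_dist (\<theta> (r i) (n i)) (v t)) \<longlonglongrightarrow> 0"
    have "(\<lambda>i. \<kappa> (r i)) \<longlonglongrightarrow> 0"
      using LIMSEQ_subseq_LIMSEQ[OF \<kappa>_lim r] by (simp add: o_def)
    moreover have "\<forall>i. 0 < \<kappa> (r i) \<and> \<kappa> (r i) < T / 2 \<and> 0 \<le> \<tau> i \<and> \<tau> i \<le> \<kappa> (r i) \<and> \<theta> (r i) (n i) \<in> V (\<kappa> (r i)) \<and>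
        (AE x in lborel. norm (\<theta> (r i) (n i) x) \<le> M)"
      using \<kappa> n \<theta>_V \<theta>_bounded by (auto simp: less_imp_le)
    ultimately show "(\<exists>B. \<forall>i. AE x in lborel. norm (\<sigma> (r i) (n i) (\<tau> i) x) \<le> B) \<and>
        (\<lambda>i. L1loc_dist (\<sigma> (r i) (n i) (\<tau> i)) (v t)) \<longlonglongrightarrow> 0"
      using assms(12)[unfolded uniform_short_time_persistence_def, rule_format, OF v_L1loc[OF t],
          of "\<lambda>i. \<kappa> (r i)" \<tau> "\<lambda>i. \<theta> (r i) (n i)" M] d
      unfolding \<sigma>_def by blast
  next
    fix m n j assume n: "n < \<nu> m"
    let ?a = "half_pt lam (\<kappa> m) (j - 1)" and ?b = "half_pt lam (\<kappa> m) j"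
    have "real n * \<kappa> m \<le> real (\<nu> m) * \<kappa> m" using n \<kappa>(1)[of m] by (intro mult_right_mono) auto
    then have "\<theta> m n \<in> H (\<kappa> m)" using \<kappa>(3)[of m] by (auto simp: H_def \<theta>_def)
    note cons = consistent[rule_format, OF conjI[OF \<kappa>(1,2)] this, of j]
    \<comment> \<open>The scheme makes the change of mass minus the numerical flux difference, so
      the residual is the consistency error up to sign.\<close>
    have "(LINT x:{?a..?b}|lborel. \<theta> m (Suc n) x - \<theta> m n x)
        = - (LINT t:{0..<\<kappa> m}|lborel. F (\<kappa> m) (\<theta> m n) j t - F (\<kappa> m) (\<theta> m n) (j - 1) t)"
      unfolding set_integral_diff(2)[OF L1loc_integrable[OF \<theta>_L1loc] L1loc_integrable[OF \<theta>_L1loc]]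
      using fvs_iterate_conservation[OF assms(10)[OF \<kappa>(1,2)] assms(14)[OF \<kappa>(1,2)] u0, of m j n]
      by (simp add: set_integral_cell \<theta>_def)
    then show "norm ((LINT x:{?a..?b}|lborel. \<theta> m (Suc n) x - \<theta> m n x)
        + (flux_integral f (\<sigma> m n) 0 (\<kappa> m) ?b - flux_integral f (\<sigma> m n) 0 (\<kappa> m) ?a)) \<le> C * \<kappa> m powr (2 + q)"
      using cons unfolding \<sigma>_def by (simp add: norm_minus_commute)
  qed (use T lam assms(2,15) C \<kappa> \<kappa>_lim \<theta>_L1loc \<theta>_bounded limit(1) \<sigma>_solution w in \<open>auto simp: M_def solution_def\<close>)
  \<comment> \<open>Convergence in L1loc does not place \<open>v 0\<close> in the two Banach spaces;
    equality with \<open>u0\<close> almost everywhere does, since both spaces are closed under Borel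
    modification on null sets.\<close>
  have "AE x in lborel. v 0 x = u0 x"
  proof (rule cell_averages_limit)
    show "u0 \<in> L1loc" using u0 U_L1loc by blast
    show "v 0 \<in> L1loc" by (rule v_L1loc) (use T in simp)
    show "(\<lambda>m. L1loc_dist (\<theta> m 0) (v 0)) \<longlonglongrightarrow> 0"
      using \<theta>_dist_tendsto[of id "\<lambda>_. 0"] by (simp add: strict_mono_id)
    show "(LINT x:cell lam (\<kappa> m) j|lborel. \<theta> m 0 x) = (LINT x:cell lam (\<kappa> m) j|lborel. u0 x)" for m j
      using assms(10)[OF \<kappa>(1,2), of m] u0 unfolding fv_projection_def \<theta>_def by simp
  qed (use \<theta>_L1loc \<theta>_bounded \<kappa> \<kappa>_lim lam in auto)
  moreover have "v 0 \<in> borel_measurable borel"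
    by (rule L1loc_borel_measurable[OF v_L1loc]) (use T in simp)
  ultimately have "v 0 \<in> Ub \<inter> Uc"
    using u0 banach_function_space_AE_cong[OF assms(3)] banach_function_space_AE_cong[OF assms(4)] by blast
  with assms(6) limit(1) limit_Linf_bound limit_balance_law
  have "continuous_bounded_curve Ub nb Uc nc T v"
    unfolding persistence_space_def by blast
  with limit_balance_law show ?thesis by (simp add: solution_def)
qed

end
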